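(* Let $d\ge 2$ and $n\ge d+1$ be integers and let $\alpha>-1$. Let $X_1,\ldots,X_n$ be independent random points on the half-sphere $\mathbb{S}^d_+$, identically distributed with density $p_{\mathbf{S},\alpha}(y)=c_{\mathbf{S},\alpha}\,y_{d+1}^{\alpha}$, $y=(y_1,\dots,y_{d+1})\in\mathbb{S}^d_+$, with respect to the spherical Lebesgue measure on $\mathbb{S}^d_+$. Let $S_{n-1}$ and $S_n$ be the spherical convex hulls of $X_1,\dots,X_{n-1}$ and of $X_1,\dots,X_n$, respectively. Then $$\mathbb{E} f_{d-1}(S_n) > \mathbb{E} f_{d-1}(S_{n-1}).$$
   Context: $\mathbb{S}^d$ is the unit sphere in $\mathbb{R}^{d+1}$, and $\mathbb{S}^d_+=\{y=(y_1,\ldots,y_{d+1})\in\mathbb{S}^d:y_{d+1}>0\}$ is the open half-sphere. The spherical Lebesgue measure is the $d$-dimensional Hausdorff measure restricted to $\mathbb{S}^d_+$, and $c_{\mathbf{S},\alpha}>0$ is the constant making $p_{\mathbf{S},\alpha}$ a probability density. The spherical convex hull of finitely many points of $\mathbb{S}^d_+$ is the smallest spherically convex subset of $\mathbb{S}^d_+$ containing them; equivalently, it is the intersection of $\mathbb{S}^d$ with the convex cone generated by the points (the set of their linear combinations with non-negative coefficients). For such a spherical polytope $S$, $f_{d-1}(S)$ is the number of its facets, i.e. its $(d-1)$-dimensional faces; these are the intersections with $\mathbb{S}^d$ of the $d$-dimensional faces of the generated cone. If $S$ itself has dimension $d-1$ (which is almost surely the case for $S_{n-1}$ when $n=d+1$),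 then $S$ is counted as its own single $(d-1)$-dimensional face, so $f_{d-1}(S)=1$. *)

theory Defs
  imports "HOL-Probability.Probability"
begin

section \<open>Hausdorff measure\<close>

text \<open>
  The \<open>k\<close>-dimensional Hausdorff measure of a metric space, normalised so that a piece of
  diameter \<open>r\<close> costs as much as a \<open>k\<close>-dimensional ball of that diameter. The empty piece is
  free also for \<open>k = 0\<close>, where \<open>diameter {} ^ 0\<close> would be 1.
\<close>

definition hausdorff_cost :: "nat \<Rightarrow> 'a::metric_space set \<Rightarrow> ennreal" where
  "hausdorff_cost k U =
     (if U = {} then 0 else ennreal (unit_ball_vol (real k) * (diameter U / 2) ^ k))"

definition hausdorff_covers :: "real \<Rightarrow> 'a::metric_space set \<Rightarrow> (nat \<Rightarrow> 'a set) set" where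
  "hausdorff_covers \<delta> A = {U. A \<subseteq> (\<Union>i. U i) \<and> (\<forall>i. bounded (U i) \<and> diameter (U i) \<le> \<delta>)}"

definition hausdorff_pre :: "nat \<Rightarrow> real \<Rightarrow> 'a::metric_space set \<Rightarrow> ennreal" where
  "hausdorff_pre k \<delta> A = (INF U \<in> hausdorff_covers \<delta> A. \<Sum>i. hausdorff_cost k (U i))"

definition hausdorff_outer :: "nat \<Rightarrow> 'a::metric_space set \<Rightarrow> ennreal" where
  "hausdorff_outer k A = (SUP \<delta> \<in> {0<..}. hausdorff_pre k \<delta> A)"

definition hausdorff_measure :: "nat \<Rightarrow> 'a::metric_space measure" where
  "hausdorff_measure k = measure_of UNIV (sets borel) (hausdorff_outer k)"

text \<open>
  By convention \<open>measure_of\<close> yields the zero measure if its argument is not countably additive on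
  the given sets. The following lemmas (Caratheodory's criterion) show that this case does not
  occur: the Hausdorff measure of a Borel set is its Hausdorff outer measure.
\<close>

lemma hausdorff_cost_empty [simp]: "hausdorff_cost k {} = 0"
  by (simp add: hausdorff_cost_def)

lemma hausdorff_cost_mono:
  assumes "A \<subseteq> B" "bounded B"
  shows "hausdorff_cost k A \<le> hausdorff_cost k B"
proof (cases "A = {}")
  case False
  have "0 \<le> diameter A" "diameter A \<le> diameter B"
    using assms bounded_subset diameter_ge_0 diameter_subset by blast+
  then have "(diameter A / 2) ^ k \<le> (diameter B / 2) ^ k"
    by (intro power_mono) auto
  moreover have "0 \<le> unit_ball_vol (real k)"
    by (simp add: less_imp_le)
  ultimately show ?thesis
    using False assms by (auto simp: hausdorff_cost_def intro!: ennreal_leI mult_left_mono)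
qed simp

lemma hausdorff_pre_lower:
  "U \<in> hausdorff_covers \<delta> A \<Longrightarrow> hausdorff_pre k \<delta> A \<le> (\<Sum>i. hausdorff_cost k (U i))"
  unfolding hausdorff_pre_def by (rule INF_lower)

lemma hausdorff_pre_empty: "0 < \<delta> \<Longrightarrow> hausdorff_pre k \<delta> {} = 0"
  using hausdorff_pre_lower[of "\<lambda>_. {}" \<delta> "{}" k] by (simp add: hausdorff_covers_def)

lemma hausdorff_pre_mono: "A \<subseteq> B \<Longrightarrow> hausdorff_pre k \<delta> A \<le> hausdorff_pre k \<delta> B"
  unfolding hausdorff_pre_def by (rule INF_superset_mono) (auto simp: hausdorff_covers_def)

lemma hausdorff_pre_antimono: "\<delta> \<le> \<delta>' \<Longrightarrow> hausdorff_pre k \<delta>' A \<le> hausdorff_pre k \<delta> A"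
  unfolding hausdorff_pre_def
  by (rule INF_superset_mono) (auto simp: hausdorff_covers_def intro: order_trans)

lemma hausdorff_pre_countably_subadditive:
  "hausdorff_pre k \<delta> (\<Union>i. A i) \<le> (\<Sum>i::nat. hausdorff_pre k \<delta> (A i))"
proof (rule ennreal_le_epsilon)
  fix e :: real assume e: "0 < e" and fin: "(\<Sum>n. hausdorff_pre k \<delta> (A n)) < top"
  have "\<exists>U\<in>hausdorff_covers \<delta> (A n). (\<Sum>i. hausdorff_cost k (U i)) <
      hausdorff_pre k \<delta> (A n) + e * (1/2)^Suc n" for n
  proof -
    have "hausdorff_pre k \<delta> (A n) < hausdorff_pre k \<delta> (A n) + e * (1/2)^Suc n"
      using e fin by (auto simp: less_top dest!: ennreal_suminf_lessD)
    then show ?thesis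
      by (subst (asm) hausdorff_pre_def) (simp add: INF_less_iff)
  qed
  then obtain U where U: "\<And>n. U n \<in> hausdorff_covers \<delta> (A n)"
    "\<And>n. (\<Sum>i. hausdorff_cost k (U n i)) < hausdorff_pre k \<delta> (A n) + e * (1/2)^Suc n"
    by metis
  define V where "V = case_prod U o prod_decode"
  have "V \<in> hausdorff_covers \<delta> (\<Union>i. A i)"
    using U(1) by (auto simp: V_def hausdorff_covers_def subset_eq split_def)
      (metis fst_conv snd_conv prod_encode_inverse)
  then have "hausdorff_pre k \<delta> (\<Union>i. A i) \<le> (\<Sum>i. hausdorff_cost k (V i))"
    by (rule hausdorff_pre_lower)
  also have "\<dots> = (\<Sum>n. \<Sum>i. hausdorff_cost k (U n i))"
    unfolding V_def comp_def
    by (rule suminf_ennreal_2dimen[where f = "\<lambda>p. hausdorff_cost k (case_prod U p)"]) simp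
  also have "\<dots> \<le> (\<Sum>n. hausdorff_pre k \<delta> (A n) + e * (1/2) ^ Suc n)"
    using U(2) by (intro suminf_le) (auto intro: less_imp_le)
  also have "\<dots> = (\<Sum>n. hausdorff_pre k \<delta> (A n)) + (\<Sum>n. ennreal e * ennreal ((1/2) ^ Suc n))"
    using e by (subst suminf_add[symmetric])
      (auto simp del: ennreal_suminf_cmult simp add: ennreal_mult[symmetric])
  also have "\<dots> = (\<Sum>n. hausdorff_pre k \<delta> (A n)) + e"
    unfolding ennreal_suminf_cmult
    by (subst suminf_ennreal_eq[OF zero_le_power power_half_series]) auto
  finally show "hausdorff_pre k \<delta> (\<Union>i. A i) \<le> (\<Sum>n. hausdorff_pre k \<delta> (A n)) + e" .
qed

lemma hausdorff_pre_le_outer: "0 < \<delta> \<Longrightarrow> hausdorff_pre k \<delta> A \<le> hausdorff_outer k A"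
  unfolding hausdorff_outer_def by (rule SUP_upper) simp

lemma hausdorff_outer_empty [simp]: "hausdorff_outer k {} = 0"
  by (simp add: hausdorff_outer_def hausdorff_pre_empty)

lemma hausdorff_outer_mono: "A \<subseteq> B \<Longrightarrow> hausdorff_outer k A \<le> hausdorff_outer k B"
  unfolding hausdorff_outer_def by (intro SUP_mono) (auto intro: hausdorff_pre_mono)

lemma hausdorff_outer_countably_subadditive:
  "hausdorff_outer k (\<Union>i. A i) \<le> (\<Sum>i::nat. hausdorff_outer k (A i))"
  unfolding hausdorff_outer_def[of k "\<Union>i. A i"]
proof (rule SUP_least)
  fix \<delta> :: real assume "\<delta> \<in> {0<..}"
  then have "(\<Sum>i. hausdorff_pre k \<delta> (A i)) \<le> (\<Sum>i. hausdorff_outer k (A i))"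
    by (intro suminf_le) (auto intro: hausdorff_pre_le_outer)
  then show "hausdorff_pre k \<delta> (\<Union>i. A i) \<le> (\<Sum>i. hausdorff_outer k (A i))"
    using hausdorff_pre_countably_subadditive order_trans by blast
qed

lemma outer_measure_space_hausdorff: "outer_measure_space UNIV (hausdorff_outer k)"
  by (auto simp: outer_measure_space_def positive_def increasing_def countably_subadditive_def
      hausdorff_outer_mono hausdorff_outer_countably_subadditive)

lemma hausdorff_outer_Un: "hausdorff_outer k (A \<union> B) \<le> hausdorff_outer k A + hausdorff_outer k B"
proof -
  have "subadditive UNIV (hausdorff_outer k :: 'a set \<Rightarrow> ennreal)"
    using outer_measure_space_hausdorff[of k] ring_of_sets_Pow[of UNIV]
    by (auto simp: outer_measure_space_def intro: ring_of_sets.countably_subadditive_subadditive)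
  then have disj: "A \<inter> C = {} \<Longrightarrow> hausdorff_outer k (A \<union> C) \<le> hausdorff_outer k A + hausdorff_outer k C"
    for C by (auto simp: subadditive_def)
  show ?thesis
    using disj[of "B - A"] hausdorff_outer_mono[of "B - A" B k]
    by (simp add: add_left_mono order_trans)
qed

lemma hausdorff_outer_separated:
  assumes "0 < e" and sep: "\<And>a b. a \<in> A \<Longrightarrow> b \<in> B \<Longrightarrow> e \<le> dist a b"
  shows "hausdorff_outer k A + hausdorff_outer k B \<le> hausdorff_outer k (A \<union> B)"
proof -
  have *: "hausdorff_pre k \<delta>1 A + hausdorff_pre k \<delta>2 B \<le> hausdorff_outer k (A \<union> B)"
    if "0 < \<delta>1" "0 < \<delta>2" for \<delta>1 \<delta>2
  proof -
    define \<delta> where "\<delta> = min (min \<delta>1 \<delta>2) (e / 2)"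
    have \<delta>: "0 < \<delta>" "\<delta> \<le> \<delta>1" "\<delta> \<le> \<delta>2" "\<delta> < e"
      using that \<open>0 < e\<close> by (auto simp: \<delta>_def)
    have "hausdorff_pre k \<delta> A + hausdorff_pre k \<delta> B \<le> hausdorff_pre k \<delta> (A \<union> B)"
      unfolding hausdorff_pre_def[of k \<delta> "A \<union> B"]
    proof (rule INF_greatest)
      fix U assume U: "U \<in> hausdorff_covers \<delta> (A \<union> B)"
      then have bd: "bounded (U i)" "diameter (U i) \<le> \<delta>" for i
        by (auto simp: hausdorff_covers_def)
      have cov: "(\<lambda>i. U i \<inter> A) \<in> hausdorff_covers \<delta> A" "(\<lambda>i. U i \<inter> B) \<in> hausdorff_covers \<delta> B"
        using U by (auto simp: hausdorff_covers_def bounded_Int intro: order_trans[OF diameter_subset])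
      have "hausdorff_cost k (U i \<inter> A) + hausdorff_cost k (U i \<inter> B) \<le> hausdorff_cost k (U i)" for i
      proof -
        have "U i \<inter> A = {} \<or> U i \<inter> B = {}"
        proof (rule ccontr)
          assume "\<not> ?thesis"
          then obtain a b where "a \<in> U i" "a \<in> A" "b \<in> U i" "b \<in> B" by auto
          then show False
            using sep[of a b] diameter_bounded_bound[OF bd(1), of a i b] bd(2)[of i] \<delta>(4) by simp
        qed
        then show ?thesis
          using hausdorff_cost_mono[OF _ bd(1)[of i], of "U i \<inter> A" k]
            hausdorff_cost_mono[OF _ bd(1)[of i], of "U i \<inter> B" k] by auto
      qed
      then have "(\<Sum>i. hausdorff_cost k (U i \<inter> A) + hausdorff_cost k (U i \<inter> B))
          \<le> (\<Sum>i. hausdorff_cost k (U i))"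
        by (intro suminf_le) auto
      moreover have "(\<Sum>i. hausdorff_cost k (U i \<inter> A) + hausdorff_cost k (U i \<inter> B)) =
          (\<Sum>i. hausdorff_cost k (U i \<inter> A)) + (\<Sum>i. hausdorff_cost k (U i \<inter> B))"
        by (rule suminf_add[symmetric]) auto
      ultimately show "hausdorff_pre k \<delta> A + hausdorff_pre k \<delta> B \<le> (\<Sum>i. hausdorff_cost k (U i))"
        using add_mono[OF cov[THEN hausdorff_pre_lower[of _ _ _ k]]] by simp
    qed
    then show ?thesis
      using add_mono[OF hausdorff_pre_antimono[OF \<delta>(2), of k A] hausdorff_pre_antimono[OF \<delta>(3), of k B]]
        hausdorff_pre_le_outer[OF \<delta>(1), of k "A \<union> B"] by (meson order_trans)
  qed
  have ne: "{0::real<..} \<noteq> {}" by (simp add: greaterThan_non_empty)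
  have "hausdorff_outer k A + hausdorff_pre k \<delta>2 B \<le> hausdorff_outer k (A \<union> B)" if "0 < \<delta>2" for \<delta>2
    unfolding hausdorff_outer_def[of k A] ennreal_SUP_add_left[OF ne, symmetric]
    by (rule SUP_least) (use * that in auto)
  then show ?thesis
    unfolding hausdorff_outer_def[of k B] ennreal_SUP_add_right[OF ne]
    by (intro SUP_least) auto
qed

lemma hausdorff_outer_closed:
  assumes "closed C"
  shows "hausdorff_outer k (T \<inter> C) + hausdorff_outer k (T - C) = hausdorff_outer k T"
proof (rule antisym)
  let ?H = "hausdorff_outer k"
  have "T = (T \<inter> C) \<union> (T - C)" by blast
  then show "?H T \<le> ?H (T \<inter> C) + ?H (T - C)"
    using hausdorff_outer_Un by metis
  show "?H (T \<inter> C) + ?H (T - C) \<le> ?H T"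
  proof (cases "C = {} \<or> ?H T = top")
    case True
    then show ?thesis by auto
  next
    case False
    then have "C \<noteq> {}" and fin: "?H T < top"
      by (auto simp: less_top)
    define r where "r = (\<lambda>n::nat. 1 / (real n + 1))"
    have r_pos: "0 < r n" for n by (simp add: r_def)
    have r_mono: "m \<le> n \<Longrightarrow> r n \<le> r m" for m n by (simp add: r_def frac_le)
    define R where "R = (\<lambda>n. {x \<in> T. r (Suc n) \<le> infdist x C \<and> infdist x C < r n})"
    have sepR: "?H S + ?H (R j) \<le> ?H (S \<union> R j)"
      if S: "S \<subseteq> T" "\<And>x. x \<in> S \<Longrightarrow> r (j - 1) \<le> infdist x C" and "1 \<le> j" for S j
    proof (rule hausdorff_outer_separated)
      show "0 < r (j - 1) - r j"
        using \<open>1 \<le> j\<close> by (simp add: r_def of_nat_diff frac_less2)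
      fix a b assume "a \<in> S" "b \<in> R j"
      then show "r (j - 1) - r j \<le> dist a b"
        using S(2)[of a] infdist_triangle[of a C b] by (auto simp: R_def)
    qed
    have parity: "(\<Sum>i<m. ?H (R (2 * i + p))) \<le> ?H (\<Union>i<m. R (2 * i + p))" for p m
    proof (induction m)
      case (Suc m)
      show ?case
      proof (cases "m = 0")
        case False
        have "?H (\<Union>i<m. R (2 * i + p)) + ?H (R (2 * m + p)) \<le>
            ?H ((\<Union>i<m. R (2 * i + p)) \<union> R (2 * m + p))"
        proof (rule sepR)
          fix x assume "x \<in> (\<Union>i<m. R (2 * i + p))"
          then obtain i where i: "i < m" "r (Suc (2 * i + p)) \<le> infdist x C"
            by (auto simp: R_def)
          then have "Suc (2 * i + p) \<le> 2 * m + p - 1" by linarith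
          from r_mono[OF this] i(2) show "r (2 * m + p - 1) \<le> infdist x C"
            by (rule order_trans)
        qed (use False in \<open>auto simp: R_def\<close>)
        moreover have "(\<Union>i<Suc m. R (2 * i + p)) = (\<Union>i<m. R (2 * i + p)) \<union> R (2 * m + p)"
          by (auto simp: lessThan_Suc)
        ultimately show ?thesis
          using Suc by (simp add: add_mono order_trans[OF add_right_mono])
      qed (simp add: lessThan_Suc)
    qed simp
    have partial: "(\<Sum>i<m. ?H (R i)) \<le> ?H T + ?H T" for m
    proof -
      have "(\<Sum>i<m. ?H (R i)) \<le> (\<Sum>i<2 * m. ?H (R i))"
        by (intro sum_mono2) auto
      also have "\<dots> = (\<Sum>i<m. ?H (R (2 * i + 0))) + (\<Sum>i<m. ?H (R (2 * i + 1)))"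
        by (induction m) (auto simp: ac_simps)
      also have "\<dots> \<le> ?H T + ?H T"
        by (intro add_mono order_trans[OF parity] hausdorff_outer_mono) (auto simp: R_def)
      finally show ?thesis .
    qed
    have "(\<Sum>i. ?H (R i)) \<le> ?H T + ?H T"
      by (intro suminf_le_const summableI partial)
    then have finR: "(\<Sum>i. ?H (R i)) < top"
      using fin by (auto simp: less_top[symmetric] top_unique)
    show ?thesis
    proof (rule ennreal_le_epsilon)
      fix e :: real assume "0 < e"
      obtain n where n: "(\<Sum>i. ?H (R (i + n))) < e"
      proof -
        have "(\<lambda>n. \<Sum>i<n. ?H (R i)) \<longlonglongrightarrow> (\<Sum>i. ?H (R i))"
          by (rule summable_LIMSEQ) simp
        then have "((\<lambda>n. (\<Sum>i. ?H (R i)) - (\<Sum>i<n. ?H (R i))) \<longlongrightarrow>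
            (\<Sum>i. ?H (R i)) - (\<Sum>i. ?H (R i))) sequentially"
          using finR by (intro tendsto_diff_ennreal tendsto_const) auto
        then have "((\<lambda>n. (\<Sum>i. ?H (R i)) - (\<Sum>i<n. ?H (R i))) \<longlongrightarrow> 0) sequentially"
          using finR by (simp add: ennreal_minus_cancel)
        then obtain n where "(\<Sum>i. ?H (R i)) - (\<Sum>i<n. ?H (R i)) < e"
          using \<open>0 < e\<close> order_tendstoD(2)[of _ 0 sequentially "ennreal e"]
          by (force simp: eventually_sequentially)
        moreover have "(\<Sum>i. ?H (R i)) - (\<Sum>i<n. ?H (R i)) = (\<Sum>i. ?H (R (i + n)))"
        proof -
          have "(\<Sum>i. ?H (R i)) = (\<Sum>i. ?H (R (i + n))) + (\<Sum>i<n. ?H (R i))"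
            by (rule suminf_offset) simp
          moreover have "(\<Sum>i<n. ?H (R i)) \<noteq> top"
            using le_less_trans[OF partial[of n], of top] fin by (simp add: less_top[symmetric])
          ultimately show ?thesis by simp
        qed
        ultimately show thesis using that by simp
      qed
      define Tn where "Tn = {x \<in> T. r n \<le> infdist x C}"
      have "T - C \<subseteq> Tn \<union> (\<Union>i. R (i + n))"
      proof
        fix x assume x: "x \<in> T - C"
        then have "0 < infdist x C"
          using \<open>closed C\<close> \<open>C \<noteq> {}\<close> in_closed_iff_infdist_zero[of C x] infdist_nonneg[of x C] by force
        then have ex: "\<exists>m. r m \<le> infdist x C"
          using reals_Archimedean[of "infdist x C"]
          by (auto simp: r_def inverse_eq_divide add.commute intro: less_imp_le)
        define m where "m = (LEAST m. r m \<le> infdist x C)"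
        have m: "r m \<le> infdist x C" unfolding m_def using ex by (rule LeastI_ex)
        show "x \<in> Tn \<union> (\<Union>i. R (i + n))"
        proof (cases "m \<le> n")
          case True
          then show ?thesis
            using m r_mono[OF True] x by (auto simp: Tn_def)
        next
          case False
          then have "infdist x C < r (m - 1)"
            using not_less_Least[of "m - 1" "\<lambda>m. r m \<le> infdist x C"] by (simp add: m_def not_le)
          then have "x \<in> R (m - 1 - n + n)"
            using False m x by (simp add: R_def)
          then show ?thesis by blast
        qed
      qed
      then have "?H (T - C) \<le> ?H Tn + ?H (\<Union>i. R (i + n))"
        by (rule order_trans[OF hausdorff_outer_mono hausdorff_outer_Un])
      also have "\<dots> \<le> ?H Tn + e"
        using hausdorff_outer_countably_subadditive[of k "\<lambda>i. R (i + n)"] n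
        by (intro add_left_mono) simp
      finally have "?H (T \<inter> C) + ?H (T - C) \<le> (?H (T \<inter> C) + ?H Tn) + e"
        by (metis add.assoc add_left_mono)
      also have "?H (T \<inter> C) + ?H Tn \<le> ?H ((T \<inter> C) \<union> Tn)"
      proof (rule hausdorff_outer_separated[OF r_pos[of n]])
        fix a b assume "a \<in> T \<inter> C" "b \<in> Tn"
        then show "r n \<le> dist a b"
          using infdist_le[of a C b] by (auto simp: Tn_def dist_commute)
      qed
      also have "\<dots> \<le> ?H T"
        by (rule hausdorff_outer_mono) (auto simp: Tn_def)
      finally show "?H (T \<inter> C) + ?H (T - C) \<le> ?H T + e"
        by (simp add: add_right_mono)
    qed
  qed
qed

lemma measure_space_hausdorff: "measure_space UNIV (sets borel) (hausdorff_outer k)"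
proof -
  interpret P: sigma_algebra UNIV "UNIV :: 'a set set"
    using sigma_algebra_Pow[of UNIV] by simp
  let ?L = "lambda_system UNIV UNIV (hausdorff_outer k) :: 'a set set"
  have L: "measure_space UNIV ?L (hausdorff_outer k)"
    by (rule P.caratheodory_lemma[OF outer_measure_space_hausdorff])
  have "Collect closed \<subseteq> ?L"
    using hausdorff_outer_closed[of _ k] by (auto simp: P.lambda_system_eq)
  then have "sets borel \<subseteq> ?L"
    using L by (simp add: borel_eq_closed measure_space_def sigma_algebra.sigma_sets_subset)
  then show ?thesis
    using measure_down[OF L] sets.sigma_algebra_axioms[of "borel :: 'a measure"] by simp
qed

lemma space_hausdorff_measure [simp]: "space (hausdorff_measure k) = UNIV"
  by (simp add: hausdorff_measure_def space_measure_of_conv)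

lemma sets_hausdorff_measure [simp, measurable_cong]: "sets (hausdorff_measure k) = sets borel"
  using sets.sigma_sets_eq[of "borel :: 'a measure"] by (simp add: hausdorff_measure_def)

lemma emeasure_hausdorff_measure:
  "A \<in> sets borel \<Longrightarrow> emeasure (hausdorff_measure k) A = hausdorff_outer k A"
  using measure_space_hausdorff[of k]
  by (subst hausdorff_measure_def, subst emeasure_measure_of_sigma)
    (auto simp: measure_space_def)


section \<open>Spherical polytopes in the half-sphere\<close>

text \<open>
  \<open>\<real>\<^bsup>d+1\<^esup>\<close> is the Euclidean space \<open>(real^'d) \<times> real\<close> with \<open>d = CARD('d)\<close>. The last coordinate
  \<open>y\<^bsub>d+1\<^esub>\<close> of \<open>y\<close> is \<open>snd y\<close>, and the norm of the product type is the Euclidean one.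
\<close>

definition half_sphere :: "((real^'d) \<times> real) set" where
  "half_sphere = {y \<in> sphere 0 1. snd y > 0}"

definition spherical_lebesgue :: "((real^'d) \<times> real) measure" where
  "spherical_lebesgue = restrict_space (hausdorff_measure CARD('d)) half_sphere"

text \<open>
  The factor in front of the power is the normalising constant. It is determined by the dimension
  and \<open>\<alpha>\<close>; the integral is finite and positive for \<open>\<alpha> > -1\<close>.
\<close>

definition spherical_density :: "real \<Rightarrow> (real^'d) \<times> real \<Rightarrow> real" where
  "spherical_density \<alpha> y =
     (1 / (\<integral>z. snd z powr \<alpha> \<partial>(spherical_lebesgue :: ((real^'d) \<times> real) measure))) * snd y powr \<alpha>"

definition spherical_hull :: "((real^'d) \<times> real) set \<Rightarrow> ((real^'d) \<times> real) set" where
  "spherical_hull A = sphere 0 1 \<inter> (convex_cone hull A)"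

text \<open>
  The \<open>k\<close>-dimensional faces of a spherical polytope are the traces on the sphere of the
  \<open>(k+1)\<close>-dimensional faces of the cone it generates. As \<^const>\<open>face_of\<close> is reflexive, a polytope
  of dimension \<open>k\<close> is its own single \<open>k\<close>-dimensional face.
\<close>

definition spherical_faces :: "nat \<Rightarrow> ((real^'d) \<times> real) set \<Rightarrow> ((real^'d) \<times> real) set set" where
  "spherical_faces k S =
     {sphere 0 1 \<inter> F | F. F face_of (convex_cone hull S) \<and> aff_dim F = int k + 1}"

definition f_number :: "nat \<Rightarrow> ((real^'d) \<times> real) set \<Rightarrow> nat" where
  "f_number k S = card (spherical_faces k S)"

end

theory Submission
  imports Defs "HOL-Real_Asymp.Real_Asymp"
begin

text \<open>
  Write \<open>d = CARD('d)\<close>. Uniqueness of uniformly distributed measures identifies the Hausdorff measure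
  on the sphere with a multiple of the law of the direction of a rotation-invariant vector. Hence the
  points \<open>X\<^sub>i\<close> may be replaced by independent points \<open>(G\<^sub>i, T\<^sub>i)\<close>, where \<open>G\<^sub>i\<close> is standard Gaussian in
  \<open>\<real>\<^sup>d\<close> and \<open>T\<^sub>i > 0\<close> has density proportional to \<open>t powr \<alpha> * exp (- t\<^sup>2 / 2)\<close>. Almost surely a facet is
  given by \<open>d\<close> points such that all others lie on one side of their hyperplane \<open>{(g, t). g \<bullet> a = t}\<close>.
  Given these \<open>d\<close> points, one side has mass \<open>V (1 / norm a)\<close>, where \<open>V\<close> is the distribution function of
  \<open>N / T\<close> with \<open>N\<close> standard normal, and \<open>1 / norm a\<close> is distributed like
  \<open>\<bar>N\<bar> / norm (T\<^sub>1, \<dots>, T\<^sub>d)\<close>. Both ratios follow Student distributions, so the expected number of facets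
  for \<open>n > d\<close> points is \<open>2 * (n choose d)\<close> times the integral of \<open>V ^ (n - d)\<close> against a Student
  distribution, whose density is \<open>V' * L ^ (d - 1)\<close> up to a constant, where \<open>L\<close> is strictly concave as a
  function of \<open>V\<close> and vanishes at \<open>V = 1\<close>. Comparing \<open>L\<close> with a linear function, for which the two
  expectations coincide, yields the strict inequality. For \<open>n = d + 1\<close>, the hull of \<open>d\<close> points has at
  most one facet.
\<close>

section \<open>Uniformly distributed measures\<close>

text \<open>Facet numbers depend only on the rays through the points, so any law on the upper
  half-space with the right directions may replace the given one. The density
  \<open>t powr \<alpha> * exp (- norm z ^ 2 / 2)\<close> is a power of the height times a radial
  factor, so its direction has density proportional to the height to the power
  \<open>\<alpha>\<close>, and it makes height and horizontal part independent. That the Hausdorff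
  measure of the sphere is finite and positive is read off from the assumed probability density; its
  value is never computed. With \<open>k = n - d\<close> and \<open>I k\<close> the integral of
  \<open>V ^ k\<close>, the identity \<open>k * (n choose d) = n * (n - 1 choose d)\<close> reduces
  the claim to \<open>k * I (k - 1) < (k + d) * I k\<close>. For the weight
  \<open>V' * (1 - V) ^ (d - 1)\<close> this is an equality, because
  \<open>V ^ k * (1 - V) ^ d\<close> vanishes at both ends. The true weight carries the additional
  increasing factor \<open>(L / (1 - V)) ^ (d - 1)\<close>, while \<open>(k + d) * V - k\<close>
  changes sign once, from minus to plus. For \<open>n = d + 1\<close> the general formula is false
  for the \<open>n - 1\<close> points, where it would count both empty sides of the only
  hyperplane.\<close>

lemma liminf_mult_le_ennreal:
  fixes a b :: "nat \<Rightarrow> ennreal"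
  assumes "\<And>n. a n * b n \<le> K"
  shows "liminf a * liminf b \<le> K"
proof -
  \<comment> \<open>A product of two tail infima is at most the product of the terms at the later
    starting index.\<close>
  have *: "(INF m\<in>{i..}. a m) * (INF m\<in>{j..}. b m) \<le> K" for i j
  proof -
    have "(INF m\<in>{i..}. a m) * (INF m\<in>{j..}. b m) \<le> a (max i j) * b (max i j)"
      by (intro mult_mono INF_lower) auto
    then show ?thesis using assms order_trans by blast
  qed
  show ?thesis
    unfolding liminf_SUP_INF SUP_mult_left_ennreal SUP_mult_right_ennreal
    by (intro SUP_least *)
qed

text \<open>For x in U and S the quotient of \<open>\<nu> (U \<inter> ball x r)\<close> and
  \<open>k r\<close> is eventually 1 as r shrinks, so Fatou's lemma bounds \<open>\<mu> U\<close> by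
  the lower limit of its integrals. As \<open>dist x y < r\<close> is symmetric, exchanging the
  integrals evaluates them as \<open>h r / k r * \<nu> U\<close>. Whether \<open>h r / k r\<close>
  converges is left open, hence the \<open>liminf\<close>.\<close>

lemma uniform_balls_open_le:
  fixes \<mu> \<nu> :: "'a::{metric_space, second_countable_topology} measure"
  assumes sf: "sigma_finite_measure \<mu>" "sigma_finite_measure \<nu>"
    and sets[measurable_cong]: "sets \<mu> = sets borel" "sets \<nu> = sets borel"
    and S: "AE x in \<mu>. x \<in> S" "AE x in \<nu>. x \<in> S"
    and h: "\<And>x r. x \<in> S \<Longrightarrow> 0 < r \<Longrightarrow> emeasure \<mu> (ball x r) = h r"
    and k: "\<And>x r. x \<in> S \<Longrightarrow> 0 < r \<Longrightarrow> emeasure \<nu> (ball x r) = k r"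
    and k0: "\<And>r. 0 < r \<Longrightarrow> 0 < k r \<and> k r < \<infinity>"
    and U: "open U"
  shows "emeasure \<mu> U \<le> liminf (\<lambda>n. h (1 / Suc n) / k (1 / Suc n) * emeasure \<nu> U)"
proof -
  interpret M: sigma_finite_measure \<mu> by fact
  interpret N: sigma_finite_measure \<nu> by fact
  interpret P: pair_sigma_finite \<mu> \<nu> ..
  note [measurable] = borel_open[OF U]
  define r where "r n = 1 / real (Suc n)" for n
  have r0: "r n > 0" for n by (simp add: r_def)
  define G where "G n x y = (indicator {y. dist x y < r n \<and> y \<in> U} y :: ennreal)" for n x y
  have G_m[measurable]: "case_prod (G n) \<in> borel_measurable (borel \<Otimes>\<^sub>M borel)" for n
  proof -
    have "{p \<in> space (borel \<Otimes>\<^sub>M (borel :: 'a measure)). dist (fst p) (snd p) < r n \<and> snd p \<in> U}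
        \<in> sets (borel \<Otimes>\<^sub>M borel)" by measurable
    then have "{p::'a\<times>'a. dist (fst p) (snd p) < r n \<and> snd p \<in> U} \<in> sets (borel \<Otimes>\<^sub>M borel)"
      by (simp add: space_pair_measure)
    then have "indicator {p::'a\<times>'a. dist (fst p) (snd p) < r n \<and> snd p \<in> U}
        \<in> borel_measurable (borel \<Otimes>\<^sub>M (borel :: 'a measure) :: ('a\<times>'a) measure)"
      by (rule borel_measurable_indicator)
    also have "indicator {p::'a\<times>'a. dist (fst p) (snd p) < r n \<and> snd p \<in> U} = case_prod (G n)"
      by (auto simp: G_def fun_eq_iff indicator_def)
    finally show ?thesis .
  qed
  have G_m'[measurable]: "case_prod (G n) \<in> borel_measurable (\<mu> \<Otimes>\<^sub>M \<nu>)" for n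
    using G_m measurable_cong_sets[OF sets_pair_measure_cong[OF sets] refl] by blast
  define f where "f n x = (\<integral>\<^sup>+y. G n x y \<partial>\<nu>) / k (r n)" for n x
  have f_m[measurable]: "f n \<in> borel_measurable \<mu>" for n
    unfolding f_def by measurable
  have fU: "f n x = emeasure \<nu> (U \<inter> ball x (r n)) / k (r n)" for n x
  proof -
    have "(\<integral>\<^sup>+y. G n x y \<partial>\<nu>) = (\<integral>\<^sup>+y. indicator (U \<inter> ball x (r n)) y \<partial>\<nu>)"
      by (intro nn_integral_cong) (auto simp: G_def indicator_def)
    then show ?thesis by (simp add: f_def)
  qed
  have "emeasure \<mu> U = (\<integral>\<^sup>+x. indicator U x \<partial>\<mu>)" by simp
  also have "\<dots> \<le> (\<integral>\<^sup>+x. liminf (\<lambda>n. f n x) \<partial>\<mu>)"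
  proof (rule nn_integral_mono_AE, use S(1) in eventually_elim)
    fix x assume "x \<in> S"
    show "indicator U x \<le> liminf (\<lambda>n. f n x)"
    proof (cases "x \<in> U")
      case True
      then obtain e where e: "e > 0" "ball x e \<subseteq> U" using U openE by blast
      have "eventually (\<lambda>n. r n < e) sequentially"
        using order_tendstoD(2)[OF LIMSEQ_inverse_real_of_nat \<open>e > 0\<close>]
        by (simp add: r_def inverse_eq_divide)
      then have "eventually (\<lambda>n. f n x = 1) sequentially"
      proof eventually_elim
        case (elim n)
        then have "U \<inter> ball x (r n) = ball x (r n)" using e by auto
        then show ?case using k[OF \<open>x \<in> S\<close> r0[of n]] k0[OF r0[of n]] unfolding fU
            by (metis ennreal_divide_self infinity_ennreal_def less_irrefl)
      qed
      then have "liminf (\<lambda>n. f n x) = liminf (\<lambda>n. 1)" by (rule Liminf_eq)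
      then show ?thesis by (simp add: Liminf_const indicator_def)
    qed simp
  qed
  also have "\<dots> \<le> liminf (\<lambda>n. \<integral>\<^sup>+x. f n x \<partial>\<mu>)"
    by (rule nn_integral_liminf) measurable
  also have "(\<lambda>n. \<integral>\<^sup>+x. f n x \<partial>\<mu>) = (\<lambda>n. h (1 / Suc n) / k (1 / Suc n) * emeasure \<nu> U)"
  proof
    fix n
    have "(\<integral>\<^sup>+x. f n x \<partial>\<mu>) = (\<integral>\<^sup>+x. (\<integral>\<^sup>+y. G n x y \<partial>\<nu>) \<partial>\<mu>) / k (r n)"
      unfolding f_def by (rule nn_integral_divide) measurable
    also have "(\<integral>\<^sup>+x. (\<integral>\<^sup>+y. G n x y \<partial>\<nu>) \<partial>\<mu>) = (\<integral>\<^sup>+y. (\<integral>\<^sup>+x. G n x y \<partial>\<mu>) \<partial>\<nu>)"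
      by (rule P.Fubini'[symmetric]) measurable
    also have "\<dots> = (\<integral>\<^sup>+y. h (r n) * indicator U y \<partial>\<nu>)"
    proof (rule nn_integral_cong_AE, use S(2) in eventually_elim)
      fix y assume y: "y \<in> S"
      have "(\<integral>\<^sup>+x. G n x y \<partial>\<mu>) = (\<integral>\<^sup>+x. indicator U y * indicator (ball y (r n)) x \<partial>\<mu>)"
        by (intro nn_integral_cong) (auto simp: G_def indicator_def dist_commute)
      also have "\<dots> = indicator U y * emeasure \<mu> (ball y (r n))"
        by (rule nn_integral_cmult_indicator) (simp add: sets)
      finally show "(\<integral>\<^sup>+x. G n x y \<partial>\<mu>) = h (r n) * indicator U y"
        using h[OF y r0[of n]] by (simp add: mult.commute)
    qed
    also have "\<dots> = h (r n) * emeasure \<nu> U" by (simp add: nn_integral_cmult)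
    finally show "(\<integral>\<^sup>+x. f n x \<partial>\<mu>) = h (1 / Suc n) / k (1 / Suc n) * emeasure \<nu> U"
      by (simp add: r_def divide_ennreal_def ac_simps)
  qed
  finally show ?thesis .
qed

lemma UN_ball_nat: "(\<Union>n. ball (a::'a::metric_space) (real n)) = UNIV"
proof (intro equalityI subset_UNIV subsetI)
  fix x show "x \<in> (\<Union>n. ball a (real n))"
    using reals_Archimedean2[of "dist a x"] by auto
qed

lemma measure_eqI_open:
  fixes \<mu> \<nu> :: "'a::metric_space measure"
  assumes "sets \<mu> = sets borel" "sets \<nu> = sets borel"
    and eq: "\<And>U. open U \<Longrightarrow> emeasure \<mu> U = emeasure \<nu> U"
    and fin: "\<And>r. emeasure \<mu> (ball a r) < \<infinity>"
  shows "\<mu> = \<nu>"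
proof (rule measure_eqI_generator_eq[where E="Collect open" and \<Omega>=UNIV and A="\<lambda>n. ball a (real n)"])
  show "sets \<mu> = sigma_sets UNIV (Collect open)" "sets \<nu> = sigma_sets UNIV (Collect open)"
    by (simp_all add: assms(1,2) sets_borel)
  show "emeasure \<mu> (ball a (real i)) \<noteq> \<infinity>" for i
    using fin[of "real i"] by simp
  show "(\<Union>i. ball a (real i)) = UNIV"
    by (rule UN_ball_nat)
qed (auto simp: Int_stable_def eq)

text \<open>Christensen's argument for the uniqueness of uniformly distributed measures.\<close>

lemma uniform_balls_proportional:
  fixes \<mu> \<nu> :: "'a::{metric_space, second_countable_topology} measure"
  assumes fin: "finite_measure \<mu>" "finite_measure \<nu>"
    and sets: "sets \<mu> = sets borel" "sets \<nu> = sets borel"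
    and S: "AE x in \<mu>. x \<in> S" "AE x in \<nu>. x \<in> S"
    and h: "\<And>x r. x \<in> S \<Longrightarrow> 0 < r \<Longrightarrow> emeasure \<mu> (ball x r) = h r"
    and k: "\<And>x r. x \<in> S \<Longrightarrow> 0 < r \<Longrightarrow> emeasure \<nu> (ball x r) = k r"
    and h0: "\<And>r. 0 < r \<Longrightarrow> 0 < h r \<and> h r < \<infinity>"
    and k0: "\<And>r. 0 < r \<Longrightarrow> 0 < k r \<and> k r < \<infinity>"
    and pos: "emeasure \<mu> UNIV > 0"
  shows "\<mu> = scale_measure (emeasure \<mu> UNIV / emeasure \<nu> UNIV) \<nu>"
proof -
  interpret M: finite_measure \<mu> by fact
  interpret N: finite_measure \<nu> by fact
  note sfm = M.sigma_finite_measure N.sigma_finite_measure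
  have prod: "emeasure \<mu> U * emeasure \<nu> V = emeasure \<nu> U * emeasure \<mu> V" if UV: "open U" "open V" for U V
  proof -
    have *: "h r / k r * (k r / h r) = 1" if "r > 0" for r
    proof -
      have "h r / k r * (k r / h r) = (h r / h r) * (k r / k r)"
        by (simp add: divide_ennreal_def ac_simps)
      then show ?thesis using h0[OF that] k0[OF that]
        by (metis ennreal_divide_self infinity_ennreal_def less_irrefl mult_1)
    qed
    \<comment> \<open>The unknown behaviour of \<open>h r / k r\<close> cancels: the bound for
      \<open>\<mu> U\<close> is multiplied by the bound for \<open>\<nu> V\<close> with the measures
      exchanged, and at each radius the two quotients have product 1.\<close>
    have le: "emeasure \<mu> U * emeasure \<nu> V \<le> emeasure \<nu> U * emeasure \<mu> V" if "open U" "open V" for U V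
    proof -
      have "emeasure \<mu> U * emeasure \<nu> V \<le>
        liminf (\<lambda>n. h (1 / Suc n) / k (1 / Suc n) * emeasure \<nu> U) *
        liminf (\<lambda>n. k (1 / Suc n) / h (1 / Suc n) * emeasure \<mu> V)"
        by (intro mult_mono uniform_balls_open_le[where h=h and k=k, OF sfm sets S h k k0]
            uniform_balls_open_le[where h=k and k=h, OF sfm(2,1) sets(2,1) S(2,1) k h h0] that) auto
      also have "\<dots> \<le> emeasure \<nu> U * emeasure \<mu> V"
      proof (rule liminf_mult_le_ennreal)
        fix n
        have "h (1 / Suc n) / k (1 / Suc n) * emeasure \<nu> U * (k (1 / Suc n) / h (1 / Suc n) * emeasure \<mu> V)
          = (h (1 / Suc n) / k (1 / Suc n) * (k (1 / Suc n) / h (1 / Suc n))) * (emeasure \<nu> U * emeasure \<mu> V)"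
          by (simp only: ac_simps)
        then show "h (1 / Suc n) / k (1 / Suc n) * emeasure \<nu> U * (k (1 / Suc n) / h (1 / Suc n) * emeasure \<mu> V)
           \<le> emeasure \<nu> U * emeasure \<mu> V"
          by (simp add: *)
      qed
      finally show ?thesis .
    qed
    show ?thesis
      using le[OF UV] le[OF UV(2,1)] by (simp add: mult.commute)
  qed
  have nu_pos: "emeasure \<nu> UNIV \<noteq> 0"
  proof
    assume 0: "emeasure \<nu> UNIV = 0"
    obtain x where "x \<in> S"
    proof (rule ccontr)
      assume "\<not> thesis"
      then have "\<And>x. x \<notin> S" using that by blast
      then have "AE x in \<mu>. \<not> True" using S(1) by auto
      then have "emeasure \<mu> {x \<in> space \<mu>. True} = 0" by (rule emeasure_eq_0_AE)
      then show False using pos sets_eq_imp_space_eq[OF sets(1)] by simp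
    qed
    then have "emeasure \<nu> (ball x 1) > 0" using k[of x 1] k0[of 1] by simp
    moreover have "emeasure \<nu> (ball x 1) \<le> emeasure \<nu> UNIV"
      by (intro emeasure_mono) (auto simp: sets)
    ultimately show False using 0 by simp
  qed
  show ?thesis
  proof (rule measure_eqI_open)
    fix U :: "'a set" assume U: "open U"
    have "emeasure \<mu> U * emeasure \<nu> UNIV = emeasure \<nu> U * emeasure \<mu> UNIV"
      by (rule prod) (auto simp: U)
    then have "emeasure \<mu> U * emeasure \<nu> UNIV / emeasure \<nu> UNIV = emeasure \<nu> U * emeasure \<mu> UNIV / emeasure \<nu> UNIV"
      by simp
    then have "emeasure \<mu> U = emeasure \<nu> U * emeasure \<mu> UNIV / emeasure \<nu> UNIV"
      using nu_pos N.emeasure_finite[of UNIV] by (simp add: mult_divide_eq_ennreal)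
    then show "emeasure \<mu> U = emeasure (scale_measure (emeasure \<mu> UNIV / emeasure \<nu> UNIV) \<nu>) U"
      by (simp add: divide_ennreal_def ac_simps)
    next
    show "emeasure \<mu> (ball undefined r) < \<infinity>" for r
      using M.emeasure_finite[of "ball undefined r"] by (simp only: infinity_ennreal_def less_top)
  qed (use sets in auto)
qed

text \<open>Isometries map balls to balls and the volume of a ball depends on its radius alone, so
  the image measure and \<open>lborel\<close> are uniformly distributed with the same
  \<open>h\<close>. The quotient in \<open>uniform_balls_open_le\<close> is then 1. That bound is
  used directly, in both directions, because the total mass is infinite while
  \<open>uniform_balls_proportional\<close> is about finite measures.\<close>

lemma distr_lborel_isometry:
  fixes f :: "'a::euclidean_space \<Rightarrow> 'a"
  assumes "linear f" and norm: "\<And>x. norm (f x) = norm x"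
  shows "distr lborel borel f = lborel"
proof -
  have inj: "inj f"
  proof (subst linear_injective_0[OF \<open>linear f\<close>], intro allI impI)
    fix x assume "f x = 0" then show "x = 0" using norm[of x] by simp
  qed
  have "surj f" using linear_injective_imp_surjective[OF \<open>linear f\<close> inj] by simp
  have [measurable]: "f \<in> borel_measurable borel"
    using \<open>linear f\<close> by (intro borel_measurable_continuous_onI linear_continuous_on) (simp add: linear_conv_bounded_linear)
  have distf: "dist (f x) (f y) = dist x y" for x y
    using norm[of "x - y"] linear_diff[OF \<open>linear f\<close>, of x y] by (simp add: dist_norm)
  have ball: "emeasure (distr lborel borel f) (ball x r) = emeasure lborel (ball x r)" if "0 < r" for x r
  proof -
    obtain z where z: "f z = x" using \<open>surj f\<close> by (metis surjD)
    have "f -` ball x r = ball z r" using z distf by auto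
    then have "emeasure (distr lborel borel f) (ball x r) = emeasure lborel (ball z r)"
      by (simp add: emeasure_distr)
    then show ?thesis using that by (simp add: emeasure_ball)
  qed
  have fin: "emeasure (lborel :: 'a measure) (ball x r) < \<infinity>" for x :: 'a and r
    using emeasure_bounded_finite[OF bounded_ball, of x r] by (simp add: less_top)
  have fin': "emeasure (distr lborel borel f) (ball x r) < \<infinity>" for x r
    using ball[of r x] fin[of x r] by (cases "r > 0") (auto simp: not_less ball_empty)
  have sf: "sigma_finite_measure (distr lborel borel f)"
  proof
    show "\<exists>A. countable A \<and> A \<subseteq> sets (distr lborel borel f) \<and> \<Union> A = space (distr lborel borel f) \<and>
        (\<forall>a\<in>A. emeasure (distr lborel borel f) a \<noteq> \<infinity>)"
    proof (intro exI conjI)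
      show "\<Union> (range (\<lambda>n::nat. ball (0::'a) n)) = space (distr lborel borel f)"
        using UN_ball_nat[of "0::'a"] by simp
      show "\<forall>a\<in>range (\<lambda>n::nat. ball (0::'a) n). emeasure (distr lborel borel f) a \<noteq> \<infinity>"
      proof
        fix a assume "a \<in> range (\<lambda>n::nat. ball (0::'a) n)"
        then obtain n :: nat where "a = ball 0 (real n)" by blast
        then show "emeasure (distr lborel borel f) a \<noteq> \<infinity>"
          using fin'[of 0 "real n"] by (metis less_irrefl)
      qed
    qed auto
  qed
  define h where "h r = emeasure lborel (ball (0::'a) r)" for r
  have h: "emeasure lborel (ball (x::'a) r) = h r" if "0 < r" for x r
    using that by (simp add: h_def emeasure_ball)
  have h': "emeasure (distr lborel borel f) (ball x r) = h r" if "0 < r" for x r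
    using ball[OF that] h[OF that] by simp
  have h0: "0 < h r \<and> h r < \<infinity>" if "0 < r" for r
    using that fin[of 0 r] by (simp add: h_def emeasure_ball unit_ball_vol_pos ennreal_zero_less_mult_iff)
  have "h r / h r = 1" if "0 < r" for r
    using h0[OF that] by (metis ennreal_divide_self infinity_ennreal_def less_irrefl)
  then have hk: "h (1 / Suc n) / h (1 / Suc n) = 1" for n
    by simp
  show ?thesis
  proof (rule measure_eqI_open)
    fix U :: "'a set" assume U: "open U"
    have "emeasure (distr lborel borel f) U \<le> liminf (\<lambda>n. h (1 / Suc n) / h (1 / Suc n) * emeasure lborel U)"
      by (rule uniform_balls_open_le[where S=UNIV and h=h and k=h])
        (use sf lborel.sigma_finite_measure_axioms h h' h0 U in simp_all)
    moreover have "emeasure lborel U \<le> liminf (\<lambda>n. h (1 / Suc n) / h (1 / Suc n) * emeasure (distr lborel borel f) U)"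
      by (rule uniform_balls_open_le[where S=UNIV and h=h and k=h])
        (use sf lborel.sigma_finite_measure_axioms h h' h0 U in simp_all)
    ultimately show "emeasure (distr lborel borel f) U = emeasure lborel U"
      unfolding hk by (simp add: Liminf_const)
  qed (use fin' in simp_all)
qed

section \<open>Facets of cones and their exposing functionals\<close>

text \<open>Makes an existential quantifier over an uncountable set measurable: the nonnegative
  continuous function attains its minimum on K, and this is zero exactly if values below every
  \<open>1 / Suc n\<close> occur on a countable dense subset.\<close>

lemma sets_compact_ex_zero:
  fixes \<phi> :: "'w \<Rightarrow> 'a::euclidean_space \<Rightarrow> real"
  assumes K: "compact K"
    and cont: "\<And>\<omega>. \<omega> \<in> space M \<Longrightarrow> continuous_on K (\<phi> \<omega>)"
    and meas[measurable]: "\<And>u. (\<lambda>\<omega>. \<phi> \<omega> u) \<in> borel_measurable M"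
    and nonneg: "\<And>\<omega> u. 0 \<le> \<phi> \<omega> u"
  shows "{\<omega> \<in> space M. \<exists>u\<in>K. \<phi> \<omega> u = 0} \<in> sets M"
proof -
  obtain D where D: "countable D" "D \<subseteq> K" "K \<subseteq> closure D"
    using separable[of K] by blast
  have "(\<exists>u\<in>K. \<phi> \<omega> u = 0) \<longleftrightarrow> (\<forall>n::nat. \<exists>u\<in>D. \<phi> \<omega> u < 1 / Suc n)" if \<omega>: "\<omega> \<in> space M" for \<omega>
  proof
    assume "\<exists>u\<in>K. \<phi> \<omega> u = 0"
    then obtain u where u: "u \<in> K" "\<phi> \<omega> u = 0" by blast
    show "\<forall>n::nat. \<exists>u\<in>D. \<phi> \<omega> u < 1 / Suc n"
    proof
      fix n :: nat
      obtain \<delta> where \<delta>: "\<delta> > 0" "\<And>v. v \<in> K \<Longrightarrow> dist v u < \<delta> \<Longrightarrow> dist (\<phi> \<omega> v) (\<phi> \<omega> u) < 1 / Suc n"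
        using cont[OF \<omega>] u(1) unfolding continuous_on_iff
        by (metis divide_pos_pos of_nat_0_less_iff zero_less_Suc zero_less_one)
      obtain v where v: "v \<in> D" "dist v u < \<delta>"
        using D(3) u(1) \<delta>(1) closure_approachable[of u D] by blast
      then have "\<phi> \<omega> v < 1 / Suc n"
        using \<delta>(2)[of v] D(2) u(2) by (auto simp: dist_real_def)
      then show "\<exists>u\<in>D. \<phi> \<omega> u < 1 / Suc n" using v by blast
    qed
  next
    assume R: "\<forall>n::nat. \<exists>u\<in>D. \<phi> \<omega> u < 1 / Suc n"
    then have "K \<noteq> {}" using D(2) by blast
    then obtain u where u: "u \<in> K" "\<And>v. v \<in> K \<Longrightarrow> \<phi> \<omega> u \<le> \<phi> \<omega> v"
      using continuous_attains_inf[OF K _ cont[OF \<omega>]] by blast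
    have "\<phi> \<omega> u < inverse (real (Suc n))" for n
      using R u(2) D(2) by (metis inverse_eq_divide order_le_less_trans subsetD)
    then have "\<phi> \<omega> u \<le> 0"
      using reals_Archimedean[of "\<phi> \<omega> u"] by (meson not_less order_less_asym)
    then show "\<exists>u\<in>K. \<phi> \<omega> u = 0" using u(1) nonneg[of \<omega> u] by (intro bexI[of _ u]) auto
  qed
  then have "{\<omega> \<in> space M. \<exists>u\<in>K. \<phi> \<omega> u = 0} = {\<omega> \<in> space M. \<forall>n::nat. \<exists>u\<in>D. \<phi> \<omega> u < 1 / Suc n}"
    by auto
  also have "\<dots> = (\<Inter>n::nat. \<Union>u\<in>D. {\<omega> \<in> space M. \<phi> \<omega> u < 1 / Suc n})"
    by auto
  also have "\<dots> \<in> sets M"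
    using D(1) by (intro sets.countable_INT' sets.countable_UN'') auto
  finally show ?thesis .
qed

text \<open>\<open>B\<close> collects the indices of all generators on a facet; counting index sets
  instead of faces makes measurability and invariance under rescaling accessible. The functional
  \<open>u\<close> supports the cone exactly along \<open>B\<close>, and dimension 1 of the solution
  space says that \<open>B\<close> spans a hyperplane. The choice \<open>u = 0\<close> with
  \<open>B = N\<close> covers a cone that is its own only facet.\<close>

definition facet_pattern :: "('i \<Rightarrow> 'a::euclidean_space) \<Rightarrow> 'i set \<Rightarrow> 'i set \<Rightarrow> bool" where
  "facet_pattern y N B \<longleftrightarrow> B \<subseteq> N \<and> (\<exists>u. (\<forall>i\<in>B. y i \<bullet> u = 0) \<and> (\<forall>i\<in>N - B. 0 < y i \<bullet> u)) \<and>
     dim {u. \<forall>i\<in>B. y i \<bullet> u = 0} = 1"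

text \<open>Positive factors keep all signs, so points of the sphere may be replaced by other points
  on the same rays.\<close>

lemma facet_pattern_scale:
  assumes "\<And>i. i \<in> N \<Longrightarrow> 0 < c i"
  shows "facet_pattern (\<lambda>i. c i *\<^sub>R y i) N B \<longleftrightarrow> facet_pattern y N B"
proof -
  have "(\<forall>i\<in>B. c i *\<^sub>R y i \<bullet> u = 0) \<longleftrightarrow> (\<forall>i\<in>B. y i \<bullet> u = 0)" if "B \<subseteq> N" for u
    using assms that by fastforce
  moreover have "(\<forall>i\<in>N - B. 0 < c i *\<^sub>R y i \<bullet> u) \<longleftrightarrow> (\<forall>i\<in>N - B. 0 < y i \<bullet> u)" for u
    using assms by (simp add: zero_less_mult_iff) (metis DiffD1 less_asym)
  ultimately show ?thesis
    unfolding facet_pattern_def by (cases "B \<subseteq> N") simp_all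
qed

lemma facet_pattern_cong:
  assumes "\<And>i. i \<in> N \<Longrightarrow> y i = z i"
  shows "facet_pattern y N B \<longleftrightarrow> facet_pattern z N B"
proof -
  have "(\<forall>i\<in>B. y i \<bullet> u = 0) \<longleftrightarrow> (\<forall>i\<in>B. z i \<bullet> u = 0)" if "B \<subseteq> N" for u
    using assms that by (metis subsetD)
  moreover have "(\<forall>i\<in>N - B. 0 < y i \<bullet> u) \<longleftrightarrow> (\<forall>i\<in>N - B. 0 < z i \<bullet> u)" for u
    using assms by (metis DiffD1)
  ultimately show ?thesis
    unfolding facet_pattern_def by (cases "B \<subseteq> N") simp_all
qed

text \<open>Expresses the dimension by the existence of a unit vector and the absence of an
  orthonormal pair. Both quantify over compact sets, as \<open>sets_compact_ex_zero\<close>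
  requires.\<close>

lemma dim_eq_1_iff_orthonormal:
  fixes W :: "'a::euclidean_space set"
  assumes W: "subspace W"
  shows "dim W = 1 \<longleftrightarrow> (\<exists>u\<in>sphere 0 1. u \<in> W) \<and>
     \<not> (\<exists>p \<in> {p \<in> sphere 0 1 \<times> sphere 0 1. fst p \<bullet> snd p = 0}. fst p \<in> W \<and> snd p \<in> W)"
proof -
  have "dim W \<noteq> 0 \<longleftrightarrow> (\<exists>u\<in>sphere 0 1. u \<in> W)"
  proof
    assume "dim W \<noteq> 0"
    then obtain u where "u \<in> W" "u \<noteq> 0" by auto
    then have "sgn u \<in> W" "norm (sgn u) = 1"
      using W by (auto simp: sgn_div_norm subspace_scale)
    then show "\<exists>u\<in>sphere 0 1. u \<in> W" by auto
  qed auto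
  moreover have "2 \<le> dim W \<longleftrightarrow>
    (\<exists>p \<in> {p \<in> sphere 0 1 \<times> sphere 0 1. fst p \<bullet> snd p = 0}. fst p \<in> W \<and> snd p \<in> W)"
  proof
    assume 2: "2 \<le> dim W"
    obtain B where B: "B \<subseteq> W" "pairwise orthogonal B" "\<And>x. x \<in> B \<Longrightarrow> norm x = 1" "card B = dim W" "independent B"
      by (rule orthonormal_basis_subspace[OF W]) (rule that; assumption)
    obtain T where "T \<subseteq> B" "card T = 2" "finite T"
      by (rule obtain_subset_with_card_n[of 2 B]) (use 2 B in auto)
    then obtain u v where "u \<noteq> v" "u \<in> B" "v \<in> B" by (auto simp: card_2_iff)
    then have "u \<bullet> v = 0" using B(2) by (auto simp: pairwise_def orthogonal_def)
    then show "\<exists>p \<in> {p \<in> sphere 0 1 \<times> sphere 0 1. fst p \<bullet> snd p = 0}. fst p \<in> W \<and> snd p \<in> W"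
      using B \<open>u \<in> B\<close> \<open>v \<in> B\<close> by (intro bexI[of _ "(u, v)"]) auto
  next
    assume "\<exists>p \<in> {p \<in> sphere 0 1 \<times> sphere 0 1. fst p \<bullet> snd p = 0}. fst p \<in> W \<and> snd p \<in> W"
    then obtain u v where uv: "norm u = 1" "norm v = 1" "u \<bullet> v = 0" "u \<in> W" "v \<in> W" by auto
    then have "u \<noteq> v" by (auto simp: dot_square_norm)
    have "0 \<notin> {u, v}" using uv by auto
    then have "independent {u, v}"
      using uv by (intro pairwise_orthogonal_independent) (auto simp: pairwise_def orthogonal_def inner_commute)
    then have "card {u, v} \<le> dim W" using uv by (intro independent_card_le_dim) auto
    then show "2 \<le> dim W" using \<open>u \<noteq> v\<close> by simp
  qed
  ultimately show ?thesis by linarith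
qed

lemma subspace_orthogonal_family: "subspace {u. \<forall>i\<in>B. y i \<bullet> u = 0}"
  by (auto simp: subspace_def inner_simps)

lemma sets_facet_pattern:
  fixes X :: "'i \<Rightarrow> 'w \<Rightarrow> 'a::euclidean_space"
  assumes N: "finite N" and X[measurable]: "\<And>i. i \<in> N \<Longrightarrow> X i \<in> borel_measurable M"
  shows "{\<omega> \<in> space M. facet_pattern (\<lambda>i. X i \<omega>) N B} \<in> sets M"
proof (cases "B \<subseteq> N")
  case B: True
  \<comment> \<open>Penalty functions encode the conditions as zeros on compact sets. Positivity is
    not of this kind, but after rescaling \<open>u\<close> it reads
    \<open>1 \<le> X i \<omega> \<bullet> u\<close>; the range of \<open>u\<close> is then unbounded
    and is exhausted by balls of integer radius.\<close>
  define \<phi> where "\<phi> \<omega> u = (\<Sum>i\<in>B. \<bar>X i \<omega> \<bullet> u\<bar>) + (\<Sum>i\<in>N - B. max 0 (1 - X i \<omega> \<bullet> u))" for \<omega> u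
  have finB: "finite B" using B N finite_subset by blast
  have \<phi>0: "\<phi> \<omega> u = 0 \<longleftrightarrow> (\<forall>i\<in>B. X i \<omega> \<bullet> u = 0) \<and> (\<forall>i\<in>N - B. 1 \<le> X i \<omega> \<bullet> u)" for \<omega> u
    unfolding \<phi>_def using N finB
    by (subst add_nonneg_eq_0_iff) (simp_all add: sum_nonneg sum_nonneg_eq_0_iff max_def, force)
  have XB[measurable]: "\<And>i. i \<in> B \<Longrightarrow> X i \<in> borel_measurable M" using B by auto
  have exp_iff: "(\<exists>u. (\<forall>i\<in>B. X i \<omega> \<bullet> u = 0) \<and> (\<forall>i\<in>N - B. 0 < X i \<omega> \<bullet> u))
      \<longleftrightarrow> (\<exists>n::nat. \<exists>u\<in>cball 0 (real n). \<phi> \<omega> u = 0)" for \<omega>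
  proof
    assume "\<exists>u. (\<forall>i\<in>B. X i \<omega> \<bullet> u = 0) \<and> (\<forall>i\<in>N - B. 0 < X i \<omega> \<bullet> u)"
    then obtain u where u: "\<And>i. i \<in> B \<Longrightarrow> X i \<omega> \<bullet> u = 0" "\<And>i. i \<in> N - B \<Longrightarrow> 0 < X i \<omega> \<bullet> u" by blast
    \<comment> \<open>Large enough to lift all positive values to at least 1; the inserted 1 keeps
      the set nonempty.\<close>
    define c where "c = Max (insert 1 ((\<lambda>i. 1 / (X i \<omega> \<bullet> u)) ` (N - B)))"
    have c: "1 / (X i \<omega> \<bullet> u) \<le> c" if "i \<in> N - B" for i
      unfolding c_def using N that by (intro Max_ge) auto
    have "1 \<le> X i \<omega> \<bullet> (c *\<^sub>R u)" if "i \<in> N - B" for i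
      using c[OF that] u(2)[OF that] by (simp add: field_simps)
    then have "\<phi> \<omega> (c *\<^sub>R u) = 0" unfolding \<phi>0 using u(1) by simp
    then show "\<exists>n::nat. \<exists>u\<in>cball 0 (real n). \<phi> \<omega> u = 0"
      using real_arch_simple[of "norm (c *\<^sub>R u)"] by (metis mem_cball_0)
  next
    assume "\<exists>n::nat. \<exists>u\<in>cball 0 (real n). \<phi> \<omega> u = 0"
    then show "\<exists>u. (\<forall>i\<in>B. X i \<omega> \<bullet> u = 0) \<and> (\<forall>i\<in>N - B. 0 < X i \<omega> \<bullet> u)"
      unfolding \<phi>0 by (meson less_le_trans zero_less_one)
  qed
  have A1: "{\<omega> \<in> space M. \<exists>n::nat. \<exists>u\<in>cball 0 (real n). \<phi> \<omega> u = 0} \<in> sets M"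
  proof -
    have "{\<omega> \<in> space M. \<exists>u\<in>cball 0 (real n). \<phi> \<omega> u = 0} \<in> sets M" for n :: nat
      by (rule sets_compact_ex_zero) (auto simp: \<phi>_def intro!: continuous_intros sum_nonneg add_nonneg_nonneg)
    then show ?thesis by (rule sets.sets_Collect_countable_Ex)
  qed
  define \<psi> where "\<psi> \<omega> u = (\<Sum>i\<in>B. \<bar>X i \<omega> \<bullet> u\<bar>)" for \<omega> u
  have \<psi>0: "\<psi> \<omega> u = 0 \<longleftrightarrow> (\<forall>i\<in>B. X i \<omega> \<bullet> u = 0)" for \<omega> u
    unfolding \<psi>_def using finB by (auto simp: sum_nonneg_eq_0_iff)
  have A2: "{\<omega> \<in> space M. \<exists>u\<in>sphere 0 1. \<psi> \<omega> u = 0} \<in> sets M"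
    by (rule sets_compact_ex_zero[OF compact_sphere]) (auto simp: \<psi>_def intro!: continuous_intros sum_nonneg)
  let ?K = "{p \<in> sphere 0 1 \<times> sphere 0 1. fst p \<bullet> (snd p :: 'a) = 0}"
  have "closed {p :: 'a \<times> 'a. fst p \<bullet> snd p = 0}"
    by (intro closed_Collect_eq continuous_intros)
  moreover have "?K = (sphere 0 1 \<times> sphere 0 1) \<inter> {p. fst p \<bullet> snd p = 0}" by blast
  ultimately have K: "compact ?K"
    using compact_Int_closed[OF compact_Times[OF compact_sphere compact_sphere]] by metis
  have A3: "{\<omega> \<in> space M. \<exists>p\<in>?K. \<psi> \<omega> (fst p) + \<psi> \<omega> (snd p) = 0} \<in> sets M"
    by (rule sets_compact_ex_zero[OF K]) (auto simp: \<psi>_def intro!: continuous_intros sum_nonneg add_nonneg_nonneg)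
  have "\<psi> \<omega> u \<ge> 0" for \<omega> u by (simp add: \<psi>_def sum_nonneg)
  then have "\<psi> \<omega> (fst p) + \<psi> \<omega> (snd p) = 0 \<longleftrightarrow> \<psi> \<omega> (fst p) = 0 \<and> \<psi> \<omega> (snd p) = 0" for \<omega> p
    by (simp add: add_nonneg_eq_0_iff)
  then have dim_iff: "dim {u. \<forall>i\<in>B. X i \<omega> \<bullet> u = 0} = 1 \<longleftrightarrow> (\<exists>u\<in>sphere 0 1. \<psi> \<omega> u = 0) \<and>
      \<not> (\<exists>p\<in>?K. \<psi> \<omega> (fst p) + \<psi> \<omega> (snd p) = 0)" for \<omega>
    unfolding dim_eq_1_iff_orthonormal[OF subspace_orthogonal_family] mem_Collect_eq \<psi>0 by presburger
  have "{\<omega> \<in> space M. facet_pattern (\<lambda>i. X i \<omega>) N B} =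
     {\<omega> \<in> space M. \<exists>n::nat. \<exists>u\<in>cball 0 (real n). \<phi> \<omega> u = 0} \<inter>
     ({\<omega> \<in> space M. \<exists>u\<in>sphere 0 1. \<psi> \<omega> u = 0} -
      {\<omega> \<in> space M. \<exists>p\<in>?K. \<psi> \<omega> (fst p) + \<psi> \<omega> (snd p) = 0})"
    unfolding facet_pattern_def exp_iff dim_iff using B by blast
  then show ?thesis by (simp only: sets.Int sets.Diff A1 A2 A3)
qed (simp add: facet_pattern_def)

section \<open>Faces of finitely generated cones\<close>

lemma convex_cone_hull_finite_image:
  assumes N: "finite N"
  shows "convex_cone hull (y ` N) = {\<Sum>i\<in>N. c i *\<^sub>R y i | c. \<forall>i\<in>N. 0 \<le> c i}" (is "_ = ?R")
proof
  show "convex_cone hull (y ` N) \<subseteq> ?R"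
  proof (rule hull_minimal)
    show "y ` N \<subseteq> ?R"
    proof
      fix x assume "x \<in> y ` N"
      then obtain j where j: "j \<in> N" "x = y j" by blast
      have "x = (\<Sum>i\<in>N. (if i = j then 1 else 0) *\<^sub>R y i)"
        using j N by (simp add: if_distrib[where f="\<lambda>c. c *\<^sub>R _"] sum.delta cong: if_cong)
      then show "x \<in> ?R" by (auto intro!: exI[of _ "\<lambda>i. if i = j then 1 else (0::real)"])
    qed
    show "convex_cone ?R"
      unfolding convex_cone_iff
    proof (intro conjI ballI allI impI)
      show "0 \<in> ?R" by (auto intro!: exI[of _ "\<lambda>_. 0"])
    next
      fix x z assume "x \<in> ?R" "z \<in> ?R"
      then obtain c e where "\<forall>i\<in>N. 0 \<le> c i" "\<forall>i\<in>N. 0 \<le> e i"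
        "x = (\<Sum>i\<in>N. c i *\<^sub>R y i)" "z = (\<Sum>i\<in>N. e i *\<^sub>R y i)" by auto
      then show "x + z \<in> ?R"
        by (auto simp: sum.distrib scaleR_left_distrib intro!: exI[of _ "\<lambda>i. c i + e i"])
    next
      fix x and t :: real assume "x \<in> ?R" "0 \<le> t"
      then obtain c where "\<forall>i\<in>N. 0 \<le> c i" "x = (\<Sum>i\<in>N. c i *\<^sub>R y i)" by auto
      then show "t *\<^sub>R x \<in> ?R" using \<open>0 \<le> t\<close>
        by (auto simp: scaleR_sum_right intro!: exI[of _ "\<lambda>i. t * c i"])
    qed
  qed
  show "?R \<subseteq> convex_cone hull (y ` N)"
  proof clarify
    fix c assume c: "\<forall>i\<in>N. 0 \<le> (c i :: real)"
    show "(\<Sum>i\<in>N. c i *\<^sub>R y i) \<in> convex_cone hull (y ` N)"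
      using N c
    proof (induction N rule: finite_induct)
      case empty
      then show ?case by (simp add: convex_cone_hull_contains_0)
    next
      case (insert i N)
      have "(\<Sum>i\<in>N. c i *\<^sub>R y i) \<in> convex_cone hull (y ` insert i N)"
        using insert hull_mono[of "y ` N" "y ` insert i N" convex_cone] by auto
      moreover have "c i *\<^sub>R y i \<in> convex_cone hull (y ` insert i N)"
        using insert by (intro convex_cone_hull_mul hull_inc) auto
      ultimately show ?case using insert by (simp add: convex_cone_hull_add)
    qed
  qed
qed

lemma dim_orthogonal_family:
  fixes y :: "'i \<Rightarrow> 'a::euclidean_space"
  shows "dim {u. \<forall>i\<in>B. y i \<bullet> u = 0} + dim (y ` B) = DIM('a)"
proof -
  have "(\<forall>i\<in>B. y i \<bullet> u = 0) \<longleftrightarrow> (\<forall>x\<in>span (y ` B). orthogonal x u)" for u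
  proof
    assume "\<forall>i\<in>B. y i \<bullet> u = 0"
    then have "orthogonal u x" if "x \<in> y ` B" for x
      using that by (auto simp: orthogonal_def inner_commute[of u])
    then show "\<forall>x\<in>span (y ` B). orthogonal x u"
      using orthogonal_to_span[of _ "y ` B" u] orthogonal_commute by blast
  qed (auto simp: orthogonal_def span_base)
  then have "{u. \<forall>i\<in>B. y i \<bullet> u = 0} = {u \<in> UNIV. \<forall>x\<in>span (y ` B). orthogonal x u}"
    by simp
  then show ?thesis
    using dim_subspace_orthogonal_to_vectors[OF subspace_span subspace_UNIV subset_UNIV, of "y ` B"]
    by (simp only: dim_span dim_UNIV)
qed

lemma dim_convex_cone_hull: "dim (convex_cone hull A) = dim (A :: 'a::euclidean_space set)"
proof (rule antisym)
  have "convex_cone hull A \<subseteq> span A"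
    by (rule hull_minimal) (auto simp: convex_cone_iff span_zero span_add span_scale span_superset)
  then show "dim (convex_cone hull A) \<le> dim A"
    by (metis dim_span dim_subset)
  show "dim A \<le> dim (convex_cone hull A)"
    by (intro dim_subset hull_subset)
qed

text \<open>If u vanishes on a nonnegative combination, each of its nonnegative terms vanishes, and
  a generator on which u is positive must have coefficient 0.\<close>

lemma convex_cone_hull_Int_hyperplane:
  assumes N: "finite N" and B: "B \<subseteq> N"
    and 0: "\<And>i. i \<in> B \<Longrightarrow> u \<bullet> y i = 0" and pos: "\<And>i. i \<in> N - B \<Longrightarrow> 0 < u \<bullet> y i"
  shows "convex_cone hull (y ` N) \<inter> {x. u \<bullet> x = 0} = convex_cone hull (y ` B)"
proof
  show "convex_cone hull (y ` N) \<inter> {x. u \<bullet> x = 0} \<subseteq> convex_cone hull (y ` B)"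
  proof clarify
    fix x assume x: "x \<in> convex_cone hull (y ` N)" and ux: "u \<bullet> x = 0"
    obtain c where c: "\<forall>i\<in>N. 0 \<le> c i" "x = (\<Sum>i\<in>N. c i *\<^sub>R y i)"
      using x unfolding convex_cone_hull_finite_image[OF N] by auto
    have ge: "0 \<le> c i * (u \<bullet> y i)" if "i \<in> N" for i
      using that c(1) 0[of i] pos[of i] by (cases "i \<in> B") (auto intro: less_imp_le)
    have "(\<Sum>i\<in>N. c i * (u \<bullet> y i)) = 0"
      using ux c(2) by (simp add: inner_sum_right)
    then have "c i * (u \<bullet> y i) = 0" if "i \<in> N" for i
      using ge that N by (simp add: sum_nonneg_eq_0_iff)
    then have c0: "c i = 0" if "i \<in> N - B" for i
      using pos[OF that] that by force
    have "x = (\<Sum>i\<in>B. c i *\<^sub>R y i)"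
      unfolding c(2) by (rule sum.mono_neutral_right) (use N B c0 in auto)
    then show "x \<in> convex_cone hull (y ` B)"
      unfolding convex_cone_hull_finite_image[OF finite_subset[OF B N]] using c(1) B by auto
  qed
  have "convex_cone hull (y ` B) \<subseteq> {x. u \<bullet> x = 0}"
    by (rule hull_minimal) (auto simp: convex_cone_iff inner_simps 0)
  then show "convex_cone hull (y ` B) \<subseteq> convex_cone hull (y ` N) \<inter> {x. u \<bullet> x = 0}"
    using hull_mono[of "y ` B" "y ` N" convex_cone] B by blast
qed

text \<open>A facet is recorded by the generators lying on it. Patterns give supporting hyperplanes
  and hence faces; conversely a finitely generated cone is a polyhedron, so every face is exposed
  and its functional yields a pattern.\<close>

lemma f_number_spherical_hull:
  fixes y :: "'i \<Rightarrow> (real^'d) \<times> real"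
  assumes N: "finite N" and y: "\<And>i. i \<in> N \<Longrightarrow> norm (y i) = 1"
    and d: "CARD('d) \<ge> 1"
  shows "f_number (CARD('d) - 1) (spherical_hull (y ` N)) = card {B. facet_pattern y N B}"
proof -
  define C where "C = convex_cone hull (y ` N)"
  have C0: "0 \<in> C" and Cscale: "\<And>x t. x \<in> C \<Longrightarrow> 0 \<le> t \<Longrightarrow> t *\<^sub>R x \<in> C"
    by (auto simp: C_def convex_cone_hull_contains_0 convex_cone_hull_mul)
  have "convex_cone hull (spherical_hull (y ` N)) = C"
  proof
    show "convex_cone hull (spherical_hull (y ` N)) \<subseteq> C"
      unfolding C_def spherical_hull_def
      by (rule hull_minimal) (auto simp: convex_cone_convex_cone_hull)
    have "y ` N \<subseteq> spherical_hull (y ` N)"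
      using y by (auto simp: spherical_hull_def hull_inc)
    then show "C \<subseteq> convex_cone hull (spherical_hull (y ` N))"
      unfolding C_def by (rule hull_mono)
  qed
  \<comment> \<open>As \<open>CARD('d) \<ge> 1\<close>, the difference is not truncated and
    \<open>int (CARD('d) - 1) + 1\<close> is \<open>int CARD('d)\<close>, one less than the
    dimension of the space.\<close>
  then have faces: "spherical_faces (CARD('d) - 1) (spherical_hull (y ` N)) =
      {sphere 0 1 \<inter> F | F. F face_of C \<and> aff_dim F = int CARD('d)}"
    using d unfolding spherical_faces_def by (simp add: of_nat_diff)
  define \<Phi> where "\<Phi> B = sphere 0 1 \<inter> convex_cone hull (y ` B)" for B
  have expose: "\<exists>u. C \<inter> {x. u \<bullet> x = 0} = convex_cone hull (y ` B) \<and>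
      (\<forall>i\<in>B. u \<bullet> y i = 0) \<and> (\<forall>i\<in>N - B. 0 < u \<bullet> y i)"
    if pat: "facet_pattern y N B" for B
  proof -
    obtain u where u: "\<forall>i\<in>B. u \<bullet> y i = 0" "\<forall>i\<in>N - B. 0 < u \<bullet> y i" and B: "B \<subseteq> N"
      using pat unfolding facet_pattern_def by (metis inner_commute)
    have "C \<inter> {x. u \<bullet> x = 0} = convex_cone hull (y ` B)"
      unfolding C_def by (rule convex_cone_hull_Int_hyperplane[OF N B]) (use u in auto)
    then show ?thesis using u by blast
  qed
  have aff: "aff_dim (convex_cone hull (y ` B)) = int CARD('d) \<longleftrightarrow> dim {u. \<forall>i\<in>B. y i \<bullet> u = 0} = 1" for B
  proof -
    have "aff_dim (convex_cone hull (y ` B)) = int (dim (y ` B))"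
      using aff_dim_zero[of "convex_cone hull (y ` B)"]
      by (simp add: hull_inc convex_cone_hull_contains_0 dim_convex_cone_hull)
    then show ?thesis using dim_orthogonal_family[of B y] by auto
  qed
  have "bij_betw \<Phi> {B. facet_pattern y N B}
      (spherical_faces (CARD('d) - 1) (spherical_hull (y ` N)))"
    unfolding bij_betw_def
  proof
    \<comment> \<open>Injectivity: a generator outside \<open>B\<close> has positive value under u
      and so misses the face, hence the face determines \<open>B\<close>.\<close>
    have rec: "B = {i \<in> N. y i \<in> \<Phi> B}" if pat: "facet_pattern y N B" for B
    proof -
      have B: "B \<subseteq> N" using pat by (simp add: facet_pattern_def)
      obtain u where u: "C \<inter> {x. u \<bullet> x = 0} = convex_cone hull (y ` B)" "\<forall>i\<in>N - B. 0 < u \<bullet> y i"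
        using expose[OF pat] by blast
      show ?thesis
      proof
        show "B \<subseteq> {i \<in> N. y i \<in> \<Phi> B}"
          using B y by (auto simp: \<Phi>_def hull_inc)
        show "{i \<in> N. y i \<in> \<Phi> B} \<subseteq> B"
          using u(2) by (force simp: \<Phi>_def simp flip: u(1))
      qed
    qed
    show "inj_on \<Phi> {B. facet_pattern y N B}"
    proof (rule inj_onI)
      fix B B' assume "B \<in> {B. facet_pattern y N B}" "B' \<in> {B. facet_pattern y N B}" "\<Phi> B = \<Phi> B'"
      then show "B = B'" using rec[of B] rec[of B'] by simp
    qed
    show "\<Phi> ` {B. facet_pattern y N B} = spherical_faces (CARD('d) - 1) (spherical_hull (y ` N))"
      unfolding faces
    proof (intro equalityI subsetI)
      fix G assume "G \<in> \<Phi> ` {B. facet_pattern y N B}"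
      then obtain B where pat: "facet_pattern y N B" and G: "G = \<Phi> B" by blast
      obtain u where u: "C \<inter> {x. u \<bullet> x = 0} = convex_cone hull (y ` B)"
          "\<forall>i\<in>B. u \<bullet> y i = 0" "\<forall>i\<in>N - B. 0 < u \<bullet> y i"
        using expose[OF pat] by blast
      have "C \<subseteq> {x. 0 \<le> u \<bullet> x}"
        unfolding C_def
      proof (rule hull_minimal)
        show "y ` N \<subseteq> {x. 0 \<le> u \<bullet> x}"
        proof (intro image_subsetI)
          fix i assume "i \<in> N" then show "y i \<in> {x. 0 \<le> u \<bullet> x}"
            using u(2,3) by (cases "i \<in> B") (auto intro: less_imp_le)
        qed
      qed (auto simp: convex_cone_iff inner_simps)
      then have "(C \<inter> {x. u \<bullet> x = 0}) face_of C"
        by (intro face_of_Int_supporting_hyperplane_ge) (auto simp: C_def convex_convex_cone_hull)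
      then have "convex_cone hull (y ` B) face_of C" using u(1) by simp
      moreover have "aff_dim (convex_cone hull (y ` B)) = int CARD('d)"
        using pat aff by (simp add: facet_pattern_def)
      ultimately show "G \<in> {sphere 0 1 \<inter> F | F. F face_of C \<and> aff_dim F = int CARD('d)}"
        unfolding G \<Phi>_def by blast
    next
      fix G assume "G \<in> {sphere 0 1 \<inter> F | F. F face_of C \<and> aff_dim F = int CARD('d)}"
      then obtain F where F: "F face_of C" "aff_dim F = int CARD('d)" and G: "G = sphere 0 1 \<inter> F" by blast
      have "polyhedron C" using N by (simp add: C_def polyhedron_convex_cone_hull)
      then have "F exposed_face_of C"
        using F(1) exposed_face_of_polyhedron[of C F] by simp
      then obtain a b where ab: "C \<subseteq> {x. a \<bullet> x \<le> b}" "F = C \<inter> {x. a \<bullet> x = b}"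
        unfolding exposed_face_of_def by auto
      have "F \<noteq> {}" using F(2) by auto
      then obtain x where x: "x \<in> C" "a \<bullet> x = b" using ab by auto
      \<comment> \<open>A hyperplane touching a cone passes through the apex: 0 and twice the
        touching point both lie in C.\<close>
      have "b \<ge> 0" using ab(1) C0 by auto
      moreover have "2 * b \<le> b" using ab(1) Cscale[OF x(1), of 2] x(2) by auto
      ultimately have "b = 0" by simp
      \<comment> \<open>If F is all of C, then a vanishes on every generator and
        \<open>B = N\<close>.\<close>
      define B where "B = {i \<in> N. a \<bullet> y i = 0}"
      have yC: "y i \<in> C" if "i \<in> N" for i using that by (simp add: C_def hull_inc)
      have neg: "a \<bullet> y i < 0" if "i \<in> N - B" for i
        using ab(1) yC[of i] that \<open>b = 0\<close> by (auto simp: B_def less_le)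
      have "F = C \<inter> {x. - a \<bullet> x = 0}" using ab(2) \<open>b = 0\<close> by simp
      also have "\<dots> = convex_cone hull (y ` B)"
        unfolding C_def by (rule convex_cone_hull_Int_hyperplane[OF N]) (use neg in \<open>auto simp: B_def\<close>)
      finally have F_eq: "F = convex_cone hull (y ` B)" .
      have "facet_pattern y N B"
        unfolding facet_pattern_def
      proof (intro conjI exI[of _ "- a"] ballI)
        show "dim {u. \<forall>i\<in>B. y i \<bullet> u = 0} = 1" using F(2) aff F_eq by simp
      qed (use neg in \<open>auto simp: B_def inner_commute\<close>)
      then show "G \<in> \<Phi> ` {B. facet_pattern y N B}"
        unfolding G \<Phi>_def F_eq by blast
    qed
  qed
  then show ?thesis
    unfolding f_number_def by (rule bij_betw_same_card[symmetric])
qed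

section \<open>Measurability of determinants and generic invertibility\<close>

lemma borel_measurable_vec_nth [measurable (raw)]:
  fixes f :: "'w \<Rightarrow> 'a::euclidean_space^'n"
  assumes "f \<in> borel_measurable M"
  shows "(\<lambda>x. f x $ i) \<in> borel_measurable M"
  by (rule borel_measurable_continuous_on[OF _ assms]) (intro continuous_intros)

lemma borel_measurable_vec_lambda [measurable (raw)]:
  fixes f :: "'w \<Rightarrow> 'n::finite \<Rightarrow> 'a::euclidean_space"
  assumes "\<And>i. (\<lambda>x. f x i) \<in> borel_measurable M"
  shows "(\<lambda>x. \<chi> i. f x i) \<in> borel_measurable M"
proof (rule borel_measurable_euclidean_space[THEN iffD2], intro ballI)
  fix b :: "'a^'n" assume "b \<in> Basis"
  then obtain i u where b: "b = axis i u" "u \<in> Basis" by (auto simp: Basis_vec_def)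
  show "(\<lambda>x. (\<chi> i. f x i) \<bullet> b) \<in> borel_measurable M"
    unfolding b inner_axis using assms[of i] by (simp add: borel_measurable_inner)
qed

lemma borel_measurable_det [measurable (raw)]:
  fixes f :: "'w \<Rightarrow> real^'n^'n"
  assumes [measurable]: "f \<in> borel_measurable M"
  shows "(\<lambda>x. det (f x)) \<in> borel_measurable M"
  unfolding det_def by measurable

lemma poly_det: "poly (det (M :: 'a::comm_ring_1 poly^'n^'n)) s = det (\<chi> i j. poly (M $ i $ j) s)"
  by (simp add: det_def poly_sum poly_prod)

text \<open>The determinant is a polynomial in s, and a nonzero one: for s beyond the operator bound
  of A the kernel is trivial.\<close>

lemma finite_det_add_scaled_identity_eq_0:
  fixes A :: "real^'n^'n"
  shows "finite {s. det (A + s *\<^sub>R mat 1) = 0}"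
proof -
  define p where "p = det (\<chi> i j. [:A $ i $ j, if i = j then 1 else 0:])"
  have p: "poly p s = det (A + s *\<^sub>R mat 1)" for s
    unfolding p_def poly_det by (rule arg_cong[where f=det]) (simp add: vec_eq_iff mat_def)
  obtain B where B: "\<And>x. norm (A *v x) \<le> B * norm x"
    using linear_bounded[OF matrix_vector_mul_linear[of A]] by blast
  define s where "s = \<bar>B\<bar> + 1"
  have "det (A + s *\<^sub>R mat 1) \<noteq> 0"
  proof
    assume "det (A + s *\<^sub>R mat 1) = 0"
    then obtain x where x: "x \<noteq> 0" "(A + s *\<^sub>R mat 1) *v x = 0"
      by (metis invertible_det_nz invertible_left_inverse matrix_left_invertible_ker)
    then have "A *v x = - (s *\<^sub>R x)"
      by (simp add: matrix_vector_mult_add_rdistrib scaleR_matrix_vector_assoc[symmetric] eq_neg_iff_add_eq_0)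
    then have "\<bar>s\<bar> * norm x \<le> B * norm x" using B[of x] by simp
    then show False using x(1) by (simp add: s_def)
  qed
  then have "p \<noteq> 0" using p by (metis poly_0)
  from poly_roots_finite[OF this] show ?thesis by (simp add: p)
qed

text \<open>All translates of the set of singular matrices along the identity matrix have the same
  measure. By Tonelli their average over \<open>s \<in> {0..1}\<close> is 0, because every line in
  this direction contains only finitely many singular matrices.\<close>

lemma AE_lborel_det_nonzero: "AE A in lborel. det (A :: real^'n^'n) \<noteq> 0"
proof -
  let ?L = "lborel :: (real^'n^'n) measure"
  define Z where "Z = {A :: real^'n^'n. det A = 0}"
  have Z[measurable]: "Z \<in> sets borel"
    unfolding Z_def by (intro borel_closed closed_Collect_eq)
      (auto simp: det_def intro!: continuous_intros)
  have shift: "emeasure ?L {A. A + s *\<^sub>R mat 1 \<in> Z} = emeasure ?L Z" for s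
  proof -
    have "emeasure ?L Z = emeasure (distr lborel borel ((+) (s *\<^sub>R mat 1))) Z"
      by (simp add: lborel_distr_plus)
    also have "\<dots> = emeasure ?L ((+) (s *\<^sub>R mat 1) -` Z \<inter> space ?L)"
      by (rule emeasure_distr) auto
    also have "(+) (s *\<^sub>R mat 1) -` Z \<inter> space ?L = {A. A + s *\<^sub>R mat 1 \<in> Z}"
      by (auto simp: add.commute)
    finally show ?thesis by simp
  qed
  have "emeasure ?L Z * emeasure (lborel :: real measure) {0..1} = (\<integral>\<^sup>+s\<in>{0..1::real}. emeasure ?L Z \<partial>lborel)"
    by (rule nn_integral_cmult_indicator[symmetric]) simp
  also have "\<dots> = (\<integral>\<^sup>+s. (\<integral>\<^sup>+A. indicator Z (A + s *\<^sub>R mat 1) * indicator {0..1} s \<partial>?L) \<partial>lborel)"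
  proof (rule nn_integral_cong)
    fix s :: real
    have "(\<integral>\<^sup>+A. indicator Z (A + s *\<^sub>R mat 1) * indicator {0..1} s \<partial>?L)
        = (\<integral>\<^sup>+A. indicator {0..1} s * indicator {A. A + s *\<^sub>R mat 1 \<in> Z} A \<partial>?L)"
      by (intro nn_integral_cong) (simp add: indicator_def)
    also have "\<dots> = indicator {0..1} s * emeasure ?L {A. A + s *\<^sub>R mat 1 \<in> Z}"
      by (rule nn_integral_cmult_indicator) measurable
    finally show "emeasure ?L Z * indicator {0..1} s = (\<integral>\<^sup>+A. indicator Z (A + s *\<^sub>R mat 1) * indicator {0..1} s \<partial>?L)"
      by (simp add: shift mult.commute)
  qed
  also have "\<dots> = (\<integral>\<^sup>+A. (\<integral>\<^sup>+s. indicator Z (A + s *\<^sub>R mat 1) * indicator {0..1} s \<partial>lborel) \<partial>?L)"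
    by (rule lborel_pair.Fubini') measurable
  also have "\<dots> = (\<integral>\<^sup>+A. 0 \<partial>?L)"
  proof (rule nn_integral_cong)
    fix A :: "real^'n^'n"
    have "(\<integral>\<^sup>+s. indicator Z (A + s *\<^sub>R mat 1) * indicator {0..1} s \<partial>lborel)
        \<le> (\<integral>\<^sup>+s. indicator {s. det (A + s *\<^sub>R mat 1) = 0} s \<partial>lborel)"
      by (intro nn_integral_mono) (simp add: indicator_def Z_def)
    also have "\<dots> = emeasure lborel {s. det (A + s *\<^sub>R mat 1) = 0}"
      using finite_det_add_scaled_identity_eq_0[of A]
      by (intro nn_integral_indicator) (simp add: finite_imp_closed borel_closed)
    also have "\<dots> = 0"
      using finite_det_add_scaled_identity_eq_0[of A] by (simp add: emeasure_lborel_countable countable_finite)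
    finally show "(\<integral>\<^sup>+s. indicator Z (A + s *\<^sub>R mat 1) * indicator {0..1} s \<partial>lborel) = 0"
      by simp
  qed
  finally have "emeasure ?L Z = 0" by simp
  then show ?thesis
    by (intro AE_I[of _ _ Z]) (auto simp: Z_def)
qed

section \<open>Linear systems and points in general position\<close>

definition solve :: "real^'n^'n \<Rightarrow> real^'n \<Rightarrow> real^'n" where
  "solve A b = (\<chi> k. det (\<chi> i j. if j = k then b $ i else A $ i $ j) / det A)"

lemma solve_iff: "det A \<noteq> 0 \<Longrightarrow> A *v x = b \<longleftrightarrow> x = solve A b"
  unfolding solve_def by (rule cramer)

text \<open>The reason for using Cramer's formula: a quotient of determinants is visibly measurable,
  unlike a solution picked by a choice operator.\<close>

lemma borel_measurable_solve [measurable (raw)]: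
  assumes [measurable]: "f \<in> borel_measurable M" "g \<in> borel_measurable M"
  shows "(\<lambda>x. solve (f x) (g x)) \<in> borel_measurable M"
  unfolding solve_def
proof (intro borel_measurable_vec_lambda borel_measurable_divide borel_measurable_det)
  fix i j k
  show "(\<lambda>x. if j = k then g x $ i else f x $ i $ j) \<in> borel_measurable M"
    by (cases "j = k") simp_all
qed measurable

text \<open>Enumerating \<open>CARD('n)\<close> indices by the coordinate type turns as many points
  into the rows of a square matrix.\<close>

definition family_matrix :: "('i \<Rightarrow> (real^'n) \<times> real) \<Rightarrow> ('n \<Rightarrow> 'i) \<Rightarrow> real^'n^'n" where
  "family_matrix y e = (\<chi> i. fst (y (e i)))"

definition family_heights :: "('i \<Rightarrow> (real^'n) \<times> real) \<Rightarrow> ('n \<Rightarrow> 'i) \<Rightarrow> real^'n" where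
  "family_heights y e = (\<chi> i. snd (y (e i)))"

text \<open>The hyperplane through \<open>0\<close> and the points \<open>y (e i)\<close> is \<open>{(g, t). g \<bullet> family_normal y e = t}\<close>.\<close>

definition family_normal :: "('i \<Rightarrow> (real^'n) \<times> real) \<Rightarrow> ('n \<Rightarrow> 'i) \<Rightarrow> real^'n" where
  "family_normal y e = solve (family_matrix y e) (family_heights y e)"

text \<open>For fixed last coordinate \<open>snd u\<close> the orthogonality relations are a linear
  system for \<open>fst u\<close>, with right-hand side \<open>- snd u\<close> times the
  heights.\<close>

lemma orthogonal_family_iff:
  assumes "det (family_matrix y e) \<noteq> 0"
  shows "(\<forall>i. y (e i) \<bullet> u = 0) \<longleftrightarrow> u = - snd u *\<^sub>R (family_normal y e, -1)"
proof -
  have "(\<forall>i. y (e i) \<bullet> u = 0) \<longleftrightarrow> family_matrix y e *v fst u = - snd u *\<^sub>R family_heights y e"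
    by (auto simp: vec_eq_iff family_matrix_def family_heights_def matrix_vector_mul_component
        inner_prod_def eq_neg_iff_add_eq_0 mult.commute)
  also have "\<dots> \<longleftrightarrow> fst u = solve (family_matrix y e) (- snd u *\<^sub>R family_heights y e)"
    by (rule solve_iff[OF assms])
  also have "solve (family_matrix y e) (- snd u *\<^sub>R family_heights y e) = - snd u *\<^sub>R family_normal y e"
  proof (rule solve_iff[OF assms, THEN iffD1, symmetric])
    have "family_matrix y e *v family_normal y e = family_heights y e"
      unfolding family_normal_def using solve_iff[OF assms] by blast
    then show "family_matrix y e *v (- snd u *\<^sub>R family_normal y e) = - snd u *\<^sub>R family_heights y e"
      by (simp add: linear_scale[OF matrix_vector_mul_linear] linear_neg[OF matrix_vector_mul_linear])
  qed
  also have "fst u = - snd u *\<^sub>R family_normal y e \<longleftrightarrow> u = - snd u *\<^sub>R (family_normal y e, -1)"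
    by (auto simp: prod_eq_iff)
  finally show ?thesis .
qed

text \<open>If the orthogonal complement is a line, the points of \<open>B\<close> span all but one
  of the \<open>CARD('n) + 1\<close> dimensions.\<close>

lemma facet_pattern_imp_card_ge:
  fixes y :: "'i \<Rightarrow> (real^'n) \<times> real"
  assumes "finite N" "facet_pattern y N B"
  shows "CARD('n) \<le> card B"
proof -
  have B: "finite B" using assms finite_subset by (auto simp: facet_pattern_def)
  have "dim (y ` B) = CARD('n)"
    using dim_orthogonal_family[of B y] assms(2) by (simp add: facet_pattern_def)
  moreover have "dim (y ` B) \<le> card (y ` B)" using B by (intro dim_le_card') auto
  ultimately show ?thesis using card_image_le[OF B, of y] by linarith
qed

text \<open>In general position a facet contains exactly \<open>CARD('n)\<close> points, since
  another one would lie on the hyperplane through these. The normal is then unique up to a factor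
  whose sign selects the side.\<close>

lemma facet_pattern_generic_iff:
  fixes y :: "'i \<Rightarrow> (real^'n) \<times> real"
  assumes N: "finite N" "CARD('n) < card N"
    and e: "\<And>I. I \<subseteq> N \<Longrightarrow> card I = CARD('n) \<Longrightarrow> range (e I) = I"
    and det: "\<And>I. I \<subseteq> N \<Longrightarrow> card I = CARD('n) \<Longrightarrow> det (family_matrix y (e I)) \<noteq> 0"
    and gen: "\<And>I j. I \<subseteq> N \<Longrightarrow> card I = CARD('n) \<Longrightarrow> j \<in> N - I \<Longrightarrow>
         fst (y j) \<bullet> family_normal y (e I) \<noteq> snd (y j)"
  shows "facet_pattern y N B \<longleftrightarrow> B \<subseteq> N \<and> card B = CARD('n) \<and>
     ((\<forall>j\<in>N - B. fst (y j) \<bullet> family_normal y (e B) < snd (y j)) \<or>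
      (\<forall>j\<in>N - B. snd (y j) < fst (y j) \<bullet> family_normal y (e B)))"
    (is "_ \<longleftrightarrow> ?R")
proof -
  have orth: "(\<forall>i\<in>I. y i \<bullet> u = 0) \<longleftrightarrow> u = - snd u *\<^sub>R (family_normal y (e I), -1)"
    if "I \<subseteq> N" "card I = CARD('n)" for I u
  proof -
    have "(\<forall>i\<in>range (e I). y i \<bullet> u = 0) \<longleftrightarrow> (\<forall>i. y (e I i) \<bullet> u = 0)"
      by simp
    then show ?thesis unfolding orthogonal_family_iff[OF det[OF that]] e[OF that] .
  qed
  show ?thesis
  proof
    assume pat: "facet_pattern y N B"
    then have BN: "B \<subseteq> N" by (simp add: facet_pattern_def)
    obtain u where u: "\<forall>i\<in>B. y i \<bullet> u = 0" "\<forall>i\<in>N - B. 0 < y i \<bullet> u"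
      using pat by (auto simp: facet_pattern_def)
    \<comment> \<open>The supporting \<open>u\<close> might be 0 as long as \<open>B = N\<close> is
      not excluded; a nonzero normal comes from the dimension condition.\<close>
    have "\<not> {u. \<forall>i\<in>B. y i \<bullet> u = 0} \<subseteq> {0}"
      using pat by (auto simp: facet_pattern_def simp flip: dim_eq_0)
    then obtain w where w: "w \<noteq> 0" "\<forall>i\<in>B. y i \<bullet> w = 0" by blast
    obtain I where I: "I \<subseteq> B" "card I = CARD('n)" "finite I"
      by (rule obtain_subset_with_card_n[OF facet_pattern_imp_card_ge[OF N(1) pat]])
    have IN: "I \<subseteq> N" using I BN by blast
    have "B = I"
    proof (rule ccontr)
      assume "B \<noteq> I"
      then obtain j where j: "j \<in> B" "j \<notin> I" using I by blast
      have "w = - snd w *\<^sub>R (family_normal y (e I), -1)" using orth[OF IN I(2)] w(2) I(1) by blast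
      then obtain s where ws: "w = s *\<^sub>R (family_normal y (e I), -1)" by blast
      then have "s \<noteq> 0" using w(1) by (auto simp: zero_prod_def)
      have "y j \<bullet> w = 0" using w(2) j(1) by blast
      then have "s * (fst (y j) \<bullet> family_normal y (e I) - snd (y j)) = 0"
        unfolding ws by (simp add: inner_prod_def algebra_simps)
      then show False using gen[OF IN I(2), of j] j BN \<open>s \<noteq> 0\<close> by auto
    qed
    define s where "s = - snd u"
    have us: "u = s *\<^sub>R (family_normal y (e B), -1)"
      using orth[OF IN I(2)] u(1) unfolding s_def \<open>B = I\<close> by blast
    have yu: "y j \<bullet> u = s * (fst (y j) \<bullet> family_normal y (e B) - snd (y j))" for j
      unfolding us by (simp add: inner_prod_def algebra_simps)
    have "(\<forall>j\<in>N - B. fst (y j) \<bullet> family_normal y (e B) < snd (y j)) \<or>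
      (\<forall>j\<in>N - B. snd (y j) < fst (y j) \<bullet> family_normal y (e B))"
    proof (cases "s < 0")
      case True
      then show ?thesis using u(2) unfolding yu by (auto simp: zero_less_mult_iff)
    next
      case False
      then show ?thesis using u(2) unfolding yu by (auto simp: zero_less_mult_iff)
    qed
    then show ?R using BN I \<open>B = I\<close> by blast
  next
    assume R: ?R
    then have BN: "B \<subseteq> N" and cB: "card B = CARD('n)" by auto
    define a where "a = (family_normal y (e B), -1::real)"
    have a: "y i \<bullet> a = 0" if "i \<in> B" for i
      using orth[OF BN cB, of a] that by (auto simp: a_def)
    have ya: "y j \<bullet> a = fst (y j) \<bullet> family_normal y (e B) - snd (y j)" for j
      by (simp add: a_def inner_prod_def)
    have "\<exists>u. (\<forall>i\<in>B. y i \<bullet> u = 0) \<and> (\<forall>i\<in>N - B. 0 < y i \<bullet> u)"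
    proof (cases "\<forall>j\<in>N - B. snd (y j) < fst (y j) \<bullet> family_normal y (e B)")
      case True
      then show ?thesis using a by (intro exI[of _ a]) (simp add: ya)
    next
      case False
      then have "\<forall>j\<in>N - B. fst (y j) \<bullet> family_normal y (e B) < snd (y j)" using R by blast
      then show ?thesis using a by (intro exI[of _ "- a"]) (simp add: ya)
    qed
    moreover have "{u. \<forall>i\<in>B. y i \<bullet> u = 0} = span {a}"
    proof (intro equalityI subsetI)
      fix u assume "u \<in> {u. \<forall>i\<in>B. y i \<bullet> u = 0}"
      then have "u = - snd u *\<^sub>R a" using orth[OF BN cB, of u] unfolding a_def by blast
      then have "u \<in> range (\<lambda>k. k *\<^sub>R a)" by blast
      then show "u \<in> span {a}" unfolding span_singleton .
    next
      fix u assume "u \<in> span {a}"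
      then obtain k where "u = k *\<^sub>R a" unfolding span_singleton by (elim rangeE)
      then show "u \<in> {u. \<forall>i\<in>B. y i \<bullet> u = 0}" using a by simp
    qed
    moreover have "a \<noteq> 0" by (simp add: a_def zero_prod_def)
    ultimately show "facet_pattern y N B"
      unfolding facet_pattern_def using BN by (simp add: dim_singleton)
  qed
qed

text \<open>A hyperplane is counted at most once: as there are more than \<open>CARD('n)\<close>
  points, some \<open>j\<close> remains outside \<open>I\<close> and cannot lie on both
  sides.\<close>

lemma card_facet_pattern_generic:
  fixes y :: "'i \<Rightarrow> (real^'n) \<times> real"
  assumes N: "finite N" "CARD('n) < card N"
    and e: "\<And>I. I \<subseteq> N \<Longrightarrow> card I = CARD('n) \<Longrightarrow> range (e I) = I"
    and det: "\<And>I. I \<subseteq> N \<Longrightarrow> card I = CARD('n) \<Longrightarrow> det (family_matrix y (e I)) \<noteq> 0"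
    and gen: "\<And>I j. I \<subseteq> N \<Longrightarrow> card I = CARD('n) \<Longrightarrow> j \<in> N - I \<Longrightarrow>
         fst (y j) \<bullet> family_normal y (e I) \<noteq> snd (y j)"
  shows "card {B. facet_pattern y N B} = (\<Sum>I | I \<subseteq> N \<and> card I = CARD('n).
      of_bool (\<forall>j\<in>N - I. fst (y j) \<bullet> family_normal y (e I) < snd (y j)) +
      of_bool (\<forall>j\<in>N - I. snd (y j) < fst (y j) \<bullet> family_normal y (e I)))"
    (is "_ = (\<Sum>I\<in>?S. of_bool (?P I) + of_bool (?Q I))")
proof -
  have finS: "finite ?S" using N by simp
  have "{B. facet_pattern y N B} = {I \<in> ?S. ?P I} \<union> {I \<in> ?S. ?Q I}"
  proof (intro set_eqI)
    fix B
    have "facet_pattern y N B \<longleftrightarrow> B \<subseteq> N \<and> card B = CARD('n) \<and> (?P B \<or> ?Q B)"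
      by (rule facet_pattern_generic_iff[where e=e]; fact N e det gen)
    then show "B \<in> {B. facet_pattern y N B} \<longleftrightarrow> B \<in> {I \<in> ?S. ?P I} \<union> {I \<in> ?S. ?Q I}"
      unfolding mem_Collect_eq Un_iff by blast
  qed
  moreover have "{I \<in> ?S. ?P I} \<inter> {I \<in> ?S. ?Q I} = {}"
  proof (rule ccontr)
    assume "{I \<in> ?S. ?P I} \<inter> {I \<in> ?S. ?Q I} \<noteq> {}"
    then obtain I where I: "I \<subseteq> N" "card I = CARD('n)" "?P I" "?Q I" by blast
    then obtain j where "j \<in> N - I" using N(2) by (metis DiffI less_irrefl subsetI subset_antisym)
    then show False using I(3,4) by (meson less_asym)
  qed
  ultimately have "card {B. facet_pattern y N B} = card {I \<in> ?S. ?P I} + card {I \<in> ?S. ?Q I}"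
    using card_Un_disjoint[OF finite_subset[OF _ finS] finite_subset[OF _ finS], of "{I \<in> ?S. ?P I}" "{I \<in> ?S. ?Q I}"]
    by (simp only: Collect_subset)
  also have "\<dots> = (\<Sum>I\<in>?S. of_bool (?P I) + of_bool (?Q I))"
  proof -
    have "{I \<in> ?S. R I} = ?S \<inter> {I. R I}" for R by blast
    then show ?thesis
      by (simp add: sum.distrib finS del: mem_Collect_eq)
  qed
  finally show ?thesis .
qed

text \<open>A pattern needs at least \<open>CARD('n)\<close> indices, so here it can only be
  \<open>N\<close> itself.\<close>

lemma card_facet_pattern_le_1:
  fixes y :: "'i \<Rightarrow> (real^'n) \<times> real"
  assumes "finite N" "card N \<le> CARD('n)"
  shows "card {B. facet_pattern y N B} \<le> 1"
proof -
  have "{B. facet_pattern y N B} \<subseteq> {N}"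
  proof clarify
    fix B assume pat: "facet_pattern y N B"
    show "B = N"
      using facet_pattern_imp_card_ge[OF assms(1) pat] assms pat
      by (intro card_seteq) (auto simp: facet_pattern_def)
  qed
  then show ?thesis using card_mono[of "{N}"] by force
qed

section \<open>The moment inequality\<close>

lemma DERIV_powr_one_plus_square:
  "((\<lambda>x. (1 + x\<^sup>2) powr p) has_real_derivative 2 * p * x * (1 + x\<^sup>2) powr (p - 1)) (at x)"
proof -
  have "0 < 1 + x\<^sup>2" by (simp add: add_pos_nonneg)
  then show ?thesis
    by (auto intro!: derivative_eq_intros)
qed

lemma tendsto_powr_one_plus_square:
  assumes "p < 0"
  shows "((\<lambda>x::real. (1 + x\<^sup>2) powr p) \<longlongrightarrow> 0) at_top"
proof (rule tendsto_neg_powr[OF assms])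
  show "filterlim (\<lambda>x::real. 1 + x\<^sup>2) at_top at_top" by real_asymp
qed

text \<open>The inequality draws only on the density and the limits of \<open>V\<close>. The
  exponent is that of Student's law with \<open>\<alpha> + 1\<close> degrees of freedom, without the
  usual rescaling.\<close>

locale beta_prime_cdf =
  fixes \<alpha> c :: real and V :: "real \<Rightarrow> real"
  assumes \<alpha>: "\<alpha> > -1" and c: "c > 0"
    and DV: "\<And>x. (V has_real_derivative c * (1 + x\<^sup>2) powr (-(\<alpha> + 2) / 2)) (at x)"
    and V_bot: "(V \<longlongrightarrow> 0) at_bot" and V_top: "(V \<longlongrightarrow> 1) at_top"
begin

definition v :: "real \<Rightarrow> real" where "v x = c * (1 + x\<^sup>2) powr (-(\<alpha> + 2) / 2)"

lemma one_plus_square_pos: "0 < 1 + (x::real)\<^sup>2"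
  by (simp add: add_pos_nonneg)

lemma v_pos: "0 < v x"
  using c one_plus_square_pos[of x] by (simp add: v_def)

lemma DV': "(V has_real_derivative v x) (at x)"
  using DV by (simp add: v_def)

lemma V_strict_mono: "x < y \<Longrightarrow> V x < V y"
  by (rule DERIV_pos_imp_increasing[of x y V]) (use DV' v_pos in blast)+

lemma V_pos: "0 < V x"
proof -
  \<comment> \<open>The limit gives weak inequalities only; the shift to \<open>x - 1\<close> makes
    the conclusion strict.\<close>
  have "0 \<le> V (x - 1)"
  proof (rule tendsto_upperbound[OF V_bot])
    show "\<forall>\<^sub>F y in at_bot. V y \<le> V (x - 1)"
      using eventually_le_at_bot[of "x - 1"] by eventually_elim (use V_strict_mono in \<open>force simp: le_less\<close>)
  qed simp
  also have "V (x - 1) < V x" by (rule V_strict_mono) simp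
  finally show ?thesis .
qed

lemma V_less_1: "V x < 1"
proof -
  have "V x < V (x + 1)" by (rule V_strict_mono) simp
  also have "V (x + 1) \<le> 1"
  proof (rule tendsto_lowerbound[OF V_top])
    show "\<forall>\<^sub>F y in at_top. V (x + 1) \<le> V y"
      using eventually_ge_at_top[of "x + 1"] by eventually_elim (use V_strict_mono in \<open>force simp: le_less\<close>)
  qed simp
  finally show ?thesis .
qed

lemma V_cont: "continuous_on A V"
  using DV' by (meson DERIV_isCont continuous_at_imp_continuous_on)

lemma V_surj:
  assumes "0 < t" "t < 1"
  obtains x where "V x = t"
proof -
  obtain a where a: "V a < t"
    using order_tendstoD(2)[OF V_bot \<open>0 < t\<close>] by (metis eventually_at_bot_linorder order_refl)
  obtain b where b: "t < V b"
    using order_tendstoD(1)[OF V_top \<open>t < 1\<close>] by (metis eventually_at_top_linorder order_refl)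
  have "a \<le> b" using a b V_strict_mono[of b a] by linarith
  then show thesis
    using IVT'[of V a t b] a b V_cont that by force
qed

text \<open>Chosen so that Student's density with \<open>d * (\<alpha> + 1)\<close> degrees of
  freedom is proportional to \<open>v * L ^ (d - 1)\<close>: its exponent
  \<open>-(d * (\<alpha> + 1) + 1) / 2\<close> is \<open>-(\<alpha> + 2) / 2\<close> plus
  \<open>d - 1\<close> times \<open>-(\<alpha> + 1) / 2\<close>.\<close>

definition L :: "real \<Rightarrow> real" where "L x = (1 + x\<^sup>2) powr (-(\<alpha> + 1) / 2)"

lemma L_pos: "0 < L x"
  using one_plus_square_pos[of x] by (simp add: L_def)

text \<open>The numerator of the derivative of \<open>L / (1 - V)\<close>, after removal of the
  positive factor \<open>(1 + x ^ 2) powr (-(\<alpha> + 2) / 2)\<close>.\<close>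

definition slope :: "real \<Rightarrow> real" where
  "slope x = c * L x - (\<alpha> + 1) * (x * (1 + x\<^sup>2) powr (-1/2)) * (1 - V x)"

text \<open>The slope tends to 0 at infinity and is strictly decreasing. In its derivative the
  contributions of \<open>L'\<close> and \<open>V'\<close> cancel, which leaves a negative multiple
  of \<open>1 - V\<close>.\<close>

lemma slope_pos: "0 < slope x"
proof -
  have D: "(slope has_real_derivative - (\<alpha> + 1) * (1 + x\<^sup>2) powr (-3/2) * (1 - V x)) (at x)" for x
  proof -
    let ?q = "1 + x\<^sup>2"
    have q: "0 < ?q" by (rule one_plus_square_pos)
    have e1: "?q powr (-1/2) = ?q * ?q powr (-3/2)"
      using powr_mult_base[of ?q "-3/2"] q by simp
    have e2: "?q powr (-1/2) * ?q powr (-(\<alpha> + 2) / 2) = ?q powr (-(\<alpha> + 1) / 2 - 1)"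
      unfolding powr_add[symmetric] by (rule arg_cong[where f="\<lambda>p. ?q powr p"]) (simp add: field_simps)
    have e3: "?q powr (-1/2 - 1) = ?q powr (-3/2)" by simp
    have "(slope has_real_derivative c * (2 * (-(\<alpha> + 1) / 2) * x * ?q powr (-(\<alpha> + 1) / 2 - 1)) -
        ((\<alpha> + 1) * (1 * ?q powr (-1/2) + (2 * (-1/2) * x * ?q powr (-1/2 - 1)) * x) * (1 - V x)
          + (0 - v x) * ((\<alpha> + 1) * (x * ?q powr (-1/2))))) (at x)"
      unfolding slope_def[abs_def] L_def
      by (intro DERIV_diff DERIV_mult DERIV_cmult DERIV_powr_one_plus_square DV' DERIV_const DERIV_ident)
    also have "c * (2 * (-(\<alpha> + 1) / 2) * x * ?q powr (-(\<alpha> + 1) / 2 - 1)) -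
        ((\<alpha> + 1) * (1 * ?q powr (-1/2) + (2 * (-1/2) * x * ?q powr (-1/2 - 1)) * x) * (1 - V x)
          + (0 - v x) * ((\<alpha> + 1) * (x * ?q powr (-1/2))))
        = - (\<alpha> + 1) * x * c * ?q powr (-(\<alpha> + 1) / 2 - 1) - (\<alpha> + 1) * (?q powr (-1/2) - x\<^sup>2 * ?q powr (-3/2)) * (1 - V x)
          + (\<alpha> + 1) * x * c * (?q powr (-1/2) * ?q powr (-(\<alpha> + 2) / 2))"
      unfolding e3 v_def by (simp add: field_simps power2_eq_square)
    also have "\<dots> = - (\<alpha> + 1) * (?q powr (-3/2)) * (1 - V x)"
      unfolding e2 unfolding e1 by (simp add: algebra_simps)
    finally show ?thesis .
  qed
  have dec: "slope y < slope x" if "x < y" for x y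
  proof (rule DERIV_neg_imp_decreasing[OF that])
    fix z assume "x \<le> z" "z \<le> y"
    have "- (\<alpha> + 1) * (1 + z\<^sup>2) powr (-3/2) * (1 - V z) < 0"
      using \<alpha> one_plus_square_pos[of z] V_less_1[of z] by (simp add: mult_neg_pos)
    with D show "\<exists>l. (slope has_real_derivative l) (at z) \<and> l < 0" by blast
  qed
  have "(slope \<longlongrightarrow> c * 0 - (\<alpha> + 1) * 1 * (1 - 1)) at_top"
    unfolding slope_def[abs_def] L_def
  proof (intro tendsto_intros V_top)
    show "((\<lambda>x::real. (1 + x\<^sup>2) powr (-(\<alpha> + 1) / 2)) \<longlongrightarrow> 0) at_top"
      using \<alpha> by (intro tendsto_powr_one_plus_square) simp
    show "((\<lambda>x::real. x * (1 + x\<^sup>2) powr (-1/2)) \<longlongrightarrow> 1) at_top"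
      by real_asymp
  qed
  then have lim: "(slope \<longlongrightarrow> 0) at_top" by simp
  have "0 \<le> slope (x + 1)"
  proof (rule tendsto_upperbound[OF lim])
    show "\<forall>\<^sub>F y in at_top. slope y \<le> slope (x + 1)"
      using eventually_ge_at_top[of "x + 1"] by eventually_elim (use dec in \<open>force simp: le_less\<close>)
  qed simp
  also have "slope (x + 1) < slope x" by (rule dec) simp
  finally show ?thesis .
qed

text \<open>In the variable \<open>V\<close> the function \<open>L\<close> is strictly concave and vanishes at \<open>V = 1\<close>,
  so its slope seen from that end point increases.\<close>

lemma chord_slope_strict_mono:
  assumes "x < y"
  shows "L x / (1 - V x) < L y / (1 - V y)"
proof (rule DERIV_pos_imp_increasing[of x y "\<lambda>x. L x / (1 - V x)", OF assms])
  fix z :: real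
  let ?q = "1 + z\<^sup>2"
  have V1: "1 - V z \<noteq> 0" using V_less_1[of z] by simp
  have "((\<lambda>x. L x / (1 - V x)) has_real_derivative
     (2 * (-(\<alpha> + 1) / 2) * z * ?q powr (-(\<alpha> + 1) / 2 - 1) * (1 - V z) - L z * (0 - v z)) / ((1 - V z) * (1 - V z))) (at z)"
    unfolding L_def
    by (intro DERIV_divide DERIV_diff DERIV_powr_one_plus_square DV' DERIV_const V1)
  also have "2 * (-(\<alpha> + 1) / 2) * z * ?q powr (-(\<alpha> + 1) / 2 - 1) * (1 - V z) - L z * (0 - v z)
    = ?q powr (-(\<alpha> + 2) / 2) * slope z"
  proof -
    have "?q powr (-(\<alpha> + 1) / 2 - 1) = ?q powr (-(\<alpha> + 2) / 2) * ?q powr (-1/2)"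
      unfolding powr_add[symmetric] by (rule arg_cong[where f="\<lambda>p. ?q powr p"]) (simp add: field_simps)
    then show ?thesis unfolding v_def slope_def by (simp add: field_simps)
  qed
  finally show "\<exists>l. ((\<lambda>x. L x / (1 - V x)) has_real_derivative l) (at z) \<and> 0 < l"
    using slope_pos[of z] one_plus_square_pos[of z] V_less_1[of z]
    by (metis (no_types, lifting) diff_gt_0_iff_gt divide_pos_pos mult_pos_pos powr_gt_zero less_irrefl)
qed

text \<open>\<open>w\<close> is the derivative of \<open>V ^ k * (1 - V) ^ d\<close>, which tends to
  0 at both ends. Thus for the weight \<open>(1 - V) ^ (d - 1) * v\<close> the two moments balance
  exactly.\<close>

lemma integral_boundary_term:
  assumes "integrable lborel v" and "k \<ge> 1" and "d \<ge> 1"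
  defines "w \<equiv> \<lambda>x. V x ^ (k - 1) * (1 - V x) ^ (d - 1) * v x * (real k - real (k + d) * V x)"
  shows "integrable lborel w" "(\<integral>x. w x \<partial>lborel) = 0"
proof -
  have contv: "continuous_on A v" for A
    unfolding v_def[abs_def] using one_plus_square_pos
    by (intro continuous_intros) (metis less_irrefl)
  have contw: "continuous_on A w" for A
    unfolding w_def by (intro continuous_intros contv V_cont)
  have [measurable]: "w \<in> borel_measurable lborel"
    using borel_measurable_continuous_onI[OF contw] by simp
  have "norm (w x) \<le> norm (real (2 * k + d) * v x)" for x
  proof -
    have 1: "\<bar>V x ^ (k - 1)\<bar> \<le> 1" "\<bar>(1 - V x) ^ (d - 1)\<bar> \<le> 1"
      using V_pos[of x] V_less_1[of x] by (auto simp: power_le_one)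
    have "\<bar>real k - real (k + d) * V x\<bar> \<le> real k + real (k + d) * V x"
      using V_pos[of x] by (simp add: abs_le_iff)
    also have "\<dots> \<le> real k + real (k + d) * 1"
      using V_less_1[of x] by (intro add_left_mono mult_left_mono) auto
    finally have 2: "\<bar>real k - real (k + d) * V x\<bar> \<le> real (2 * k + d)" by simp
    have "\<bar>w x\<bar> = \<bar>V x ^ (k - 1)\<bar> * \<bar>(1 - V x) ^ (d - 1)\<bar> * \<bar>v x\<bar> * \<bar>real k - real (k + d) * V x\<bar>"
      by (simp add: w_def abs_mult)
    also have "\<dots> \<le> 1 * 1 * \<bar>v x\<bar> * real (2 * k + d)"
      by (intro mult_mono 1 2) auto
    finally show ?thesis by (simp add: abs_mult mult.commute)
  qed
  then show int: "integrable lborel w"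
    by (intro Bochner_Integration.integrable_bound[OF integrable_mult_right[OF assms(1), of "real (2 * k + d)"]]) auto
  define W where "W x = V x ^ k * (1 - V x) ^ d" for x
  have DW: "(W has_real_derivative w x) (at x)" for x
  proof -
    obtain k' d' where kd: "k = Suc k'" "d = Suc d'" using assms by (metis Suc_le_D One_nat_def)
    show ?thesis
      unfolding W_def[abs_def] w_def kd
      by (rule DERIV_cong, (rule derivative_eq_intros DV' refl)+) (simp add: algebra_simps)
  qed
  have "(LBINT x=-\<infinity>..\<infinity>. w x) = 0 - 0"
  proof (rule interval_integral_FTC_integrable[where F=W])
    show "set_integrable lborel (einterval (-\<infinity>) \<infinity>) w"
      using int by (simp add: set_integrable_def)
    have "(W \<longlongrightarrow> 0 ^ k * (1 - 0) ^ d) at_bot" "(W \<longlongrightarrow> 1 ^ k * (1 - 1) ^ d) at_top"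
      unfolding W_def[abs_def] by (intro tendsto_intros V_bot V_top)+
    then show "((W \<circ> real_of_ereal) \<longlongrightarrow> 0) (at_right (-\<infinity>))" "((W \<circ> real_of_ereal) \<longlongrightarrow> 0) (at_left \<infinity>)"
      using assms by (simp_all add: ereal_tendsto_simps power_0_left)
    show "isCont w x" for x
      using contw[of UNIV] by (simp add: continuous_on_eq_continuous_at)
  qed (use DW in \<open>simp_all add: has_real_derivative_iff_has_vector_derivative\<close>)
  then show "(\<integral>x. w x \<partial>lborel) = 0"
    by (simp add: interval_integral_to_infinity_eq interval_lebesgue_integral_def set_lebesgue_integral_def)
qed

text \<open>An argument of Chebyshev type. The difference of the two sides integrates
  \<open>- w / c\<close> times the increasing function \<open>m ^ (d - 1)\<close>. Subtracting from
  this function its value at the only sign change \<open>x0\<close> of \<open>w\<close> does not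
  affect the integral, since \<open>w\<close> has integral 0, and makes the integrand positive off
  \<open>x0\<close>.\<close>

lemma moment_inequality:
  fixes k d :: nat
  defines "g \<equiv> \<lambda>x::real. (1 + x\<^sup>2) powr (-(real d * (\<alpha> + 1) + 1) / 2)"
  assumes iv: "integrable lborel v" and ig: "integrable lborel g" and k: "k \<ge> 1" and d: "d \<ge> 2"
  shows "real k * (\<integral>x. V x ^ (k - 1) * g x \<partial>lborel) < real (k + d) * (\<integral>x. V x ^ k * g x \<partial>lborel)"
proof -
  define w where "w x = V x ^ (k - 1) * (1 - V x) ^ (d - 1) * v x * (real k - real (k + d) * V x)" for x
  have w: "integrable lborel w" "(\<integral>x. w x \<partial>lborel) = 0"
    using integral_boundary_term[OF iv k, of d] d unfolding w_def[abs_def] by auto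
  have kd: "0 < real k / real (k + d)" "real k / real (k + d) < 1"
    using k d by (auto simp: field_simps)
  obtain x0 where x0: "V x0 = real k / real (k + d)" using V_surj[OF kd] .
  define m where "m x = L x / (1 - V x)" for x
  have m_pos: "0 < m x" for x using L_pos[of x] V_less_1[of x] by (simp add: m_def)
  have g_eq: "g x = v x / c * L x ^ (d - 1)" for x
  proof -
    have "L x ^ (d - 1) = (1 + x\<^sup>2) powr (real (d - 1) * (-(\<alpha> + 1) / 2))"
      using one_plus_square_pos[of x] by (simp add: L_def powr_realpow[symmetric] powr_powr mult.commute)
    then have "v x / c * L x ^ (d - 1) = (1 + x\<^sup>2) powr (-(\<alpha> + 2) / 2 + real (d - 1) * (-(\<alpha> + 1) / 2))"
      using c by (simp add: v_def powr_add)
    also have "-(\<alpha> + 2) / 2 + real (d - 1) * (-(\<alpha> + 1) / 2) = -(real d * (\<alpha> + 1) + 1) / 2"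
      using d by (simp add: of_nat_diff field_simps)
    finally show ?thesis by (simp add: g_def)
  qed
  define f where "f x = V x ^ (k - 1) * (real (k + d) * V x - real k) * g x" for x
  have f_eq: "f x = - (w x / c) * m x ^ (d - 1)" for x
  proof -
    have "L x ^ (d - 1) = m x ^ (d - 1) * (1 - V x) ^ (d - 1)"
      using V_less_1[of x] by (simp add: m_def power_divide)
    then show ?thesis using c by (simp add: f_def w_def g_eq field_simps)
  qed
  have contg: "continuous_on UNIV g"
    unfolding g_def using one_plus_square_pos by (intro continuous_intros) (metis less_irrefl)
  have [measurable]: "g \<in> borel_measurable lborel" "V \<in> borel_measurable lborel"
    using borel_measurable_continuous_onI[OF contg] borel_measurable_continuous_onI[OF V_cont] by simp_all
  have iVg: "integrable lborel (\<lambda>x. V x ^ j * g x)" for j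
  proof (rule Bochner_Integration.integrable_bound[OF ig])
    show "AE x in lborel. norm (V x ^ j * g x) \<le> norm (g x)"
    proof (rule AE_I2)
      fix x
      have "\<bar>V x ^ j\<bar> * \<bar>g x\<bar> \<le> 1 * \<bar>g x\<bar>"
        using V_pos[of x] V_less_1[of x] by (intro mult_right_mono) (auto simp: power_le_one)
      then show "norm (V x ^ j * g x) \<le> norm (g x)" by (simp add: abs_mult)
    qed
  qed measurable
  have f_alt: "f x = real (k + d) * (V x ^ k * g x) - real k * (V x ^ (k - 1) * g x)" for x
  proof -
    have "V x ^ k = V x ^ (k - 1) * V x" using k by (metis power_minus_mult le_eq_less_or_eq less_one not_le zero_less_one less_le_trans)
    then show ?thesis by (simp add: f_def algebra_simps)
  qed
  have intf: "integrable lborel f"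
    unfolding f_alt[abs_def] by (intro Bochner_Integration.integrable_diff integrable_mult_right iVg)
  define h where "h x = f x + m x0 ^ (d - 1) / c * w x" for x
  have h_eq: "h x = (m x ^ (d - 1) - m x0 ^ (d - 1)) * (- (w x / c))" for x
    by (simp add: h_def f_eq algebra_simps)
  have h_pos: "0 < h x" if "x \<noteq> x0" for x
  proof -
    have wpos: "0 < V x ^ (k - 1) * (1 - V x) ^ (d - 1) * v x"
      using V_pos[of x] V_less_1[of x] v_pos[of x] by simp
    show ?thesis
    proof (cases "x < x0")
      case True
      then have "V x < real k / real (k + d)" using V_strict_mono x0 by metis
      then have "0 < real k - real (k + d) * V x" using k by (simp add: field_simps)
      then have "- (w x / c) < 0" using wpos c by (simp add: w_def)
      \<comment> \<open>\<open>d \<ge> 2\<close> enters here: with exponent 0 the function would be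
        constant.\<close>
      moreover have "m x ^ (d - 1) < m x0 ^ (d - 1)"
        using chord_slope_strict_mono[OF True] m_pos[of x] d
        by (intro power_strict_mono) (auto simp: m_def[symmetric] less_imp_le)
      ultimately show ?thesis unfolding h_eq by (intro mult_neg_neg) simp_all
    next
      case False
      then have "x0 < x" using that by simp
      then have "real k / real (k + d) < V x" using V_strict_mono x0 by metis
      then have "real k - real (k + d) * V x < 0" using k by (simp add: field_simps)
      then have "0 < - (w x / c)" using wpos c by (simp add: w_def mult_pos_neg divide_neg_pos)
      moreover have "m x0 ^ (d - 1) < m x ^ (d - 1)"
        using chord_slope_strict_mono[OF \<open>x0 < x\<close>] m_pos[of x0] d
        by (intro power_strict_mono) (auto simp: m_def[symmetric] less_imp_le)
      ultimately show ?thesis unfolding h_eq by (intro mult_pos_pos) simp_all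
    qed
  qed
  have inth: "integrable lborel h"
    unfolding h_def by (intro Bochner_Integration.integrable_add integrable_mult_right intf w)
  have AEh: "AE x in lborel. 0 < h x"
    using AE_lborel_singleton[of x0] by eventually_elim (use h_pos in auto)
  have "0 < (\<integral>x. h x \<partial>lborel)"
  proof -
    have "(\<integral>x. h x \<partial>lborel) \<noteq> 0"
    proof
      assume "(\<integral>x. h x \<partial>lborel) = 0"
      then have "AE x in lborel. h x = 0"
        using integral_nonneg_eq_0_iff_AE[OF inth] AE_mp[OF AEh, of "\<lambda>x. 0 \<le> h x"] by simp
      with AEh have "AE x in (lborel :: real measure). False" by eventually_elim simp
      then show False by (auto simp: AE_iff_null dest: null_setsD1)
    qed
    moreover have "0 \<le> (\<integral>x. h x \<partial>lborel)"
      by (rule integral_nonneg_AE) (use AEh in \<open>auto elim: eventually_mono\<close>)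
    ultimately show ?thesis by simp
  qed
  also have "(\<integral>x. h x \<partial>lborel) = (\<integral>x. f x \<partial>lborel)"
    unfolding h_def using intf w by simp
  also have "\<dots> = real (k + d) * (\<integral>x. V x ^ k * g x \<partial>lborel) - real k * (\<integral>x. V x ^ (k - 1) * g x \<partial>lborel)"
    unfolding f_alt[abs_def] using iVg by simp
  finally show ?thesis by simp
qed

end

section \<open>Gaussian measures\<close>

lemma prod_Basis_vec:
  fixes f :: "'a::euclidean_space^'n \<Rightarrow> 'b::comm_monoid_mult"
  shows "(\<Prod>b\<in>Basis. f b) = (\<Prod>i\<in>UNIV. \<Prod>u\<in>Basis. f (axis i u))"
proof -
  have B: "(Basis :: ('a^'n) set) = (\<lambda>(i, u). axis i u) ` (UNIV \<times> Basis)"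
    by (auto simp: Basis_vec_def)
  have "inj_on (\<lambda>(i, u). axis i u :: 'a^'n) (UNIV \<times> Basis)"
    by (auto simp: inj_on_def axis_eq_axis)
  then show ?thesis
    unfolding B by (simp add: prod.reindex prod.cartesian_product comp_def split_def)
qed

lemma lborel_vec_eq_distr_PiM:
  "(lborel :: ('a::euclidean_space^'n) measure) = distr (PiM UNIV (\<lambda>_. lborel)) borel (\<lambda>f. \<chi> i. f i)"
proof (rule lborel_eqI)
  interpret product_sigma_finite "\<lambda>_::'n. lborel :: 'a measure" ..
  have [measurable]: "(\<lambda>f. \<chi> i. f i) \<in> (PiM UNIV (\<lambda>_::'n. lborel :: 'a measure)) \<rightarrow>\<^sub>M borel"
    by measurable
  fix l u :: "'a^'n" assume le: "\<And>b. b \<in> Basis \<Longrightarrow> l \<bullet> b \<le> u \<bullet> b"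
  have "(\<lambda>f. \<chi> i. f i) -` box l u \<inter> space (PiM UNIV (\<lambda>_::'n. lborel :: 'a measure)) =
      (\<Pi>\<^sub>E i\<in>UNIV. box (l $ i) (u $ i))"
    by (auto simp: space_PiM PiE_iff mem_box Basis_vec_def inner_axis)
  then have "emeasure (distr (PiM UNIV (\<lambda>_. lborel)) borel (\<lambda>f. \<chi> i. f i)) (box l u) =
      emeasure (PiM UNIV (\<lambda>_::'n. lborel :: 'a measure)) (\<Pi>\<^sub>E i\<in>UNIV. box (l $ i) (u $ i))"
    by (simp add: emeasure_distr)
  also have "\<dots> = (\<Prod>i\<in>UNIV. emeasure lborel (box (l $ i) (u $ i)))"
    by (rule emeasure_PiM) auto
  also have "\<dots> = (\<Prod>i\<in>UNIV. ennreal (\<Prod>v\<in>Basis. (u $ i - l $ i) \<bullet> v))"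
  proof (rule prod.cong[OF refl], rule emeasure_lborel_box)
    fix i and v :: 'a assume "v \<in> Basis"
    then have "axis i v \<in> (Basis :: ('a^'n) set)" by (auto simp: Basis_vec_def)
    from le[OF this] show "l $ i \<bullet> v \<le> u $ i \<bullet> v" by (simp add: inner_axis)
  qed
  also have "\<dots> = ennreal (\<Prod>b\<in>Basis. (u - l) \<bullet> b)"
    unfolding prod_Basis_vec
  proof (subst prod_ennreal)
    show "0 \<le> (\<Prod>v\<in>Basis. (u $ i - l $ i) \<bullet> v)" for i
    proof (rule prod_nonneg)
      fix v :: 'a assume "v \<in> Basis"
      then have "axis i v \<in> (Basis :: ('a^'n) set)" by (auto simp: Basis_vec_def)
      from le[OF this] show "0 \<le> (u $ i - l $ i) \<bullet> v" by (simp add: inner_axis inner_diff_left)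
    qed
  qed (simp add: inner_axis)
  finally show "emeasure (distr (PiM UNIV (\<lambda>_. lborel)) borel (\<lambda>f. \<chi> i. f i)) (box l u)
      = ennreal (\<Prod>b\<in>Basis. (u - l) \<bullet> b)" .
qed simp

text \<open>Stated for vector-valued coordinates, as it serves for the Gaussian rows of a matrix as
  well as for real chi coordinates.\<close>

lemma PiM_density_vec:
  fixes f :: "'a::euclidean_space \<Rightarrow> ennreal"
  assumes [measurable]: "f \<in> borel_measurable borel" and prob: "prob_space (density lborel f)"
  shows "distr (PiM UNIV (\<lambda>_::'n::finite. density lborel f)) borel (\<lambda>x. \<chi> i. x i)
    = density lborel (\<lambda>x. \<Prod>i\<in>UNIV. f (x $ i))"
proof -
  interpret prob_space "density lborel f" by fact
  interpret P: product_sigma_finite "\<lambda>_::'n. density lborel f" ..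
  interpret L: product_sigma_finite "\<lambda>_::'n. lborel :: 'a measure" ..
  let ?D = "density lborel (\<lambda>x::'a^'n. \<Prod>i\<in>UNIV. f (x $ i))"
  let ?\<pi> = "\<lambda>(x::'a^'n) i. x $ i"
  have [measurable]: "(\<lambda>x. \<chi> i. x i) \<in> (PiM UNIV (\<lambda>_::'n. lborel :: 'a measure)) \<rightarrow>\<^sub>M borel"
    by measurable
  have \<pi>[measurable]: "?\<pi> \<in> borel \<rightarrow>\<^sub>M PiM UNIV (\<lambda>_. density lborel f)"
    by (rule measurable_PiM_single') (auto simp: space_PiM)
  \<comment> \<open>Uniqueness of product measures is a statement on the function space, so the
    density is first transported there by the coordinate map.\<close>
  have eq: "distr ?D (PiM UNIV (\<lambda>_. density lborel f)) ?\<pi> = PiM UNIV (\<lambda>_. density lborel f)"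
  proof (rule P.PiM_eqI)
    fix A :: "'n \<Rightarrow> 'a set" assume "\<And>i. i \<in> UNIV \<Longrightarrow> A i \<in> sets (density lborel f)"
    then have A[measurable]: "A i \<in> sets borel" for i by simp
    have "emeasure (distr ?D (PiM UNIV (\<lambda>_. density lborel f)) ?\<pi>) (Pi\<^sub>E UNIV A)
      = emeasure ?D (?\<pi> -` Pi\<^sub>E UNIV A \<inter> space ?D)"
      by (rule emeasure_distr) (use A in \<open>auto intro!: sets_PiM_I_finite\<close>)
    also have "?\<pi> -` Pi\<^sub>E UNIV A \<inter> space ?D = {x. \<forall>i. x $ i \<in> A i}" by auto
    also have "emeasure ?D {x. \<forall>i. x $ i \<in> A i} =
      (\<integral>\<^sup>+x. (\<Prod>i\<in>UNIV. f (x $ i)) * indicator {x. \<forall>i. x $ i \<in> A i} x \<partial>lborel)"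
      by (rule emeasure_density) measurable
    also have "\<dots> = (\<integral>\<^sup>+x. (\<Prod>i\<in>UNIV. f (x $ i) * indicator (A i) (x $ i)) \<partial>lborel)"
    proof (rule nn_integral_cong)
      fix x :: "'a^'n"
      have "indicator {x. \<forall>i. x $ i \<in> A i} x = (\<Prod>i\<in>UNIV. indicator (A i) (x $ i) :: ennreal)"
        by (auto simp: indicator_def prod_zero_iff)
      then show "(\<Prod>i\<in>UNIV. f (x $ i)) * indicator {x. \<forall>i. x $ i \<in> A i} x =
          (\<Prod>i\<in>UNIV. f (x $ i) * indicator (A i) (x $ i))"
        by (simp add: prod.distrib)
    qed
    also have "\<dots> = (\<integral>\<^sup>+x. (\<Prod>i\<in>UNIV. f (x i) * indicator (A i) (x i)) \<partial>PiM UNIV (\<lambda>_::'n. lborel))"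
      by (subst lborel_vec_eq_distr_PiM, subst nn_integral_distr) auto
    also have "\<dots> = (\<Prod>i\<in>UNIV. \<integral>\<^sup>+x. f x * indicator (A i) x \<partial>lborel)"
      by (rule L.product_nn_integral_prod) auto
    also have "\<dots> = (\<Prod>i\<in>UNIV. emeasure (density lborel f) (A i))"
      by (simp add: emeasure_density)
    finally show "emeasure (distr ?D (PiM UNIV (\<lambda>_. density lborel f)) ?\<pi>) (Pi\<^sub>E UNIV A)
      = (\<Prod>i\<in>UNIV. emeasure (density lborel f) (A i))" .
  qed auto
  have "distr (PiM UNIV (\<lambda>_::'n. density lborel f)) borel (\<lambda>x. \<chi> i. x i) =
      distr ?D borel ((\<lambda>x. \<chi> i. x i) \<circ> ?\<pi>)"
    by (subst eq[symmetric], rule distr_distr) (auto simp: \<pi>)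
  also have "\<dots> = distr ?D ?D (\<lambda>x. x)" by (intro distr_cong) (auto simp: comp_def)
  also have "\<dots> = ?D" by (rule distr_id)
  finally show ?thesis .
qed

text \<open>One definition for numbers, vectors and matrices; a matrix is a Gaussian vector in the
  Euclidean space of its entries.\<close>

definition gauss :: "'a::euclidean_space measure" where
  "gauss = density lborel (\<lambda>x. ennreal (\<Prod>b\<in>Basis. std_normal_density (x \<bullet> b)))"

lemma sets_gauss [measurable_cong, simp]: "sets gauss = sets borel"
  by (simp add: gauss_def)

lemma space_gauss [simp]: "space gauss = UNIV"
  by (simp add: gauss_def)

lemma gauss_density_eq:
  fixes x :: "'a::euclidean_space"
  shows "(\<Prod>b\<in>Basis. std_normal_density (x \<bullet> b)) = (1 / sqrt (2 * pi)) ^ DIM('a) * exp (- (norm x)\<^sup>2 / 2)"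
proof -
  have "(\<Prod>b\<in>Basis. std_normal_density (x \<bullet> b)) =
      (\<Prod>b\<in>(Basis :: 'a set). 1 / sqrt (2 * pi)) * exp (\<Sum>b\<in>Basis. - (x \<bullet> b)\<^sup>2 / 2)"
    unfolding std_normal_density_def prod.distrib by (simp only: exp_sum[OF finite_Basis])
  also have "(\<Sum>b\<in>Basis. - (x \<bullet> b)\<^sup>2 / 2) = - (norm x)\<^sup>2 / 2"
  proof -
    have "(norm x)\<^sup>2 = (\<Sum>b\<in>Basis. (x \<bullet> b)\<^sup>2)"
      by (subst power2_norm_eq_inner, subst euclidean_inner) (simp add: power2_eq_square)
    then show ?thesis by (simp add: sum_negf sum_divide_distrib)
  qed
  finally show ?thesis by simp
qed

lemma gauss_eq_density_norm:
  "gauss = density lborel (\<lambda>x::'a::euclidean_space. ennreal ((1 / sqrt (2 * pi)) ^ DIM('a) * exp (- (norm x)\<^sup>2 / 2)))"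
  unfolding gauss_def gauss_density_eq ..

lemma prob_space_gauss: "prob_space (gauss :: 'a::euclidean_space measure)"
proof
  interpret N: prob_space "density lborel (\<lambda>x. ennreal (std_normal_density x))"
    by (rule prob_space_normal_density) simp
  have 1: "(\<integral>\<^sup>+x. ennreal (std_normal_density x) \<partial>lborel) = 1"
    using N.emeasure_space_1 by (simp add: emeasure_density)
  have "emeasure (gauss :: 'a measure) (space gauss) = (\<integral>\<^sup>+x. (\<Prod>b\<in>Basis. ennreal (std_normal_density ((x::'a) \<bullet> b))) \<partial>lborel)"
    by (simp add: gauss_def emeasure_density prod_ennreal)
  also have "\<dots> = 1"
    by (subst nn_integral_lborel_prod) (simp_all add: 1)
  finally show "emeasure (gauss :: 'a measure) (space gauss) = 1" .
qed

lemma density_distr_invariant: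
  assumes f: "f \<in> M \<rightarrow>\<^sub>M M" and inv: "distr M M f = M" and g: "g \<in> borel_measurable M"
    and gf: "\<And>x. g (f x) = g x"
  shows "distr (density M g) M f = density M g"
  using density_distr[OF g f] unfolding inv gf by (rule sym)

lemma distr_gauss_isometry:
  fixes f :: "'a::euclidean_space \<Rightarrow> 'a"
  assumes "linear f" and norm: "\<And>x. norm (f x) = norm x"
  shows "distr gauss borel f = gauss"
proof -
  have [measurable]: "f \<in> borel_measurable borel"
    using \<open>linear f\<close> by (intro borel_measurable_continuous_onI linear_continuous_on) (simp add: linear_conv_bounded_linear)
  have "distr lborel lborel f = lborel"
    using distr_lborel_isometry[OF assms] by (metis distr_cong sets_lborel)
  then have "distr gauss lborel f = gauss"
    unfolding gauss_eq_density_norm by (intro density_distr_invariant) (auto simp: norm)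
  then show ?thesis by (metis distr_cong sets_lborel)
qed

lemma gauss_vec_eq_distr_PiM:
  "(gauss :: ('a::euclidean_space^'n) measure) = distr (PiM UNIV (\<lambda>_. gauss)) borel (\<lambda>f. \<chi> i. f i)"
proof -
  have "distr (PiM UNIV (\<lambda>_. gauss)) borel (\<lambda>f. \<chi> i. f i) = density lborel (\<lambda>x::'a^'n. \<Prod>i\<in>UNIV.
      ennreal (\<Prod>b\<in>Basis. std_normal_density (x $ i \<bullet> b)))"
    unfolding gauss_def
    by (rule PiM_density_vec) (use prob_space_gauss in \<open>simp_all add: gauss_def\<close>)
  then show ?thesis
    by (simp add: gauss_def prod_ennreal prod_nonneg prod_Basis_vec inner_axis)
qed

lemma gauss_real: "(gauss :: real measure) = density lborel (\<lambda>x. ennreal (std_normal_density x))"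
  by (simp add: gauss_def)

text \<open>An orthogonal map takes v to a coordinate axis without changing the law, and each
  coordinate of a Gaussian vector is standard normal.\<close>

lemma gauss_inner_law:
  fixes v :: "real^'n"
  assumes "norm v = 1"
  shows "distr gauss borel (\<lambda>x. x \<bullet> v) = (gauss :: real measure)"
proof -
  obtain k :: 'n where True by blast
  obtain f where f: "orthogonal_transformation f" "f v = (axis k 1 :: real^'n)"
    by (rule orthogonal_transformation_exists[of v "axis k 1"]) (simp_all add: assms)
  then have lin: "linear f" and norm: "\<And>x. norm (f x) = norm x"
    unfolding orthogonal_transformation by blast+
  have [measurable]: "f \<in> borel_measurable borel"
    using lin by (intro borel_measurable_continuous_onI linear_continuous_on) (simp add: linear_conv_bounded_linear)
  have "x \<bullet> v = f x $ k" for x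
  proof -
    have "f x \<bullet> f v = x \<bullet> v" using f(1) unfolding orthogonal_transformation_def by blast
    then show ?thesis unfolding f(2) by (simp add: inner_axis)
  qed
  then have "distr gauss borel (\<lambda>x. x \<bullet> v) = distr gauss borel ((\<lambda>x. x $ k) \<circ> f)"
    by (simp add: comp_def)
  also have "\<dots> = distr (distr gauss borel f) borel (\<lambda>x. x $ k)"
    by (rule distr_distr[symmetric]) measurable
  also have "\<dots> = distr gauss borel (\<lambda>x. x $ k)"
    unfolding distr_gauss_isometry[OF lin norm] ..
  also have "\<dots> = distr (PiM UNIV (\<lambda>_. gauss)) borel (\<lambda>x. x k)"
    by (subst gauss_vec_eq_distr_PiM, subst distr_distr) (auto simp: comp_def)
  also have "\<dots> = distr (PiM UNIV (\<lambda>_. gauss)) gauss (\<lambda>x. x k)"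
    by (rule distr_cong) auto
  also have "\<dots> = gauss"
    by (rule distr_PiM_component) (auto simp: prob_space_gauss)
  finally show ?thesis .
qed

section \<open>Chi and Student distributions\<close>

text \<open>Saves the computation of normalising constants: the integral of \<open>f\<close>
  determines the factor.\<close>

lemma prob_space_density_unique:
  fixes a b :: ennreal
  assumes f[measurable]: "f \<in> borel_measurable M"
    and "prob_space (density M (\<lambda>x. a * f x))" "prob_space (density M (\<lambda>x. b * f x))"
  shows "density M (\<lambda>x. a * f x) = density M (\<lambda>x. b * f x)"
proof -
  have 1: "c * (\<integral>\<^sup>+x. f x \<partial>M) = 1" if "prob_space (density M (\<lambda>x. c * f x))" for c
  proof -
    have "1 = emeasure (density M (\<lambda>x. c * f x)) (space M)"
      using prob_space.emeasure_space_1[OF that] by simp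
    also have "\<dots> = (\<integral>\<^sup>+x. c * f x * indicator (space M) x \<partial>M)"
      by (rule emeasure_density) auto
    also have "\<dots> = (\<integral>\<^sup>+x. c * f x \<partial>M)"
      by (intro nn_integral_cong) simp
    also have "\<dots> = c * (\<integral>\<^sup>+x. f x \<partial>M)"
      by (rule nn_integral_cmult) auto
    finally show ?thesis by simp
  qed
  have "a = a * (b * (\<integral>\<^sup>+x. f x \<partial>M))" using 1[OF assms(3)] by simp
  also have "\<dots> = b * (a * (\<integral>\<^sup>+x. f x \<partial>M))" by (simp only: ac_simps)
  also have "\<dots> = b" using 1[OF assms(2)] by simp
  finally show ?thesis by simp
qed

text \<open>The unnormalised chi density, with a real number p of degrees of freedom. The heights
  use \<open>p = \<alpha> + 1\<close>, so that the power of t is \<open>\<alpha>\<close>.\<close>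

definition chi_weight :: "real \<Rightarrow> real \<Rightarrow> real" where
  "chi_weight p t = indicator {0<..} t * t powr (p - 1) * exp (- t\<^sup>2 / 2)"

definition chi_const :: "real \<Rightarrow> real" where
  "chi_const p = enn2real (\<integral>\<^sup>+t. ennreal (chi_weight p t) \<partial>lborel)"

definition chi :: "real \<Rightarrow> real measure" where
  "chi p = density lborel (\<lambda>t. ennreal (chi_weight p t / chi_const p))"

lemma chi_weight_nonneg [simp]: "0 \<le> chi_weight p t"
  by (simp add: chi_weight_def)

lemma borel_measurable_chi_weight [measurable]: "chi_weight p \<in> borel_measurable borel"
  unfolding chi_weight_def[abs_def] by measurable

text \<open>From \<open>0 \<le> (t - 1) ^ 2\<close> the Gaussian factor is at most
  \<open>exp (1/2) / exp t\<close>, which leaves a Gamma integrand; the integral is positive because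
  the weight is positive on \<open>{0<..<1}\<close>.\<close>

lemma nn_integral_chi_weight:
  assumes "p > 0"
  shows "(\<integral>\<^sup>+t. ennreal (chi_weight p t) \<partial>lborel) = ennreal (chi_const p)" and "0 < chi_const p"
proof -
  let ?I = "\<integral>\<^sup>+t. ennreal (chi_weight p t) \<partial>lborel"
  have "?I \<le> (\<integral>\<^sup>+t. ennreal (exp (1/2)) * ennreal (indicator {0..} t * t powr (p - 1) / exp t) \<partial>lborel)"
  proof (rule nn_integral_mono)
    fix t :: real
    have "0 \<le> (t - 1)\<^sup>2" by simp
    then have "- t\<^sup>2 / 2 \<le> 1/2 - t" by (simp add: power2_eq_square algebra_simps)
    then have "exp (- t\<^sup>2 / 2) \<le> exp (1/2) / exp t" by (simp add: exp_diff[symmetric])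
    then have "chi_weight p t \<le> exp (1/2) * (indicator {0..} t * t powr (p - 1) / exp t)"
      using mult_left_mono[of "exp (- t\<^sup>2 / 2)" "exp (1/2) / exp t" "t powr (p - 1)"]
      by (auto simp: chi_weight_def indicator_def mult.commute)
    then show "ennreal (chi_weight p t) \<le> ennreal (exp (1/2)) * ennreal (indicator {0..} t * t powr (p - 1) / exp t)"
      by (subst ennreal_mult[symmetric]) (auto intro!: ennreal_leI divide_nonneg_nonneg)
  qed
  also have "\<dots> = ennreal (exp (1/2)) * ennreal (Gamma p)"
    using assms by (subst nn_integral_cmult) (auto simp: Gamma_conv_nn_integral_real)
  also have "\<dots> < \<top>" by (simp add: ennreal_mult_less_top)
  finally have fin: "?I < \<top>" .
  then show eq: "?I = ennreal (chi_const p)" by (simp add: chi_const_def)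
  have "?I \<noteq> 0"
  proof
    assume "?I = 0"
    then have "AE t in lborel. ennreal (chi_weight p t) = 0"
      by (subst (asm) nn_integral_0_iff_AE) auto
    then have "AE t in lborel. t \<notin> {0<..<1::real}"
      by eventually_elim (auto simp: chi_weight_def ennreal_eq_0_iff indicator_def mult_le_0_iff)
    then have "emeasure lborel {t \<in> space lborel. t \<in> {0<..<1::real}} = 0"
      by (rule emeasure_eq_0_AE)
    moreover have "{t \<in> space lborel. t \<in> {0<..<1::real}} = {0<..<1}" by (simp add: set_eq_iff)
    ultimately show False by (simp only: emeasure_lborel_Ioo zero_le_one) simp
  qed
  then show "0 < chi_const p" using eq by (metis chi_const_def enn2real_nonneg ennreal_0 less_eq_real_def)
qed

lemma sets_chi [measurable_cong, simp]: "sets (chi p) = sets borel"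
  by (simp add: chi_def)

lemma space_chi [simp]: "space (chi p) = UNIV"
  by (simp add: chi_def)

lemma chi_density_factor: "p > 0 \<Longrightarrow> ennreal (chi_weight p t / chi_const p) = ennreal (1 / chi_const p) * ennreal (chi_weight p t)"
  using nn_integral_chi_weight(2)[of p] by (subst ennreal_mult[symmetric]) auto

lemma prob_space_chi: "p > 0 \<Longrightarrow> prob_space (chi p)"
proof
  assume p: "p > 0"
  have "emeasure (chi p) (space (chi p)) = (\<integral>\<^sup>+t. ennreal (1 / chi_const p) * ennreal (chi_weight p t) \<partial>lborel)"
    by (simp add: chi_def emeasure_density chi_density_factor[OF p])
  also have "\<dots> = ennreal (1 / chi_const p) * ennreal (chi_const p)"
    by (subst nn_integral_cmult) (auto simp: nn_integral_chi_weight(1)[OF p])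
  also have "\<dots> = 1"
    using nn_integral_chi_weight(2)[OF p] by (subst ennreal_mult[symmetric]) auto
  finally show "emeasure (chi p) (space (chi p)) = 1" .
qed

lemma AE_chi_pos: "AE t in chi p. 0 < t"
  unfolding chi_def by (subst AE_density) (auto simp: chi_weight_def indicator_def intro!: AE_I2)

text \<open>The inner integral of the density of \<open>N / R\<close> at x. The substitution
  \<open>r = s / q\<close> with \<open>q ^ 2 = 1 + x ^ 2\<close> merges the two Gaussian factors,
  and the additional factor r raises the degrees of freedom by 1.\<close>

lemma nn_integral_chi_weight_scaled:
  fixes x :: real
  assumes p: "p > 0"
  shows "(\<integral>\<^sup>+r. ennreal (chi_weight p r * r * exp (- (r * x)\<^sup>2 / 2)) \<partial>lborel)
    = ennreal (chi_const (p + 1) * (1 + x\<^sup>2) powr (- (p + 1) / 2))"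
proof -
  define q where "q = sqrt (1 + x\<^sup>2)"
  have q1: "0 < 1 + x\<^sup>2" by (simp add: add_pos_nonneg)
  then have q: "0 < q" "q\<^sup>2 = 1 + x\<^sup>2" by (simp_all add: q_def)
  have qp: "q powr - (p + 1) = (1 + x\<^sup>2) powr (- (p + 1) / 2)"
    using q1 by (simp add: q_def powr_half_sqrt[symmetric] powr_powr)
  have "(\<integral>\<^sup>+r. ennreal (chi_weight p r * r * exp (- (r * x)\<^sup>2 / 2)) \<partial>lborel)
      = ennreal \<bar>1 / q\<bar> * (\<integral>\<^sup>+s. ennreal (chi_weight p (0 + 1 / q * s) * (0 + 1 / q * s) * exp (- ((0 + 1 / q * s) * x)\<^sup>2 / 2)) \<partial>lborel)"
    by (rule nn_integral_real_affine) (use q in auto)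
  also have "(\<integral>\<^sup>+s. ennreal (chi_weight p (0 + 1 / q * s) * (0 + 1 / q * s) * exp (- ((0 + 1 / q * s) * x)\<^sup>2 / 2)) \<partial>lborel)
      = (\<integral>\<^sup>+s. ennreal (q powr - p) * ennreal (chi_weight (p + 1) s) \<partial>lborel)"
  proof (rule nn_integral_cong)
    fix s :: real
    have "chi_weight p (1 / q * s) * (1 / q * s) * exp (- ((1 / q * s) * x)\<^sup>2 / 2) = q powr - p * chi_weight (p + 1) s"
    proof (cases "s > 0")
      case True
      have e: "exp (- (1 / q * s)\<^sup>2 / 2) * exp (- ((1 / q * s) * x)\<^sup>2 / 2) = exp (- s\<^sup>2 / 2)"
      proof -
        have "(1 / q * s)\<^sup>2 + ((1 / q * s) * x)\<^sup>2 = s\<^sup>2 * (1 + x\<^sup>2) / q\<^sup>2"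
          by (simp add: power_mult_distrib power_divide distrib_left add_divide_distrib)
        also have "\<dots> = s\<^sup>2" using q q1 by simp
        finally have "- (1 / q * s)\<^sup>2 / 2 + - ((1 / q * s) * x)\<^sup>2 / 2 = - s\<^sup>2 / 2" by linarith
        then show ?thesis by (simp only: exp_add[symmetric])
      qed
      have w: "(1 / q * s) powr (p - 1) * (1 / q * s) = q powr - p * s powr p"
      proof -
        have "(1 / q * s) powr (p - 1) * (1 / q * s) = (1 / q * s) powr p"
          using q True powr_mult_base[of "1 / q * s" "p - 1"] by (simp add: mult.commute)
        also have "\<dots> = (1 / q) powr p * s powr p" by (rule powr_mult)
        finally show ?thesis using q by (simp add: powr_divide powr_minus_divide)
      qed
      have "chi_weight p (1 / q * s) * (1 / q * s) * exp (- ((1 / q * s) * x)\<^sup>2 / 2)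
        = ((1 / q * s) powr (p - 1) * (1 / q * s)) * (exp (- (1 / q * s)\<^sup>2 / 2) * exp (- ((1 / q * s) * x)\<^sup>2 / 2))"
        using q True by (simp add: chi_weight_def)
      then show ?thesis unfolding w e using True by (simp add: chi_weight_def)
    next
      case False
      then show ?thesis using q by (simp add: chi_weight_def indicator_def zero_less_mult_iff zero_less_divide_iff)
    qed
    then show "ennreal (chi_weight p (0 + 1 / q * s) * (0 + 1 / q * s) * exp (- ((0 + 1 / q * s) * x)\<^sup>2 / 2))
        = ennreal (q powr - p) * ennreal (chi_weight (p + 1) s)"
      by (simp add: ennreal_mult)
  qed
  also have "\<dots> = ennreal (q powr - p) * ennreal (chi_const (p + 1))"
    using p by (subst nn_integral_cmult) (auto simp: nn_integral_chi_weight)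
  also have "ennreal \<bar>1 / q\<bar> * \<dots> = ennreal (chi_const (p + 1) * q powr - (p + 1))"
  proof -
    have "\<bar>1 / q\<bar> * (q powr - p * chi_const (p + 1)) = chi_const (p + 1) * q powr - (p + 1)"
    proof -
      have "q powr - (p + 1) = q powr - p * (1 / q)"
        using powr_add[of q "- p" "- 1"] q by (simp add: powr_neg_one)
      then show ?thesis using q by simp
    qed
    then show ?thesis
      using nn_integral_chi_weight(2)[of "p + 1"] p by (simp add: ennreal_mult[symmetric])
  qed
  finally show ?thesis unfolding qp .
qed

text \<open>Up to scaling, Student's distribution with \<open>p\<close> degrees of freedom: the law of \<open>N / R\<close> for
  independent \<open>N\<close> standard normal and \<open>R\<close> of law \<open>chi p\<close>.\<close>

definition student_const :: "real \<Rightarrow> real" where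
  "student_const p = chi_const (p + 1) / (sqrt (2 * pi) * chi_const p)"

definition student :: "real \<Rightarrow> real measure" where
  "student p = density lborel (\<lambda>x. ennreal (student_const p * (1 + x\<^sup>2) powr (- (p + 1) / 2)))"

lemma student_const_pos: "p > 0 \<Longrightarrow> 0 < student_const p"
  using nn_integral_chi_weight(2)[of p] nn_integral_chi_weight(2)[of "p + 1"]
  by (simp add: student_const_def)

text \<open>For fixed r the substitution \<open>n = r * x\<close> brings in the Jacobian r; after
  exchanging the integrals the one over r is \<open>nn_integral_chi_weight_scaled\<close>.\<close>

lemma distr_gauss_chi_ratio:
  assumes p: "p > 0"
  shows "distr (gauss \<Otimes>\<^sub>M chi p) borel (\<lambda>(n, r). n / r) = student p"
proof (rule measure_eqI)
  let ?R = "distr (gauss \<Otimes>\<^sub>M chi p) borel (\<lambda>(n, r). n / r)"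
  let ?c = "ennreal (1 / (sqrt (2 * pi) * chi_const p))"
  let ?w = "\<lambda>r x. ennreal (chi_weight p r * r * exp (- (r * x)\<^sup>2 / 2))"
  interpret G: prob_space "gauss :: real measure" by (rule prob_space_gauss)
  interpret C: prob_space "chi p" by (rule prob_space_chi[OF p])
  interpret GC: pair_sigma_finite "gauss :: real measure" "chi p" ..
  have Z: "0 < chi_const p" by (rule nn_integral_chi_weight(2)[OF p])
  fix A assume "A \<in> sets (?R)"
  then have A[measurable]: "A \<in> sets borel" by simp
  have m[measurable]: "(\<lambda>(n, r). n / r) \<in> (gauss \<Otimes>\<^sub>M chi p) \<rightarrow>\<^sub>M (borel :: real measure)"
    by measurable
  have "emeasure (?R) A
    = (\<integral>\<^sup>+z. indicator A z \<partial>?R)"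
    by simp
  also have "\<dots> = (\<integral>\<^sup>+z. indicator A (case z of (n, r) \<Rightarrow> n / r) \<partial>(gauss \<Otimes>\<^sub>M chi p))"
    by (rule nn_integral_distr) auto
  also have "\<dots> = (\<integral>\<^sup>+r. (\<integral>\<^sup>+n. indicator A (n / r) \<partial>gauss) \<partial>chi p)"
    by (subst GC.nn_integral_snd[symmetric]) auto
  also have "\<dots> = (\<integral>\<^sup>+r. ennreal (chi_weight p r / chi_const p) * (\<integral>\<^sup>+n. ennreal (std_normal_density n) * indicator A (n / r) \<partial>lborel) \<partial>lborel)"
    unfolding chi_def gauss_real
    by (subst nn_integral_density) (auto simp: nn_integral_density)
  also have "\<dots> = (\<integral>\<^sup>+r. (\<integral>\<^sup>+x. ?c * (?w r x * indicator A x) \<partial>lborel) \<partial>lborel)"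
  proof (rule nn_integral_cong)
    fix r :: real
    show "ennreal (chi_weight p r / chi_const p) * (\<integral>\<^sup>+n. ennreal (std_normal_density n) * indicator A (n / r) \<partial>lborel)
      = (\<integral>\<^sup>+x. ?c * (?w r x * indicator A x) \<partial>lborel)"
    proof (cases "r > 0")
      case True
      have "(\<integral>\<^sup>+n. ennreal (std_normal_density n) * indicator A (n / r) \<partial>lborel)
        = ennreal \<bar>r\<bar> * (\<integral>\<^sup>+x. ennreal (std_normal_density (0 + r * x)) * indicator A ((0 + r * x) / r) \<partial>lborel)"
        by (rule nn_integral_real_affine) (use True in auto)
      also have "\<dots> = (\<integral>\<^sup>+x. ennreal r * (ennreal (std_normal_density (r * x)) * indicator A x) \<partial>lborel)"
        using True by (subst nn_integral_cmult[symmetric]) auto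
      finally have "ennreal (chi_weight p r / chi_const p) * (\<integral>\<^sup>+n. ennreal (std_normal_density n) * indicator A (n / r) \<partial>lborel)
        = (\<integral>\<^sup>+x. ennreal (chi_weight p r / chi_const p) * (ennreal r * (ennreal (std_normal_density (r * x)) * indicator A x)) \<partial>lborel)"
        by (simp add: nn_integral_cmult)
      also have "\<dots> = (\<integral>\<^sup>+x. ?c * (?w r x * indicator A x) \<partial>lborel)"
      proof (rule nn_integral_cong)
        fix x
        have "ennreal (chi_weight p r / chi_const p) * (ennreal r * ennreal (std_normal_density (r * x)))
          = ?c * ?w r x"
          using True Z by (simp add: ennreal_mult[symmetric] std_normal_density_def ac_simps)
        then show "ennreal (chi_weight p r / chi_const p) * (ennreal r * (ennreal (std_normal_density (r * x)) * indicator A x))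
          = ?c * (?w r x * indicator A x)"
          by (metis mult.assoc)
      qed
      finally show ?thesis .
    qed (simp add: chi_weight_def)
  qed
  also have "\<dots> = (\<integral>\<^sup>+x. (\<integral>\<^sup>+r. ?c * (?w r x * indicator A x) \<partial>lborel) \<partial>lborel)"
    by (rule lborel_pair.Fubini') measurable
  also have "\<dots> = (\<integral>\<^sup>+x. ennreal (student_const p * (1 + x\<^sup>2) powr (- (p + 1) / 2)) * indicator A x \<partial>lborel)"
  proof (rule nn_integral_cong)
    fix x :: real
    have "(\<integral>\<^sup>+r. ?c * (?w r x * indicator A x) \<partial>lborel)
      = ?c * (\<integral>\<^sup>+r. ?w r x \<partial>lborel) * indicator A x"
      by (simp add: nn_integral_cmult nn_integral_multc mult.assoc)
    also have "\<dots> = ennreal (student_const p * (1 + x\<^sup>2) powr (- (p + 1) / 2)) * indicator A x"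
      unfolding nn_integral_chi_weight_scaled[OF p]
      using Z nn_integral_chi_weight(2)[of "p + 1"] p
      by (subst ennreal_mult[symmetric]) (auto simp: student_const_def)
    finally show "(\<integral>\<^sup>+r. ?c * (?w r x * indicator A x) \<partial>lborel)
      = ennreal (student_const p * (1 + x\<^sup>2) powr (- (p + 1) / 2)) * indicator A x" .
  qed
  also have "\<dots> = emeasure (student p) A"
    unfolding student_def by (rule emeasure_density[symmetric]) auto
  finally show "emeasure (?R) A = emeasure (student p) A" .
qed (simp add: student_def)

lemma prob_space_student: "p > 0 \<Longrightarrow> prob_space (student p)"
proof -
  assume p: "p > 0"
  interpret G: prob_space "gauss :: real measure" by (rule prob_space_gauss)
  interpret C: prob_space "chi p" by (rule prob_space_chi[OF p])
  interpret P: pair_prob_space "gauss :: real measure" "chi p" ..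
  show ?thesis
    unfolding distr_gauss_chi_ratio[OF p, symmetric] by (rule P.prob_space_distr) measurable
qed

section \<open>Norms of vectors with independent chi coordinates\<close>

lemma nn_integral_powr_Ioc:
  fixes r :: real
  assumes "D > 0" "0 \<le> r"
  shows "(\<integral>\<^sup>+s. ennreal (D * s powr (D - 1) * indicator {0<..} s) * indicator {..r} s \<partial>lborel) = ennreal (r powr D)"
proof -
  have "((\<lambda>s. D * s powr (D - 1)) has_integral D * (r powr (D - 1 + 1) / (D - 1 + 1))) {0..r}"
    using assms by (intro has_integral_mult_right has_integral_powr_from_0) auto
  then have "((\<lambda>s. D * s powr (D - 1)) has_integral r powr D) {0..r}"
    using assms by simp
  then have "integral\<^sup>N lborel (\<lambda>s. ennreal (indicator {0..r} s * (D * s powr (D - 1)))) = ennreal (r powr D)"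
    by (intro nn_integral_has_integral_lebesgue) (use assms in auto)
  moreover have "ennreal (D * s powr (D - 1) * indicator {0<..} s) * indicator {..r} s =
      ennreal (indicator {0..r} s * (D * s powr (D - 1)))" for s
    using assms by (cases "s = 0") (auto simp: indicator_def)
  ultimately show ?thesis by simp
qed

text \<open>The law of the norm is determined by the masses of balls. It is applied to a density
  made of powers of the coordinates, and to Lebesgue measure, where it replaces polar
  coordinates.\<close>

lemma distr_norm_homogeneous:
  fixes \<kappa> :: "'a::euclidean_space measure"
  assumes [measurable_cong]: "sets \<kappa> = sets borel" and D: "D > 0" and K: "K < \<infinity>"
    and hom: "\<And>r. 0 \<le> r \<Longrightarrow> emeasure \<kappa> (cball 0 r) = ennreal (r powr D) * K"
  shows "distr \<kappa> borel norm = density lborel (\<lambda>s. K * ennreal (D * s powr (D - 1) * indicator {0<..} s))"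
    (is "_ = ?R")
proof (rule measure_eqI_generator_eq[where E="range atMost" and \<Omega>=UNIV and A="\<lambda>n. {..real n}"])
  let ?d = "\<lambda>s. ennreal (D * s powr (D - 1) * indicator {0<..} s)"
  have space: "space \<kappa> = UNIV" using sets_eq_imp_space_eq[OF assms(1)] by simp
  have L: "emeasure (distr \<kappa> borel norm) {..r} = (if 0 \<le> r then ennreal (r powr D) * K else 0)" for r
  proof -
    have "emeasure (distr \<kappa> borel norm) {..r} = emeasure \<kappa> (norm -` {..r} \<inter> space \<kappa>)"
      by (rule emeasure_distr) auto
    also have "norm -` {..r} \<inter> space \<kappa> = cball 0 r" by (auto simp: space)
    finally show ?thesis using hom[of r] by simp
  qed
  have R: "emeasure ?R {..r} = (if 0 \<le> r then ennreal (r powr D) * K else 0)" for r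
  proof -
    have "emeasure ?R {..r} = (\<integral>\<^sup>+s. K * (?d s * indicator {..r} s) \<partial>lborel)"
      by (subst emeasure_density) (auto simp: mult.assoc)
    also have "\<dots> = K * (\<integral>\<^sup>+s. ?d s * indicator {..r} s \<partial>lborel)"
      by (rule nn_integral_cmult) auto
    also have "\<dots> = (if 0 \<le> r then ennreal (r powr D) * K else 0)"
    proof (cases "0 \<le> r")
      case True
      then show ?thesis unfolding nn_integral_powr_Ioc[OF D True] by (simp add: mult.commute)
    next
      case False
      then have "(\<integral>\<^sup>+s. ?d s * indicator {..r} s \<partial>lborel) = (\<integral>\<^sup>+s. 0 \<partial>(lborel :: real measure))"
        by (intro nn_integral_cong) (auto simp: indicator_def)
      then show ?thesis using False by simp
    qed
    finally show ?thesis .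
  qed
  fix X :: "real set" assume "X \<in> range atMost"
  then show "emeasure (distr \<kappa> borel norm) X = emeasure ?R X" using L R by auto
next
  fix i :: nat
  have "norm -` {..real i} \<inter> space \<kappa> = cball 0 (real i)"
    using sets_eq_imp_space_eq[OF assms(1)] by auto
  then show "emeasure (distr \<kappa> borel norm) {..real i} \<noteq> \<infinity>"
    using K hom[of "real i"] by (subst emeasure_distr) (auto simp: ennreal_mult_eq_top_iff)
next
  show "sets (distr \<kappa> borel norm) = sigma_sets UNIV (range atMost)"
    by (simp add: borel_eq_atMost)
  show "sets ?R = sigma_sets UNIV (range atMost)"
    by (simp add: borel_eq_atMost)
  show "(\<Union>i. {..real i}) = UNIV"
    using real_arch_simple by auto
qed (auto simp: Int_stable_def)

lemma nn_integral_lborel_scaleR: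
  fixes f :: "'a::euclidean_space \<Rightarrow> ennreal"
  assumes [measurable]: "f \<in> borel_measurable borel" and c: "c > 0"
  shows "(\<integral>\<^sup>+x. f x \<partial>lborel) = ennreal (c ^ DIM('a)) * (\<integral>\<^sup>+x. f (c *\<^sub>R x) \<partial>lborel)"
  using c by (subst lborel_affine[of c 0])
    (auto simp: nn_integral_density nn_integral_distr nn_integral_cmult)

text \<open>The joint density is homogeneous up to a radial Gaussian factor. The homogeneous part
  has degree \<open>CARD('n) * (p - 1)\<close>, so the masses of its balls grow like
  \<open>r powr (CARD('n) * p)\<close>; the radial factor then produces a chi density up to a
  constant, which normalisation fixes.\<close>

lemma distr_norm_PiM_chi:
  assumes p: "p > 0"
  shows "distr (PiM UNIV (\<lambda>_::'n::finite. chi p)) borel (\<lambda>f. norm (\<chi> i. f i)) = chi (real CARD('n) * p)"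
proof -
  define n where "n = CARD('n)"
  have n: "n > 0" by (simp add: n_def)
  define D where "D = real n * p"
  have D: "D > 0" using n p by (simp add: D_def)
  have Z: "0 < chi_const p" by (rule nn_integral_chi_weight(2)[OF p])
  define k :: "real^'n \<Rightarrow> real" where "k x = (\<Prod>i\<in>UNIV. indicator {0<..} (x $ i) * (x $ i) powr (p - 1))" for x
  have k0: "0 \<le> k x" for x by (auto simp: k_def intro!: prod_nonneg)
  have cb[measurable]: "cball (0 :: real^'n) s \<in> sets borel" for s by simp
  have [measurable]: "k \<in> borel_measurable borel" unfolding k_def[abs_def] by measurable
  define \<kappa> where "\<kappa> = density lborel (\<lambda>x. ennreal (k x))"
  have sets_\<kappa>[measurable_cong, simp]: "sets \<kappa> = sets borel" by (simp add: \<kappa>_def)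
  define c where "c = (1 / chi_const p) ^ n"
  have c: "c > 0" using Z by (simp add: c_def)
  have dens: "(\<Prod>i\<in>UNIV. ennreal (chi_weight p (x $ i) / chi_const p)) = ennreal (k x) * ennreal (c * exp (- (norm x)\<^sup>2 / 2))" for x :: "real^'n"
  proof -
    have "(\<Prod>i\<in>UNIV. chi_weight p (x $ i) / chi_const p) =
      k x * (\<Prod>i\<in>(UNIV :: 'n set). 1 / chi_const p) * (\<Prod>i\<in>UNIV. exp (- (x $ i)\<^sup>2 / 2))"
      unfolding chi_weight_def k_def prod.distrib[symmetric] by (intro prod.cong) auto
    also have "(\<Prod>i\<in>UNIV. exp (- (x $ i)\<^sup>2 / 2)) = exp (- (norm x)\<^sup>2 / 2)"
      by (simp add: exp_sum[symmetric] norm_vec_def L2_set_def sum_nonneg sum_negf sum_divide_distrib)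
    finally show ?thesis
      using Z k0 c by (simp add: prod_ennreal ennreal_mult[symmetric] c_def n_def)
  qed
  let ?G = "\<lambda>x::real^'n. ennreal (c * exp (- (norm x)\<^sup>2 / 2))"
  have law: "distr (PiM UNIV (\<lambda>_::'n. chi p)) borel (\<lambda>f. \<chi> i. f i) = density \<kappa> ?G"
  proof -
    have "distr (PiM UNIV (\<lambda>_::'n. chi p)) borel (\<lambda>f. \<chi> i. f i) =
        density lborel (\<lambda>x. \<Prod>i\<in>UNIV. ennreal (chi_weight p (x $ i) / chi_const p))"
      unfolding chi_def by (rule PiM_density_vec) (use prob_space_chi[OF p] in \<open>auto simp: chi_def\<close>)
    then show ?thesis unfolding dens \<kappa>_def by (simp add: density_density_eq)
  qed
  interpret Pi: prob_space "PiM UNIV (\<lambda>_::'n. chi p)"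
    by (intro prob_space_PiM prob_space_chi p)
  interpret V: prob_space "density \<kappa> ?G"
    unfolding law[symmetric] by (rule Pi.prob_space_distr) measurable
  define K where "K = emeasure \<kappa> (cball 0 1)"
  \<comment> \<open>On the unit ball the Gaussian factor is at least \<open>exp (-1/2)\<close>, so
    \<open>K\<close> is controlled by the total mass 1.\<close>
  have K: "K < \<infinity>"
  proof -
    have "ennreal (c * exp (-1/2)) * K = (\<integral>\<^sup>+x. ennreal (c * exp (-1/2)) * indicator (cball 0 1) x \<partial>\<kappa>)"
      unfolding K_def by (rule nn_integral_cmult_indicator[symmetric]) simp
    also have "\<dots> \<le> (\<integral>\<^sup>+x. ?G x \<partial>\<kappa>)"
    proof (rule nn_integral_mono)
      fix x :: "real^'n"
      show "ennreal (c * exp (-1/2)) * indicator (cball 0 1) x \<le> ?G x"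
        using c by (auto simp: indicator_def abs_square_le_1 intro!: ennreal_leI)
    qed
    also have "\<dots> = 1"
      using V.emeasure_space_1 by (simp add: emeasure_density \<kappa>_def)
    finally have "ennreal (c * exp (-1/2)) * K < \<top>" by (rule le_less_trans) simp
    then show ?thesis using c by (auto simp: ennreal_mult_less_top)
  qed
  have hom: "emeasure \<kappa> (cball 0 r) = ennreal (r powr D) * K" if "0 \<le> r" for r
  proof (cases "r = 0")
    case True
    have "emeasure \<kappa> {0} = (\<integral>\<^sup>+x. ennreal (k x) * indicator {0} x \<partial>lborel)"
      unfolding \<kappa>_def by (rule emeasure_density) auto
    also have "\<dots> = 0"
      by (subst nn_integral_0_iff_AE) (use AE_lborel_singleton[of "0::real^'n"] in \<open>auto simp: indicator_def\<close>)
    finally show ?thesis using True by simp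
  next
    case False
    then have r: "r > 0" using that by simp
    have "emeasure \<kappa> (cball 0 r) = (\<integral>\<^sup>+x. ennreal (k x) * indicator (cball 0 r) x \<partial>lborel)"
      unfolding \<kappa>_def by (rule emeasure_density) auto
    also have "\<dots> = ennreal (r ^ DIM(real^'n)) * (\<integral>\<^sup>+x. ennreal (k (r *\<^sub>R x)) * indicator (cball 0 r) (r *\<^sub>R x) \<partial>lborel)"
      by (rule nn_integral_lborel_scaleR[OF _ r]) measurable
    also have "(\<integral>\<^sup>+x. ennreal (k (r *\<^sub>R x)) * indicator (cball 0 r) (r *\<^sub>R x) \<partial>lborel)
      = (\<integral>\<^sup>+x. ennreal ((r powr (p - 1)) ^ n) * (ennreal (k x) * indicator (cball 0 1) x) \<partial>lborel)"
    proof (rule nn_integral_cong)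
      fix x :: "real^'n"
      have "k (r *\<^sub>R x) = (\<Prod>i\<in>(UNIV :: 'n set). r powr (p - 1) * (indicator {0<..} (x $ i) * (x $ i) powr (p - 1)))"
        unfolding k_def using r
        by (intro prod.cong) (auto simp: indicator_def powr_mult zero_less_mult_iff)
      also have "\<dots> = (r powr (p - 1)) ^ n * k x"
        by (simp add: k_def prod.distrib n_def)
      finally have "k (r *\<^sub>R x) = (r powr (p - 1)) ^ n * k x" .
      moreover have "indicator (cball 0 r) (r *\<^sub>R x) = (indicator (cball 0 1) x :: ennreal)"
        using r by (auto simp: indicator_def)
      ultimately show "ennreal (k (r *\<^sub>R x)) * indicator (cball 0 r) (r *\<^sub>R x) =
          ennreal ((r powr (p - 1)) ^ n) * (ennreal (k x) * indicator (cball 0 1) x)"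
        using k0 by (simp add: ennreal_mult mult.assoc)
    qed
    also have "\<dots> = ennreal ((r powr (p - 1)) ^ n) * K"
      unfolding K_def \<kappa>_def by (subst nn_integral_cmult) (auto simp: emeasure_density)
    also have "ennreal (r ^ DIM(real^'n)) * \<dots> = ennreal (r powr D) * K"
    proof -
      have "r ^ DIM(real^'n) * (r powr (p - 1)) ^ n = (r * r powr (p - 1)) ^ n"
        by (simp add: n_def power_mult_distrib)
      also have "r * r powr (p - 1) = r powr p" using r powr_mult_base[of r "p - 1"] by simp
      also have "(r powr p) ^ n = r powr D" using r by (simp add: powr_realpow[symmetric] powr_powr D_def mult.commute)
      finally show ?thesis using r by (simp add: mult.assoc[symmetric] ennreal_mult[symmetric])
    qed
    finally show ?thesis .
  qed
  let ?w = "\<lambda>s. ennreal (chi_weight D s)"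
  have "distr (PiM UNIV (\<lambda>_::'n. chi p)) borel (\<lambda>f. norm (\<chi> i. f i)) =
      distr (distr (PiM UNIV (\<lambda>_::'n. chi p)) borel (\<lambda>f. \<chi> i. f i)) borel norm"
    by (subst distr_distr) (auto simp: comp_def)
  also have "\<dots> = distr (density \<kappa> ?G) borel norm" unfolding law ..
  also have "\<dots> = density (distr \<kappa> borel norm) (\<lambda>s. ennreal (c * exp (- s\<^sup>2 / 2)))"
    by (rule density_distr[symmetric]) auto
  also have "distr \<kappa> borel norm = density lborel (\<lambda>s. K * ennreal (D * s powr (D - 1) * indicator {0<..} s))"
    by (rule distr_norm_homogeneous) (use D K hom in auto)
  also have "density \<dots> (\<lambda>s. ennreal (c * exp (- s\<^sup>2 / 2))) =
      density lborel (\<lambda>s. K * ennreal (D * s powr (D - 1) * indicator {0<..} s) * ennreal (c * exp (- s\<^sup>2 / 2)))"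
    by (rule density_density_eq) auto
  also have "\<dots> = density lborel (\<lambda>s. (K * ennreal (D * c)) * ?w s)"
  proof (rule arg_cong[where f="density lborel"], rule ext)
    fix s :: real
    have "ennreal (D * s powr (D - 1) * indicator {0<..} s) * ennreal (c * exp (- s\<^sup>2 / 2)) = ennreal (D * c) * ?w s"
      using D c by (simp add: ennreal_mult[symmetric] chi_weight_def)
    then show "K * ennreal (D * s powr (D - 1) * indicator {0<..} s) * ennreal (c * exp (- s\<^sup>2 / 2)) = (K * ennreal (D * c)) * ?w s"
      by (simp add: mult.assoc)
  qed
  finally have eq: "distr (PiM UNIV (\<lambda>_::'n. chi p)) borel (\<lambda>f. norm (\<chi> i. f i)) =
      density lborel (\<lambda>s. (K * ennreal (D * c)) * ?w s)" .
  have "prob_space (density lborel (\<lambda>s. (K * ennreal (D * c)) * ?w s))"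
    unfolding eq[symmetric] by (rule Pi.prob_space_distr) measurable
  moreover have chi: "chi D = density lborel (\<lambda>s. ennreal (1 / chi_const D) * ?w s)"
    unfolding chi_def chi_density_factor[OF D] ..
  ultimately show ?thesis
    unfolding eq n_def[symmetric] D_def[symmetric] chi
    by (intro prob_space_density_unique) (use prob_space_chi[OF D] in \<open>simp_all add: chi\<close>)
qed

section \<open>Normals of Gaussian hyperplanes\<close>

text \<open>A model of one random point, with independent horizontal part and height; only its
  direction will matter.\<close>

definition height_law :: "real \<Rightarrow> ((real^'n) \<times> real) measure" where
  "height_law p = gauss \<Otimes>\<^sub>M chi p"

lemma sets_height_law [measurable_cong, simp]: "sets (height_law p) = sets borel"
  unfolding height_law_def borel_prod[symmetric] by (rule sets_pair_measure_cong) auto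

lemma space_height_law [simp]: "space (height_law p) = UNIV"
  by (simp add: height_law_def space_pair_measure)

lemma prob_space_height_law: "p > 0 \<Longrightarrow> prob_space (height_law p :: ((real^'n) \<times> real) measure)"
proof -
  assume p: "p > 0"
  interpret G: prob_space "gauss :: (real^'n) measure" by (rule prob_space_gauss)
  interpret C: prob_space "chi p" by (rule prob_space_chi[OF p])
  interpret P: pair_prob_space "gauss :: (real^'n) measure" "chi p" ..
  show ?thesis unfolding height_law_def by (rule P.prob_space_axioms)
qed

text \<open>Regroups the points into all horizontal parts and all heights, which makes the matrix of
  the linear system independent of its right-hand side.\<close>

lemma PiM_pair_eq_distr:
  assumes "prob_space A" "prob_space B" and I: "finite I"
  shows "PiM I (\<lambda>_. A \<Otimes>\<^sub>M B) = distr (PiM I (\<lambda>_. A) \<Otimes>\<^sub>M PiM I (\<lambda>_. B)) (PiM I (\<lambda>_. A \<Otimes>\<^sub>M B))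
    (\<lambda>(x, y). \<lambda>i\<in>I. (x i, y i))"
proof -
  interpret A: prob_space A by fact
  interpret B: prob_space B by fact
  interpret AB: pair_prob_space A B ..
  interpret PA: product_sigma_finite "\<lambda>_. A" ..
  interpret PB: product_sigma_finite "\<lambda>_. B" ..
  interpret PAB: product_sigma_finite "\<lambda>_. A \<Otimes>\<^sub>M B" ..
  interpret IA: prob_space "PiM I (\<lambda>_. A)" by (intro prob_space_PiM assms(1))
  interpret IB: prob_space "PiM I (\<lambda>_. B)" by (intro prob_space_PiM assms(2))
  interpret IAB: pair_sigma_finite "PiM I (\<lambda>_. A)" "PiM I (\<lambda>_. B)" ..
  let ?f = "\<lambda>(x, y). \<lambda>i\<in>I. (x i, y i)"
  have f[measurable]: "?f \<in> (PiM I (\<lambda>_. A) \<Otimes>\<^sub>M PiM I (\<lambda>_. B)) \<rightarrow>\<^sub>M PiM I (\<lambda>_. A \<Otimes>\<^sub>M B)"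
    by measurable
  show ?thesis
  proof (rule PAB.PiM_eqI[OF I, symmetric])
    fix E assume "\<And>i. i \<in> I \<Longrightarrow> E i \<in> sets (A \<Otimes>\<^sub>M B)"
    then have E[measurable]: "\<And>i. i \<in> I \<Longrightarrow> E i \<in> sets (A \<Otimes>\<^sub>M B)" .
    let ?R = "distr (PiM I (\<lambda>_. A) \<Otimes>\<^sub>M PiM I (\<lambda>_. B)) (PiM I (\<lambda>_. A \<Otimes>\<^sub>M B)) ?f"
    have PE[measurable]: "Pi\<^sub>E I E \<in> sets (PiM I (\<lambda>_. A \<Otimes>\<^sub>M B))"
      using E I by (intro sets_PiM_I_finite) auto
    have "emeasure ?R (Pi\<^sub>E I E) = (\<integral>\<^sup>+z. indicator (Pi\<^sub>E I E) z \<partial>?R)"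
      by (rule nn_integral_indicator[symmetric]) simp
    also have "\<dots> = (\<integral>\<^sup>+z. indicator (Pi\<^sub>E I E) (?f z) \<partial>(PiM I (\<lambda>_. A) \<Otimes>\<^sub>M PiM I (\<lambda>_. B)))"
      by (rule nn_integral_distr) auto
    also have "\<dots> = (\<integral>\<^sup>+y. (\<integral>\<^sup>+x. indicator (Pi\<^sub>E I E) (?f (x, y)) \<partial>PiM I (\<lambda>_. A)) \<partial>PiM I (\<lambda>_. B))"
      by (rule IAB.nn_integral_snd[symmetric]) measurable
    also have "\<dots> = (\<integral>\<^sup>+y. (\<Prod>i\<in>I. emeasure A {a \<in> space A. (a, y i) \<in> E i}) \<partial>PiM I (\<lambda>_. B))"
    proof (rule nn_integral_cong)
      fix y assume y: "y \<in> space (PiM I (\<lambda>_. B))"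
      have yi: "y i \<in> space B" if "i \<in> I" for i using y that by (auto simp: space_PiM)
      have S[measurable]: "{a \<in> space A. (a, y i) \<in> E i} \<in> sets A" if "i \<in> I" for i
        using measurable_Pair2'[OF yi[OF that], of A] E[OF that]
        by (auto dest!: measurable_sets simp: vimage_def Int_def conj_commute)
      have "(\<integral>\<^sup>+x. indicator (Pi\<^sub>E I E) (?f (x, y)) \<partial>PiM I (\<lambda>_. A)) =
          (\<integral>\<^sup>+x. (\<Prod>i\<in>I. indicator {a \<in> space A. (a, y i) \<in> E i} (x i)) \<partial>PiM I (\<lambda>_. A))"
      proof (rule nn_integral_cong)
        fix x assume "x \<in> space (PiM I (\<lambda>_. A))"
        then have xi: "x i \<in> space A" if "i \<in> I" for i using that by (auto simp: space_PiM)
        show "indicator (Pi\<^sub>E I E) (?f (x, y)) = (\<Prod>i\<in>I. indicator {a \<in> space A. (a, y i) \<in> E i} (x i) :: ennreal)"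
        proof (cases "\<forall>i\<in>I. (x i, y i) \<in> E i")
          case True
          then show ?thesis using xi by (simp add: indicator_def PiE_iff)
        next
          case False
          then obtain i where "i \<in> I" "(x i, y i) \<notin> E i" by blast
          then have "(\<Prod>i\<in>I. indicator {a \<in> space A. (a, y i) \<in> E i} (x i) :: ennreal) = 0"
            using I by (intro prod_zero bexI[of _ i]) auto
          moreover have "indicator (Pi\<^sub>E I E) (?f (x, y)) = (0 :: ennreal)"
            using False by (auto simp: indicator_def PiE_iff)
          ultimately show ?thesis by (simp only:)
        qed
      qed
      also have "\<dots> = (\<Prod>i\<in>I. \<integral>\<^sup>+a. indicator {a \<in> space A. (a, y i) \<in> E i} a \<partial>A)"
        by (rule PA.product_nn_integral_prod[OF I]) (use S in auto)
      also have "\<dots> = (\<Prod>i\<in>I. emeasure A {a \<in> space A. (a, y i) \<in> E i})"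
        using S by (intro prod.cong) auto
      finally show "(\<integral>\<^sup>+x. indicator (Pi\<^sub>E I E) (?f (x, y)) \<partial>PiM I (\<lambda>_. A)) =
          (\<Prod>i\<in>I. emeasure A {a \<in> space A. (a, y i) \<in> E i})" .
    qed
    also have "\<dots> = (\<Prod>i\<in>I. \<integral>\<^sup>+b. emeasure A {a \<in> space A. (a, b) \<in> E i} \<partial>B)"
    proof (rule PB.product_nn_integral_prod[OF I])
      fix i assume i: "i \<in> I"
      have "(\<lambda>b. emeasure A ((\<lambda>a. (a, b)) -` E i)) \<in> borel_measurable B"
        by (rule AB.measurable_emeasure_Pair2[OF E[OF i]])
      moreover have "(\<lambda>a. (a, b)) -` E i = {a \<in> space A. (a, b) \<in> E i}" for b
        using sets.sets_into_space[OF E[OF i]] by (auto simp: space_pair_measure)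
      ultimately show "(\<lambda>b. emeasure A {a \<in> space A. (a, b) \<in> E i}) \<in> borel_measurable B" by simp
    qed
    also have "\<dots> = (\<Prod>i\<in>I. emeasure (A \<Otimes>\<^sub>M B) (E i))"
    proof (rule prod.cong[OF refl])
      fix i assume i: "i \<in> I"
      have "(\<lambda>a. (a, b)) -` E i = {a \<in> space A. (a, b) \<in> E i}" for b
        using sets.sets_into_space[OF E[OF i]] by (auto simp: space_pair_measure)
      then show "(\<integral>\<^sup>+b. emeasure A {a \<in> space A. (a, b) \<in> E i} \<partial>B) = emeasure (A \<Otimes>\<^sub>M B) (E i)"
        using AB.emeasure_pair_measure_alt2[OF E[OF i]] by simp
    qed
    finally show "emeasure ?R (Pi\<^sub>E I E) = (\<Prod>i\<in>I. emeasure (A \<Otimes>\<^sub>M B) (E i))" .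
  qed simp
qed

lemma AE_gauss_det_nonzero: "AE G in gauss. det (G :: real^'n^'n) \<noteq> 0"
  unfolding gauss_def by (subst AE_density) (use AE_lborel_det_nonzero in \<open>auto elim: eventually_mono\<close>)

lemma solve_zero: "det A \<noteq> 0 \<Longrightarrow> solve A 0 = 0"
  using solve_iff[of A 0 0] by simp

text \<open>Left multiplication acts on each column by f and so preserves the Frobenius norm, which
  is the Euclidean norm of the matrix.\<close>

lemma distr_gauss_matrix_mult:
  fixes f :: "real^'n \<Rightarrow> real^'n"
  assumes f: "orthogonal_transformation f"
  shows "distr gauss borel (\<lambda>G::real^'n^'n. matrix f ** G) = gauss"
proof (rule distr_gauss_isometry)
  show "linear (\<lambda>G::real^'n^'n. matrix f ** G)"
    by (rule linearI) (simp_all add: matrix_add_ldistrib matrix_scalar_ac scalar_matrix_assoc)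
  have lin: "linear f" and norm: "\<And>x. norm (f x) = norm x"
    using f unfolding orthogonal_transformation by blast+
  fix G :: "real^'n^'n"
  have norm_col: "(norm (H :: real^'n^'n))\<^sup>2 = (\<Sum>j\<in>UNIV. (norm (column j H))\<^sup>2)" for H
    unfolding norm_vec_def L2_set_def column_def
    by (simp add: sum_nonneg) (rule sum.swap)
  have "column j (matrix f ** G) = f (column j G)" for j
    using fun_cong[OF matrix_vector_mul(2)[OF lin], of "column j G"]
    by (simp add: vec_eq_iff column_def matrix_matrix_mult_def matrix_vector_mult_def)
  then have "(norm (matrix f ** G))\<^sup>2 = (norm G)\<^sup>2"
    unfolding norm_col by (simp add: norm)
  then show "norm (matrix f ** G) = norm G" by simp
qed

text \<open>Given the rows other than \<open>k\<close>, the solution is a multiple of a unit vector \<open>\<nu>\<close> orthogonal to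
  them; the factor is \<open>t / (y \<bullet> \<nu>)\<close> for the \<open>k\<close>-th row \<open>y\<close>, whatever \<open>\<nu>\<close> is.\<close>

lemma nn_integral_solve_axis:
  fixes \<phi> :: "real \<Rightarrow> ennreal" and k :: "'n::finite"
  assumes [measurable]: "\<phi> \<in> borel_measurable borel" and t: "t > 0"
  shows "(\<integral>\<^sup>+G. \<phi> (norm (solve (G :: real^'n^'n) (axis k t))) \<partial>gauss) = (\<integral>\<^sup>+n. \<phi> (t / \<bar>n\<bar>) \<partial>gauss)"
proof -
  interpret G: prob_space "gauss :: (real^'n) measure" by (rule prob_space_gauss)
  interpret P: product_sigma_finite "\<lambda>_::'n. gauss :: (real^'n) measure" ..
  let ?J = "UNIV - {k}"
  interpret J: prob_space "PiM ?J (\<lambda>_. gauss :: (real^'n) measure)"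
    by (intro prob_space_PiM prob_space_gauss)
  have U: "insert k ?J = UNIV" by blast
  define row where "row x y = (\<chi> i. (x(k := y)) i)" for x :: "'n \<Rightarrow> real^'n" and y
  have split: "(\<integral>\<^sup>+G. h G \<partial>gauss) = (\<integral>\<^sup>+x. (\<integral>\<^sup>+y. h (row x y) \<partial>gauss) \<partial>PiM ?J (\<lambda>_. gauss))"
    if [measurable]: "h \<in> borel_measurable borel" for h :: "real^'n^'n \<Rightarrow> ennreal"
  proof -
    have [measurable]: "(\<lambda>f. \<chi> i. f i) \<in> (PiM UNIV (\<lambda>_::'n. gauss :: (real^'n) measure)) \<rightarrow>\<^sub>M borel"
      by measurable
    have "(\<integral>\<^sup>+G. h G \<partial>gauss) = (\<integral>\<^sup>+f. h (\<chi> i. f i) \<partial>PiM (insert k ?J) (\<lambda>_. gauss))"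
      unfolding U by (subst gauss_vec_eq_distr_PiM, subst nn_integral_distr) auto
    also have "\<dots> = (\<integral>\<^sup>+x. (\<integral>\<^sup>+y. h (\<chi> i. (x(k := y)) i) \<partial>gauss) \<partial>PiM ?J (\<lambda>_. gauss))"
      by (rule P.product_nn_integral_insert) (auto simp: U)
    finally show ?thesis unfolding row_def .
  qed
  have row_m: "(\<lambda>y. row x y) \<in> gauss \<rightarrow>\<^sub>M borel" for x
    unfolding row_def
  proof (rule borel_measurable_vec_lambda)
    fix i show "(\<lambda>y. (x(k := y)) i) \<in> borel_measurable gauss" by (cases "i = k") auto
  qed
  note [measurable] = row_m
  have row_m2: "(\<lambda>(x, y). row x y) \<in> (PiM ?J (\<lambda>_. gauss) \<Otimes>\<^sub>M gauss) \<rightarrow>\<^sub>M borel"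
    unfolding row_def split_beta'
  proof (rule borel_measurable_vec_lambda)
    fix i show "(\<lambda>z. ((fst z)(k := snd z)) i) \<in> borel_measurable (PiM ?J (\<lambda>_. gauss) \<Otimes>\<^sub>M (gauss :: (real^'n) measure))"
      by (cases "i = k") (auto intro!: measurable_component_singleton' simp: measurable_fst'')
  qed
  have det_m[measurable]: "{G :: real^'n^'n. det G = 0} \<in> sets borel"
    using measurable_sets[OF borel_measurable_det[OF measurable_ident], of "{0}"] by (simp add: vimage_def)
  \<comment> \<open>By Fubini, for almost every choice of the other rows, almost every k-th row
    gives an invertible matrix.\<close>
  have "(\<integral>\<^sup>+x. (\<integral>\<^sup>+y. indicator {G. det G = 0} (row x y) \<partial>gauss) \<partial>PiM ?J (\<lambda>_. gauss)) = (\<integral>\<^sup>+G. indicator {G :: real^'n^'n. det G = 0} G \<partial>gauss)"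
    by (rule split[symmetric]) simp
  also have "\<dots> = 0"
    by (subst nn_integral_0_iff_AE) (use AE_gauss_det_nonzero in \<open>auto elim: eventually_mono\<close>)
  finally have "AE x in PiM ?J (\<lambda>_. gauss). (\<integral>\<^sup>+y. indicator {G. det G = 0} (row x y) \<partial>gauss) = 0"
    by (subst (asm) nn_integral_0_iff_AE)
      (use row_m2 in \<open>auto intro!: G.borel_measurable_nn_integral measurable_compose[OF row_m2, unfolded split_beta']
        simp: split_beta'\<close>)
  then have AE_det: "AE x in PiM ?J (\<lambda>_. gauss). AE y in gauss. det (row x y) \<noteq> 0"
  proof eventually_elim
    case (elim x)
    then have "AE y in gauss. indicator {G. det G = 0} (row x y) = (0 :: ennreal)"
      by (subst (asm) nn_integral_0_iff_AE) auto
    then show ?case by eventually_elim (auto simp: indicator_def split: if_splits)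
  qed
  have "(\<integral>\<^sup>+G. \<phi> (norm (solve (G :: real^'n^'n) (axis k t))) \<partial>gauss) =
     (\<integral>\<^sup>+x. (\<integral>\<^sup>+y. \<phi> (norm (solve (row x y) (axis k t))) \<partial>gauss) \<partial>PiM ?J (\<lambda>_. gauss))"
    by (rule split) measurable
  also have "\<dots> = (\<integral>\<^sup>+x. (\<integral>\<^sup>+n. \<phi> (t / \<bar>n\<bar>) \<partial>gauss) \<partial>PiM ?J (\<lambda>_. gauss :: (real^'n) measure))"
  proof (rule nn_integral_cong_AE, use AE_det in eventually_elim)
    case (elim x)
    \<comment> \<open>The \<open>CARD('n) - 1\<close> other rows cannot span the space, so a unit
      vector orthogonal to all of them exists.\<close>
    have "dim (x ` ?J) \<le> card ?J"
      using dim_le_card'[of "x ` ?J"] card_image_le[of ?J x] by simp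
    also have "card ?J < CARD('n)" by (simp add: card_Diff_singleton)
    finally have "dim (x ` ?J) < DIM(real^'n)" by simp
    then obtain w where w: "w \<noteq> 0" "\<And>z. z \<in> span (x ` ?J) \<Longrightarrow> orthogonal w z"
      using orthogonal_to_subspace_exists[of "x ` ?J"] by blast
    define \<nu> where "\<nu> = sgn w"
    have \<nu>: "norm \<nu> = 1" using w(1) by (simp add: \<nu>_def norm_sgn)
    have \<nu>x: "x i \<bullet> \<nu> = 0" if "i \<noteq> k" for i
      using w(2)[of "x i"] that by (simp add: span_base \<nu>_def sgn_div_norm orthogonal_def inner_commute)
    have "(\<integral>\<^sup>+y. \<phi> (norm (solve (row x y) (axis k t))) \<partial>gauss) = (\<integral>\<^sup>+y. \<phi> (t / \<bar>y \<bullet> \<nu>\<bar>) \<partial>gauss)"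
    proof (rule nn_integral_cong_AE, use elim in eventually_elim)
      fix y assume det: "det (row x y) \<noteq> 0"
      have mv: "row x y *v (c *\<^sub>R \<nu>) = axis k (c * (y \<bullet> \<nu>))" for c
        by (auto simp: vec_eq_iff matrix_vector_mul_component row_def axis_def \<nu>x)
      have y\<nu>: "y \<bullet> \<nu> \<noteq> 0"
      proof
        assume "y \<bullet> \<nu> = 0"
        then have "row x y *v \<nu> = 0" using mv[of 1] by (simp add: axis_def vec_eq_iff)
        then have "\<nu> = 0" using solve_iff[OF det, of \<nu> 0] solve_zero[OF det] by simp
        then show False using \<nu> by simp
      qed
      then have "row x y *v ((t / (y \<bullet> \<nu>)) *\<^sub>R \<nu>) = axis k t" unfolding mv by simp
      then have "solve (row x y) (axis k t) = (t / (y \<bullet> \<nu>)) *\<^sub>R \<nu>" using solve_iff[OF det] by metis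
      then show "\<phi> (norm (solve (row x y) (axis k t))) = \<phi> (t / \<bar>y \<bullet> \<nu>\<bar>)" using \<nu> t by simp
    qed
    also have "\<dots> = (\<integral>\<^sup>+n. \<phi> (t / \<bar>n\<bar>) \<partial>distr gauss borel (\<lambda>y. y \<bullet> \<nu>))"
      by (rule nn_integral_distr[symmetric]) auto
    also have "\<dots> = (\<integral>\<^sup>+n. \<phi> (t / \<bar>n\<bar>) \<partial>gauss)" unfolding gauss_inner_law[OF \<nu>] ..
    finally show ?case .
  qed
  also have "\<dots> = (\<integral>\<^sup>+n. \<phi> (t / \<bar>n\<bar>) \<partial>gauss)" by (simp add: J.emeasure_space_1)
  finally show ?thesis .
qed

text \<open>An orthogonal matrix that mixes the rows turns \<open>T\<close> into a multiple of a basis vector and does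
  not change the law of \<open>G\<close>.\<close>

lemma nn_integral_solve:
  fixes \<phi> :: "real \<Rightarrow> ennreal" and T :: "real^'n"
  assumes \<phi>[measurable]: "\<phi> \<in> borel_measurable borel" and T: "T \<noteq> 0"
  shows "(\<integral>\<^sup>+G. \<phi> (norm (solve (G :: real^'n^'n) T)) \<partial>gauss) = (\<integral>\<^sup>+n. \<phi> (norm T / \<bar>n\<bar>) \<partial>gauss)"
proof -
  obtain k :: 'n where True by blast
  obtain f where f: "orthogonal_transformation f" "f (axis k (norm T)) = (T :: real^'n)"
    by (rule orthogonal_transformation_exists[of "axis k (norm T)" T])
      (simp_all add: norm_eq_sqrt_inner inner_axis_axis)
  have lin: "linear f" using f(1) unfolding orthogonal_transformation by blast
  have detf: "det (matrix f) \<noteq> 0"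
  proof -
    have "orthogonal_matrix (matrix f)" using f(1) orthogonal_transformation_matrix by blast
    from det_orthogonal_matrix[OF this] show ?thesis by auto
  qed
  have Fm[measurable]: "(\<lambda>G::real^'n^'n. matrix f ** G) \<in> borel_measurable borel"
    by (intro borel_measurable_continuous_onI linear_continuous_on)
      (auto simp: linear_conv_bounded_linear[symmetric] matrix_add_ldistrib matrix_scalar_ac scalar_matrix_assoc intro!: linearI)
  have "(\<integral>\<^sup>+G. \<phi> (norm (solve (G :: real^'n^'n) T)) \<partial>gauss) =
      (\<integral>\<^sup>+G. \<phi> (norm (solve G T)) \<partial>distr gauss borel (\<lambda>G::real^'n^'n. matrix f ** G))"
    unfolding distr_gauss_matrix_mult[OF f(1)] ..
  also have "\<dots> = (\<integral>\<^sup>+G. \<phi> (norm (solve (matrix f ** G) T)) \<partial>gauss)"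
    by (rule nn_integral_distr) measurable
  also have "\<dots> = (\<integral>\<^sup>+G. \<phi> (norm (solve (G :: real^'n^'n) (axis k (norm T)))) \<partial>gauss)"
  proof (rule nn_integral_cong_AE, use AE_gauss_det_nonzero in eventually_elim)
    fix G :: "real^'n^'n" assume G: "det G \<noteq> 0"
    then have "det (matrix f ** G) \<noteq> 0" using detf by (simp add: det_mul)
    moreover have "(matrix f ** G) *v solve G (axis k (norm T)) = T"
    proof -
      have "(matrix f ** G) *v solve G (axis k (norm T)) = f (G *v solve G (axis k (norm T)))"
        using fun_cong[OF matrix_vector_mul(2)[OF lin]] by (simp add: matrix_vector_mul_assoc[symmetric])
      also have "G *v solve G (axis k (norm T)) = axis k (norm T)" using solve_iff[OF G] by blast
      finally show ?thesis using f(2) by simp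
    qed
    ultimately show "\<phi> (norm (solve (matrix f ** G) T)) = \<phi> (norm (solve G (axis k (norm T))))"
      using solve_iff by metis
  qed
  also have "\<dots> = (\<integral>\<^sup>+n. \<phi> (norm T / \<bar>n\<bar>) \<partial>gauss)"
    by (rule nn_integral_solve_axis) (use T in auto)
  finally show ?thesis .
qed

section \<open>The Hausdorff measure of the sphere\<close>

text \<open>Reflections are involutions and carry any point of the sphere to any other, so they
  provide all symmetries that uniformity requires.\<close>

definition reflect :: "'a::real_inner \<Rightarrow> 'a \<Rightarrow> 'a" where
  "reflect u z = z - (2 * (z \<bullet> u)) *\<^sub>R u"

lemma linear_reflect: "linear (reflect u)"
  by (rule linearI) (simp_all add: reflect_def inner_add_left algebra_simps)

lemma norm_reflect:
  assumes "norm u = 1"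
  shows "norm (reflect u z) = norm z"
proof -
  have "u \<bullet> u = 1" using assms by (simp add: dot_square_norm)
  then have "reflect u z \<bullet> reflect u z = z \<bullet> z"
    by (simp add: reflect_def inner_diff inner_commute algebra_simps)
  then show ?thesis by (simp add: norm_eq)
qed

lemma reflect_reflect: "norm u = 1 \<Longrightarrow> reflect u (reflect u z) = z"
  by (simp add: reflect_def inner_diff_left dot_square_norm algebra_simps)

lemma dist_reflect: "norm u = 1 \<Longrightarrow> dist (reflect u x) (reflect u y) = dist x y"
  using norm_reflect[of u "x - y"] linear_diff[OF linear_reflect, of u x y] by (simp add: dist_norm)

text \<open>Householder's reflection: for equal norms
  \<open>norm (x - y) ^ 2 = 2 * (x \<bullet> (x - y))\<close>, which makes the subtracted multiple
  exactly \<open>x - y\<close>.\<close>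

lemma reflect_swap:
  fixes x y :: "'a::real_inner"
  assumes "norm x = norm y" "x \<noteq> y"
  shows "reflect (sgn (x - y)) x = y" "norm (sgn (x - y)) = 1"
proof -
  let ?n = "norm (x - y)"
  have n: "?n \<noteq> 0" using assms by simp
  have "?n\<^sup>2 = 2 * (x \<bullet> (x - y))"
    using assms(1) by (simp add: power2_norm_eq_inner inner_diff inner_commute norm_eq)
  then have "2 * (x \<bullet> (x - y)) / ?n\<^sup>2 = 1" using n by (metis divide_self power_not_zero)
  moreover have "(2 * (x \<bullet> sgn (x - y))) *\<^sub>R sgn (x - y) = (2 * (x \<bullet> (x - y)) / ?n\<^sup>2) *\<^sub>R (x - y)"
    by (simp add: sgn_div_norm power2_eq_square divide_inverse ac_simps)
  ultimately have "reflect (sgn (x - y)) x = x - 1 *\<^sub>R (x - y)"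
    by (simp only: reflect_def)
  then show "reflect (sgn (x - y)) x = y" by simp
  show "norm (sgn (x - y)) = 1" using assms by (simp add: norm_sgn)
qed

lemma diameter_isometry_image:
  fixes f :: "'a::metric_space \<Rightarrow> 'a"
  assumes "\<And>x y. dist (f x) (f y) = dist x y"
  shows "diameter (f ` U) = diameter U" "bounded (f ` U) \<longleftrightarrow> bounded U"
proof -
  show "diameter (f ` U) = diameter U"
  proof -
    have "(\<lambda>(x, y). dist x y) ` (f ` U \<times> f ` U) = (\<lambda>(x, y). dist x y) ` (U \<times> U)"
      unfolding image_paired_Times[symmetric] image_image by (simp add: assms case_prod_beta)
    then show ?thesis unfolding diameter_def by simp
  qed
  show "bounded (f ` U) \<longleftrightarrow> bounded U"
    unfolding bounded_two_points by (simp add: assms)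
qed

text \<open>An isometry carries covers to covers of the same cost. For reflections equality follows
  by applying this twice.\<close>

lemma hausdorff_outer_isometry_le:
  fixes f :: "'a::metric_space \<Rightarrow> 'a"
  assumes iso: "\<And>x y. dist (f x) (f y) = dist x y"
  shows "hausdorff_outer k (f ` A) \<le> hausdorff_outer k A"
  unfolding hausdorff_outer_def
proof (rule SUP_mono, intro bexI)
  fix \<delta> :: real
  show "hausdorff_pre k \<delta> (f ` A) \<le> hausdorff_pre k \<delta> A"
    unfolding hausdorff_pre_def
  proof (rule INF_mono)
    fix U assume U: "U \<in> hausdorff_covers \<delta> A"
    have 1: "(\<lambda>i. f ` U i) \<in> hausdorff_covers \<delta> (f ` A)"
      using U image_mono[of A "\<Union>i. U i" f]
      by (simp add: hausdorff_covers_def diameter_isometry_image[OF iso] image_UN)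
    have 2: "(\<Sum>i. hausdorff_cost k (f ` U i)) \<le> (\<Sum>i. hausdorff_cost k (U i))"
      by (simp add: hausdorff_cost_def diameter_isometry_image[OF iso] cong: if_cong)
    show "\<exists>V\<in>hausdorff_covers \<delta> (f ` A). (\<Sum>i. hausdorff_cost k (V i)) \<le> (\<Sum>i. hausdorff_cost k (U i))"
      by (rule bexI[where x="\<lambda>i. f ` U i" and P="\<lambda>V. (\<Sum>i. hausdorff_cost k (V i)) \<le> (\<Sum>i. hausdorff_cost k (U i))", OF 2 1])
  qed
qed

lemma hausdorff_outer_reflect:
  assumes u: "norm u = 1"
  shows "hausdorff_outer k (reflect u ` A) = hausdorff_outer k A"
proof (rule antisym)
  show "hausdorff_outer k (reflect u ` A) \<le> hausdorff_outer k A"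
    by (rule hausdorff_outer_isometry_le) (rule dist_reflect[OF u])
  have "hausdorff_outer k (reflect u ` reflect u ` A) \<le> hausdorff_outer k (reflect u ` A)"
    by (rule hausdorff_outer_isometry_le) (rule dist_reflect[OF u])
  then show "hausdorff_outer k A \<le> hausdorff_outer k (reflect u ` A)"
    by (simp add: image_image reflect_reflect[OF u])
qed

lemma reflect_image_ball_sphere:
  assumes u: "norm u = 1"
  shows "reflect u ` (ball x r \<inter> sphere 0 1) = ball (reflect u x) r \<inter> sphere 0 1"
proof (intro equalityI subsetI)
  fix z assume "z \<in> ball (reflect u x) r \<inter> sphere 0 1"
  then have "reflect u z \<in> ball x r \<inter> sphere 0 1"
    using dist_reflect[OF u, of x "reflect u z"] by (simp add: norm_reflect[OF u] reflect_reflect[OF u])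
  then show "z \<in> reflect u ` (ball x r \<inter> sphere 0 1)"
    using reflect_reflect[OF u, of z] by (metis image_eqI)
next
  fix z assume "z \<in> reflect u ` (ball x r \<inter> sphere 0 1)"
  then obtain w where "z = reflect u w" "w \<in> ball x r \<inter> sphere 0 1" by (rule imageE)
  then show "z \<in> ball (reflect u x) r \<inter> sphere 0 1"
    using dist_reflect[OF u, of x w] norm_reflect[OF u, of w] by simp
qed

text \<open>By compactness, a uniform measure on the sphere is finite or null as soon as one ball is.\<close>

lemma emeasure_uniform_sphere_le:
  fixes \<mu> :: "'a::euclidean_space measure"
  assumes sets: "sets \<mu> = sets borel" and S: "AE x in \<mu>. x \<in> sphere 0 1"
    and h: "\<And>x. x \<in> sphere 0 1 \<Longrightarrow> emeasure \<mu> (ball x r) = h" and r: "0 < r"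
  shows "\<exists>n::nat. emeasure \<mu> UNIV \<le> of_nat n * h"
proof -
  obtain T where T: "T \<subseteq> sphere (0::'a) 1" "finite T" "sphere 0 1 \<subseteq> (\<Union>x\<in>T. ball x r)"
    by (rule compactE_image[OF compact_sphere[of "0::'a" 1], of "sphere 0 1" "\<lambda>x. ball x r"]) (use r in auto)
  have "emeasure \<mu> UNIV = emeasure \<mu> (sphere 0 1)"
    by (rule emeasure_eq_AE) (use S sets in auto)
  also have "\<dots> \<le> emeasure \<mu> (\<Union>x\<in>T. ball x r)"
    by (rule emeasure_mono) (use T sets in auto)
  also have "\<dots> \<le> (\<Sum>x\<in>T. emeasure \<mu> (ball x r))"
    by (rule emeasure_subadditive_finite) (use T sets in auto)
  also have "\<dots> = (\<Sum>x\<in>T. h)" by (rule sum.cong) (use T h in auto)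
  finally show ?thesis by (auto intro!: exI[of _ "card T"])
qed

text \<open>The squared norms of the two components add up, so the product density depends only on
  the norm and the height. The constant stays unspecified because normalisation fixes it in
  \<open>spherical_law\<close>.\<close>

lemma height_law_eq_density:
  assumes p: "p > 0"
  shows "\<exists>c>0. (height_law p :: ((real^'n) \<times> real) measure) =
    density lborel (\<lambda>z. ennreal c * ennreal (indicator {z. 0 < snd z} z * snd z powr (p - 1) * exp (- (norm z)\<^sup>2 / 2)))"
proof (intro exI conjI)
  interpret C: prob_space "chi p" by (rule prob_space_chi[OF p])
  let ?c = "(1 / sqrt (2 * pi)) ^ CARD('n) / chi_const p"
  have Z: "0 < chi_const p" by (rule nn_integral_chi_weight(2)[OF p])
  show "0 < ?c" using Z by simp
  have "sigma_finite_measure (density lborel (\<lambda>t. ennreal (chi_weight p t / chi_const p)))"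
    using C.sigma_finite_measure unfolding chi_def .
  then have "(height_law p :: ((real^'n) \<times> real) measure) = density (lborel \<Otimes>\<^sub>M lborel)
     (\<lambda>(x, t). ennreal ((1 / sqrt (2 * pi)) ^ DIM(real^'n) * exp (- (norm x)\<^sup>2 / 2)) * ennreal (chi_weight p t / chi_const p))"
    unfolding height_law_def gauss_eq_density_norm chi_def
    by (intro pair_measure_density) (auto simp: lborel.sigma_finite_measure_axioms)
  also have "\<dots> = density lborel (\<lambda>z. ennreal ?c * ennreal (indicator {z. 0 < snd z} z * snd z powr (p - 1) * exp (- (norm z)\<^sup>2 / 2)))"
    unfolding lborel_prod
  proof (rule arg_cong[where f="density lborel"], rule ext)
    fix z :: "(real^'n) \<times> real"
    obtain x t where z: "z = (x, t)" by fastforce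
    have "(norm z)\<^sup>2 = (norm x)\<^sup>2 + t\<^sup>2" by (simp add: z norm_prod_def)
    then have "exp (- (norm z)\<^sup>2 / 2) = exp (- (norm x)\<^sup>2 / 2) * exp (- t\<^sup>2 / 2)"
      by (simp add: exp_add[symmetric] add_divide_distrib)
    then show "(case z of (x, t) \<Rightarrow> ennreal ((1 / sqrt (2 * pi)) ^ DIM(real^'n) * exp (- (norm x)\<^sup>2 / 2)) * ennreal (chi_weight p t / chi_const p))
      = ennreal ?c * ennreal (indicator {z. 0 < snd z} z * snd z powr (p - 1) * exp (- (norm z)\<^sup>2 / 2))"
      using Z by (simp add: z ennreal_mult[symmetric] chi_weight_def indicator_def)
  qed
  finally show "(height_law p :: ((real^'n) \<times> real) measure) =
    density lborel (\<lambda>z. ennreal ?c * ennreal (indicator {z. 0 < snd z} z * snd z powr (p - 1) * exp (- (norm z)\<^sup>2 / 2)))" .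
qed

text \<open>The factor \<open>norm z powr \<alpha>\<close> is included since the height of z is its
  norm times the height of its direction: integrating the height to the power
  \<open>\<alpha>\<close> against this measure reproduces the density of the height law.\<close>

definition cone_measure :: "real \<Rightarrow> 'a::euclidean_space measure" where
  "cone_measure \<alpha> = distr (density lborel (\<lambda>z. ennreal (norm z powr \<alpha> * exp (- (norm z)\<^sup>2 / 2)))) borel sgn"

lemma sgn_measurable [measurable]: "(sgn :: 'a::euclidean_space \<Rightarrow> 'a) \<in> borel_measurable borel"
  unfolding sgn_div_norm[abs_def] by measurable

lemma sets_cone_measure [measurable_cong, simp]: "sets (cone_measure \<alpha>) = sets borel"
  by (simp add: cone_measure_def)

lemma space_cone_measure [simp]: "space (cone_measure \<alpha>) = UNIV"
  by (simp add: cone_measure_def)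

lemma nn_integral_cone_measure:
  assumes [measurable]: "f \<in> borel_measurable borel"
  shows "(\<integral>\<^sup>+x. f x \<partial>cone_measure \<alpha>) = (\<integral>\<^sup>+z. ennreal (norm z powr \<alpha> * exp (- (norm z)\<^sup>2 / 2)) * f (sgn z) \<partial>lborel)"
  unfolding cone_measure_def by (simp add: nn_integral_distr nn_integral_density)

text \<open>In polar coordinates the total mass is a multiple of the chi integral with
  \<open>D + \<alpha>\<close> degrees of freedom; here \<open>D + \<alpha> > 0\<close>, as the
  dimension D is at least 1.\<close>

lemma finite_cone_measure:
  assumes "\<alpha> > -1"
  shows "finite_measure (cone_measure \<alpha> :: 'a::euclidean_space measure)"
proof
  let ?k = "\<lambda>s. ennreal (s powr \<alpha> * exp (- s\<^sup>2 / 2))"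
  define K where "K = emeasure lborel (cball (0::'a) 1)"
  have K: "K < \<infinity>" unfolding K_def using emeasure_bounded_finite[of "cball (0::'a) 1"] by (simp add: less_top)
  define D where "D = real DIM('a)"
  have D: "D > 0" by (simp add: D_def)
  have hom: "emeasure lborel (cball (0::'a) r) = ennreal (r powr D) * K" if "0 \<le> r" for r
    using that unfolding K_def by (cases "r = 0") (simp_all add: emeasure_cball D_def powr_realpow ennreal_mult[symmetric])
  have "emeasure (cone_measure \<alpha> :: 'a measure) (space (cone_measure \<alpha>)) = (\<integral>\<^sup>+x. 1 \<partial>(cone_measure \<alpha> :: 'a measure))"
    by simp
  also have "\<dots> = (\<integral>\<^sup>+z. ennreal (norm z powr \<alpha> * exp (- (norm z)\<^sup>2 / 2)) \<partial>(lborel :: 'a measure))"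
    by (subst nn_integral_cone_measure) auto
  also have "\<dots> = (\<integral>\<^sup>+s. ?k s \<partial>distr (lborel :: 'a measure) borel norm)"
    by (rule nn_integral_distr[symmetric]) auto
  also have "distr (lborel :: 'a measure) borel norm = density lborel (\<lambda>s. K * ennreal (D * s powr (D - 1) * indicator {0<..} s))"
    by (rule distr_norm_homogeneous) (use D K hom in auto)
  also have "(\<integral>\<^sup>+s. ?k s \<partial>\<dots>) =
      (\<integral>\<^sup>+s. K * ennreal (D * s powr (D - 1) * indicator {0<..} s) * ?k s \<partial>lborel)"
    by (rule nn_integral_density) auto
  also have "\<dots> = (\<integral>\<^sup>+s. K * ennreal D * ennreal (chi_weight (D + \<alpha>) s) \<partial>lborel)"
  proof (rule nn_integral_cong)
    fix s :: real
    have "D * s powr (D - 1) * indicator {0<..} s * (s powr \<alpha> * exp (- s\<^sup>2 / 2)) = D * chi_weight (D + \<alpha>) s"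
      by (auto simp: chi_weight_def indicator_def powr_add[symmetric] algebra_simps)
    then have "ennreal (D * s powr (D - 1) * indicator {0<..} s) * ?k s = ennreal D * ennreal (chi_weight (D + \<alpha>) s)"
      using D by (simp add: ennreal_mult[symmetric])
    then show "K * ennreal (D * s powr (D - 1) * indicator {0<..} s) * ?k s = K * ennreal D * ennreal (chi_weight (D + \<alpha>) s)"
      by (simp add: mult.assoc)
  qed
  also have "\<dots> = K * ennreal D * ennreal (chi_const (D + \<alpha>))"
  proof -
    have "1 \<le> D" unfolding D_def using DIM_positive[where 'a='a] by simp
    then have "0 < D + \<alpha>" using assms by linarith
    then show ?thesis by (subst nn_integral_cmult) (auto simp: nn_integral_chi_weight)
  qed
  also have "\<dots> < \<top>" using K by (simp add: ennreal_mult_less_top)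
  finally show "emeasure (cone_measure \<alpha> :: 'a measure) (space (cone_measure \<alpha>)) \<noteq> \<infinity>" by simp
qed

text \<open>Reflections preserve Lebesgue measure and the radial density, and they commute with
  \<open>sgn\<close>.\<close>

lemma distr_cone_measure_reflect:
  fixes u :: "'a::euclidean_space"
  assumes u: "norm u = 1"
  shows "distr (cone_measure \<alpha>) borel (reflect u) = cone_measure \<alpha>"
proof -
  let ?g = "\<lambda>z::'a. ennreal (norm z powr \<alpha> * exp (- (norm z)\<^sup>2 / 2))"
  have m[measurable]: "reflect u \<in> borel_measurable borel"
    unfolding reflect_def[abs_def] by measurable
  have "distr lborel lborel (reflect u) = distr lborel borel (reflect u)"
    by (rule distr_cong) auto
  also have "\<dots> = lborel" by (rule distr_lborel_isometry) (simp_all add: linear_reflect norm_reflect[OF u])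
  finally have "distr (density lborel ?g) lborel (reflect u) = density lborel ?g"
    by (intro density_distr_invariant) (auto simp: norm_reflect[OF u])
  moreover have "distr (density lborel ?g) lborel (reflect u) = distr (density lborel ?g) (density lborel ?g) (reflect u)"
    by (rule distr_cong) simp_all
  ultimately have inv: "distr (density lborel ?g) (density lborel ?g) (reflect u) = density lborel ?g"
    by simp
  have sgn: "sgn (reflect u z) = reflect u (sgn z)" for z
    by (simp add: sgn_div_norm norm_reflect[OF u] linear_scale[OF linear_reflect])
  have "distr (cone_measure \<alpha>) borel (reflect u) = distr (density lborel ?g) borel (reflect u \<circ> sgn)"
    unfolding cone_measure_def by (rule distr_distr) auto
  also have "reflect u \<circ> sgn = sgn \<circ> reflect u" by (simp add: fun_eq_iff sgn)
  also have "distr (density lborel ?g) borel (sgn \<circ> reflect u) =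
      distr (distr (density lborel ?g) (density lborel ?g) (reflect u)) borel sgn"
    by (rule distr_distr[symmetric]) auto
  finally show ?thesis unfolding inv by (simp add: cone_measure_def)
qed

lemma cone_measure_ball_uniform:
  fixes x y :: "'a::euclidean_space"
  assumes "norm x = norm y"
  shows "emeasure (cone_measure \<alpha>) (ball x r) = emeasure (cone_measure \<alpha>) (ball y r)"
proof (cases "x = y")
  case False
  let ?u = "sgn (x - y)"
  note u = reflect_swap[OF assms False]
  have [measurable]: "reflect ?u \<in> borel_measurable borel"
    unfolding reflect_def[abs_def] by measurable
  have "emeasure (cone_measure \<alpha>) (ball x r) = emeasure (distr (cone_measure \<alpha>) borel (reflect ?u)) (ball x r)"
    unfolding distr_cone_measure_reflect[OF u(2)] ..
  also have "\<dots> = emeasure (cone_measure \<alpha>) (reflect ?u -` ball x r \<inter> space (cone_measure \<alpha>))"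
    by (rule emeasure_distr) auto
  also have "reflect ?u -` ball x r \<inter> space (cone_measure \<alpha>) = ball y r"
  proof -
    have "dist x (reflect ?u z) = dist y z" for z
      using dist_reflect[OF u(2), of x "reflect ?u z"] by (simp add: u reflect_reflect)
    then show ?thesis by auto
  qed
  finally show ?thesis .
qed simp

lemma AE_cone_measure_sphere: "AE x in cone_measure \<alpha>. x \<in> sphere (0::'a::euclidean_space) 1"
proof -
  have "AE z in density lborel (\<lambda>z. ennreal (norm z powr \<alpha> * exp (- (norm z)\<^sup>2 / 2))). sgn z \<in> sphere (0::'a) 1"
    using AE_lborel_singleton[of "0::'a"] by (subst AE_density) (auto simp: norm_sgn elim: eventually_mono)
  then show ?thesis unfolding cone_measure_def by (subst AE_distr_iff) auto
qed

text \<open>The pole \<open>(0, 1)\<close> is a default outside the open upper half-space, which the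
  height law does not charge; it makes the map total with values in the half-sphere.\<close>

definition to_half_sphere :: "(real^'n) \<times> real \<Rightarrow> (real^'n) \<times> real" where
  "to_half_sphere z = (if 0 < snd z then sgn z else (0, 1))"

lemma borel_measurable_snd_comp [measurable (raw)]:
  fixes f :: "'w \<Rightarrow> 'a::second_countable_topology \<times> 'b::second_countable_topology"
  assumes "f \<in> borel_measurable M"
  shows "(\<lambda>x. snd (f x)) \<in> borel_measurable M"
  by (rule borel_measurable_continuous_on[OF _ assms]) (intro continuous_intros)

lemma borel_measurable_fst_comp [measurable (raw)]:
  fixes f :: "'w \<Rightarrow> 'a::second_countable_topology \<times> 'b::second_countable_topology"
  assumes "f \<in> borel_measurable M"
  shows "(\<lambda>x. fst (f x)) \<in> borel_measurable M"
  by (rule borel_measurable_continuous_on[OF _ assms]) (intro continuous_intros)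

lemma half_sphere_borel [measurable]: "half_sphere \<in> sets borel"
proof -
  have "closed (sphere 0 1 :: ((real^'n) \<times> real) set)" by simp
  moreover have "open {y :: (real^'n) \<times> real. 0 < snd y}"
    by (intro open_Collect_less continuous_intros)
  moreover have "half_sphere = sphere 0 1 \<inter> {y :: (real^'n) \<times> real. 0 < snd y}"
    by (auto simp: half_sphere_def)
  ultimately show ?thesis by (metis borel_closed borel_open sets.Int)
qed

lemma snd_sgn: "snd (sgn z) = snd z / norm (z :: (real^'n) \<times> real)"
  by (simp add: sgn_div_norm divide_inverse mult.commute)

lemma sgn_in_half_sphere: "sgn z \<in> half_sphere \<longleftrightarrow> 0 < snd (z :: (real^'n) \<times> real)"
proof (cases "z = 0")
  case True
  then show ?thesis by (simp add: half_sphere_def)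
next
  case False
  then show ?thesis by (simp add: half_sphere_def norm_sgn snd_sgn zero_less_divide_iff)
qed

lemma to_half_sphere_in: "to_half_sphere z \<in> half_sphere"
  by (simp add: to_half_sphere_def sgn_in_half_sphere) (simp add: half_sphere_def norm_prod_def)

lemma to_half_sphere_scale:
  assumes "0 < snd z"
  shows "to_half_sphere z = (1 / norm z) *\<^sub>R z" "0 < 1 / norm z"
proof -
  have "z \<noteq> 0" using assms by auto
  then show "to_half_sphere z = (1 / norm z) *\<^sub>R z" "0 < 1 / norm z"
    using assms by (simp_all add: to_half_sphere_def sgn_div_norm divide_inverse)
qed

lemma space_spherical_lebesgue [simp]: "space spherical_lebesgue = half_sphere"
  by (simp add: spherical_lebesgue_def space_restrict_space)

lemma sets_spherical_lebesgue:
  "A \<in> sets spherical_lebesgue \<longleftrightarrow> A \<in> sets borel \<and> A \<subseteq> half_sphere"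
  unfolding spherical_lebesgue_def
  by (subst sets_restrict_space_iff) auto

lemma measurable_spherical_lebesgue_borel: "(\<lambda>x. x) \<in> spherical_lebesgue \<rightarrow>\<^sub>M borel"
  unfolding spherical_lebesgue_def by (rule measurable_restrict_space1) (simp add: measurable_ident_sets)

lemma to_half_sphere_borel_measurable: "to_half_sphere \<in> borel \<rightarrow>\<^sub>M borel"
proof -
  have "(\<lambda>z. if z \<in> {z :: (real^'n) \<times> real. 0 < snd z} then sgn z else (0, 1)) \<in> borel \<rightarrow>\<^sub>M borel"
    by (rule measurable_If_set) (auto intro!: borel_open open_Collect_less continuous_intros)
  then show ?thesis by (simp add: to_half_sphere_def[abs_def])
qed

lemma to_half_sphere_measurable: "to_half_sphere \<in> borel \<rightarrow>\<^sub>M spherical_lebesgue"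
  unfolding spherical_lebesgue_def
proof (rule measurable_restrict_space2)
  show "to_half_sphere \<in> borel \<rightarrow>\<^sub>M hausdorff_measure CARD('a)"
    unfolding measurable_cong_sets[OF refl sets_hausdorff_measure] by (rule to_half_sphere_borel_measurable)
qed (use to_half_sphere_in in blast)

lemma hausdorff_sphere_uniform:
  fixes x y :: "(real^'n) \<times> real"
  assumes "norm x = 1" "norm y = 1"
  shows "emeasure (hausdorff_measure k) (ball x r \<inter> sphere 0 1) = emeasure (hausdorff_measure k) (ball y r \<inter> sphere 0 1)"
proof (cases "x = y")
  case False
  note u = reflect_swap[OF _ False]
  have b: "ball z r \<inter> sphere 0 1 \<in> sets borel" for z :: "(real^'n) \<times> real"
    by (intro sets.Int) auto
  have "hausdorff_outer k (ball y r \<inter> sphere 0 1) = hausdorff_outer k (reflect (sgn (x - y)) ` (ball x r \<inter> sphere 0 1))"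
    using u assms by (simp add: reflect_image_ball_sphere)
  also have "\<dots> = hausdorff_outer k (ball x r \<inter> sphere 0 1)"
    by (rule hausdorff_outer_reflect) (use u assms in simp)
  finally show ?thesis by (simp only: emeasure_hausdorff_measure[OF b])
qed simp

lemma nn_integral_spherical_lebesgue:
  fixes f :: "(real^'n) \<times> real \<Rightarrow> ennreal"
  shows "(\<integral>\<^sup>+z. f z \<partial>spherical_lebesgue) = (\<integral>\<^sup>+z. f z * indicator half_sphere z \<partial>hausdorff_measure CARD('n))"
  unfolding spherical_lebesgue_def by (rule nn_integral_restrict_space) simp

text \<open>The Hausdorff measure on the sphere and \<open>cone_measure \<alpha>\<close> both give
  equal mass to balls of equal radius around points of the sphere, so they are proportional.
  Weighting by the height to the power \<open>\<alpha>\<close> turns the second one into the law of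
  the direction under the height law, up to constants, and these agree because both sides are
  probability measures.\<close>

lemma spherical_law:
  fixes X :: "'w \<Rightarrow> (real^'n) \<times> real"
  assumes \<alpha>: "\<alpha> > -1" and M: "prob_space M"
    and X: "distributed M spherical_lebesgue X (\<lambda>y. ennreal (spherical_density \<alpha> y))"
  shows "distr M spherical_lebesgue X = distr (height_law (\<alpha> + 1)) spherical_lebesgue to_half_sphere"
proof -
  let ?s = "\<lambda>z :: (real^'n) \<times> real. ennreal (snd z powr \<alpha>)"
  interpret M: prob_space M by fact
  let ?S = "sphere 0 1 :: ((real^'n) \<times> real) set"
  let ?SL = "spherical_lebesgue :: ((real^'n) \<times> real) measure"
  let ?H = "hausdorff_measure CARD('n) :: ((real^'n) \<times> real) measure"
  define C where "C = (\<integral>z. snd z powr \<alpha> \<partial>?SL)"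
  have Xm: "X \<in> M \<rightarrow>\<^sub>M ?SL" using X by (rule distributed_measurable)
  have law: "distr M ?SL X = density ?SL (\<lambda>y. ennreal (spherical_density \<alpha> y))"
    using X by (rule distributed_distr_eq_density)
  have hs: "half_sphere \<in> sets ?SL" by (simp add: sets_spherical_lebesgue)
  interpret P: prob_space "distr M ?SL X" by (rule M.prob_space_distr[OF Xm])
  have snd_m: "(\<lambda>z. snd z powr \<alpha>) \<in> borel_measurable ?SL"
    using measurable_compose[OF measurable_spherical_lebesgue_borel, of "\<lambda>z. snd z powr \<alpha>" borel] by simp
  have dens: "spherical_density \<alpha> y = (1 / C) * snd y powr \<alpha>" for y :: "(real^'n) \<times> real"
    by (simp add: spherical_density_def C_def)
  \<comment> \<open>If C were 0, division by zero would make the density 0 and X would have no mass.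
    Since a nonintegrable function has integral 0 by convention, this also yields
    integrability.\<close>
  have C0: "C \<noteq> 0"
  proof
    assume "C = 0"
    then have "emeasure (distr M ?SL X) (space (distr M ?SL X)) = 0"
      unfolding law dens using hs by (simp add: emeasure_density)
    then show False using P.emeasure_space_1 by simp
  qed
  then have int: "integrable ?SL (\<lambda>z. snd z powr \<alpha>)"
    unfolding C_def by (metis not_integrable_integral_eq)
  have "0 \<le> C" unfolding C_def by (rule Bochner_Integration.integral_nonneg) simp
  with C0 have C: "0 < C" by simp
  have intC: "(\<integral>\<^sup>+z. ?s z \<partial>?SL) = ennreal C"
    unfolding C_def by (rule nn_integral_eq_integral[OF int]) simp
  have iS[measurable]: "(indicator ?S :: _ \<Rightarrow> ennreal) \<in> borel_measurable ?H"
    by (rule borel_measurable_indicator) simp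
  define \<mu> where "\<mu> = density ?H (indicator ?S)"
  have sets_\<mu>[measurable_cong, simp]: "sets \<mu> = sets borel" by (simp add: \<mu>_def)
  have em: "emeasure \<mu> A = emeasure ?H (A \<inter> ?S)" if "A \<in> sets borel" for A
  proof -
    have "emeasure \<mu> A = (\<integral>\<^sup>+x. indicator ?S x * indicator A x \<partial>?H)"
      unfolding \<mu>_def by (rule emeasure_density) (use that iS in auto)
    also have "\<dots> = (\<integral>\<^sup>+x. indicator (A \<inter> ?S) x \<partial>?H)"
      by (intro nn_integral_cong) (auto simp: indicator_def)
    also have "\<dots> = emeasure ?H (A \<inter> ?S)"
      using that by (intro nn_integral_indicator) (auto intro!: sets.Int)
    finally show ?thesis .
  qed
  define e :: "(real^'n) \<times> real" where "e = (0, 1)"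
  have e: "norm e = 1" by (simp add: e_def norm_prod_def)
  define h where "h r = emeasure \<mu> (ball e r)" for r
  have h: "emeasure \<mu> (ball x r) = h r" if "x \<in> ?S" for x r
    unfolding h_def em[OF borel_open[OF open_ball]]
    using that e by (intro hausdorff_sphere_uniform) simp_all
  have AE\<mu>: "AE x in \<mu>. x \<in> ?S"
    unfolding \<mu>_def by (subst AE_density) (auto simp: indicator_def)
  \<comment> \<open>A lower bound for the weight on the ball of radius 1/2 around the pole, where
    the height lies between 1/2 and 1; the minimum serves both signs of
    \<open>\<alpha>\<close>.\<close>
  define c0 where "c0 = min 1 ((1/2) powr \<alpha>)"
  have c0: "0 < c0" by (simp add: c0_def)
  have low: "z \<in> half_sphere" "c0 \<le> snd z powr \<alpha>" if z: "z \<in> ball e (1/2)" "z \<in> ?S" for z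
  proof -
    have "\<bar>snd z - 1\<bar> \<le> dist e z"
      using dist_snd_le[of e z] by (simp add: e_def dist_real_def abs_minus_commute)
    then have lo: "1/2 < snd z" using z(1) by (simp add: abs_if split: if_splits)
    have "norm (snd z) \<le> norm z" using norm_snd_le[of "snd z" "fst z"] by simp
    then have hi: "snd z \<le> 1" using z(2) by simp
    show "z \<in> half_sphere" using lo z(2) by (simp add: half_sphere_def)
    show "c0 \<le> snd z powr \<alpha>"
    proof (cases "\<alpha> \<ge> 0")
      case True
      then have "(1/2) powr \<alpha> \<le> snd z powr \<alpha>" using lo by (intro powr_mono2) auto
      then show ?thesis by (simp add: c0_def)
    next
      case False
      then have "1 powr \<alpha> \<le> snd z powr \<alpha>" using lo hi by (intro powr_mono2') auto
      then show ?thesis by (simp add: c0_def)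
    qed
  qed
  \<comment> \<open>Finiteness: the weighted integral C controls the mass of one ball, and finitely
    many balls of this radius cover the sphere.\<close>
  have "ennreal c0 * h (1/2) = (\<integral>\<^sup>+z. ennreal c0 * indicator (ball e (1/2)) z \<partial>\<mu>)"
    unfolding h_def by (rule nn_integral_cmult_indicator[symmetric]) simp
  also have "\<dots> = (\<integral>\<^sup>+z. indicator ?S z * (ennreal c0 * indicator (ball e (1/2)) z) \<partial>?H)"
    unfolding \<mu>_def by (rule nn_integral_density) (auto intro!: iS borel_measurable_times_ennreal borel_measurable_indicator)
  also have "\<dots> \<le> (\<integral>\<^sup>+z. ?s z * indicator half_sphere z \<partial>?H)"
    by (intro nn_integral_mono) (use low in \<open>auto simp: indicator_def intro!: ennreal_leI\<close>)
  also have "\<dots> = ennreal C" unfolding nn_integral_spherical_lebesgue[symmetric] by (rule intC)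
  finally have "ennreal c0 * h (1/2) < \<top>" by (rule le_less_trans) simp
  then have hfin: "h (1/2) < \<top>" using c0 by (auto simp: ennreal_mult_less_top)
  obtain n0 :: nat where "emeasure \<mu> UNIV \<le> of_nat n0 * h (1/2)"
    using emeasure_uniform_sphere_le[OF sets_\<mu> AE\<mu>, of "1/2" "h (1/2)"] h by auto
  also have "\<dots> < \<top>" using hfin by (simp add: ennreal_mult_less_top of_nat_less_top)
  finally have \<mu>fin: "emeasure \<mu> UNIV < \<top>" .
  have space_\<mu>: "space \<mu> = UNIV" by (simp add: \<mu>_def)
  have fin\<mu>: "finite_measure \<mu>" by standard (use \<mu>fin in \<open>simp add: space_\<mu>\<close>)
  \<comment> \<open>If the sphere were a null set, the weighted integral C would be 0.\<close>
  have \<mu>pos: "0 < emeasure \<mu> UNIV"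
  proof (rule ccontr)
    assume "\<not> ?thesis"
    then have "emeasure ?H ?S = 0" using em[of UNIV] by simp
    then have null: "?S \<in> null_sets ?H" by (auto simp: null_sets_def)
    have "(\<integral>\<^sup>+z. ?s z * indicator half_sphere z \<partial>?H) = (\<integral>\<^sup>+z. 0 \<partial>?H)"
      by (rule nn_integral_cong_AE, use AE_not_in[OF null] in eventually_elim) (auto simp: half_sphere_def indicator_def)
    then show False using intC C unfolding nn_integral_spherical_lebesgue by simp
  qed
  have h0: "0 < h r \<and> h r < \<infinity>" if r: "0 < r" for r
  proof
    obtain m :: nat where m: "emeasure \<mu> UNIV \<le> of_nat m * h r"
      using emeasure_uniform_sphere_le[OF sets_\<mu> AE\<mu> _ r, of "h r"] h by auto
    show "0 < h r"
    proof (rule ccontr)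
      assume "\<not> 0 < h r"
      then show False using m \<mu>pos by simp
    qed
    show "h r < \<infinity>"
      unfolding h_def infinity_ennreal_def by (rule le_less_trans[OF emeasure_mono \<mu>fin]) auto
  qed
  let ?\<nu> = "cone_measure \<alpha> :: ((real^'n) \<times> real) measure"
  define k where "k r = emeasure ?\<nu> (ball e r)" for r
  have k: "emeasure ?\<nu> (ball x r) = k r" if "x \<in> ?S" for x r
    unfolding k_def using that e by (intro cone_measure_ball_uniform) simp
  interpret N: finite_measure ?\<nu> by (rule finite_cone_measure[OF \<alpha>])
  have \<nu>pos: "0 < emeasure ?\<nu> UNIV"
  proof (rule ccontr)
    assume "\<not> ?thesis"
    then have "(\<integral>\<^sup>+z. 1 \<partial>?\<nu>) = 0" by simp
    then have "(\<integral>\<^sup>+z. ennreal (norm z powr \<alpha> * exp (- (norm z)\<^sup>2 / 2)) \<partial>(lborel :: ((real^'n) \<times> real) measure)) = 0"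
      by (subst (asm) nn_integral_cone_measure) simp_all
    then have "AE z in lborel. ennreal (norm z powr \<alpha> * exp (- (norm (z :: (real^'n) \<times> real))\<^sup>2 / 2)) = 0"
      by (subst (asm) nn_integral_0_iff_AE) auto
    with AE_lborel_singleton[of "0 :: (real^'n) \<times> real"] have "AE z in (lborel :: ((real^'n) \<times> real) measure). False"
      by eventually_elim (auto simp: ennreal_eq_0_iff mult_le_0_iff)
    then show False by (auto simp: AE_iff_null dest: null_setsD1)
  qed
  have k0: "0 < k r \<and> k r < \<infinity>" if r: "0 < r" for r
  proof
    have "\<exists>m::nat. emeasure ?\<nu> UNIV \<le> of_nat m * k r"
      by (rule emeasure_uniform_sphere_le[OF sets_cone_measure AE_cone_measure_sphere k r])
    then obtain m :: nat where m: "emeasure ?\<nu> UNIV \<le> of_nat m * k r" by blast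
    show "0 < k r"
    proof (rule ccontr)
      assume "\<not> 0 < k r"
      then show False using m \<nu>pos by simp
    qed
    show "k r < \<infinity>"
      unfolding k_def using N.emeasure_finite[of "ball e r"] by (simp only: infinity_ennreal_def less_top)
  qed
  define r where "r = emeasure \<mu> UNIV / emeasure ?\<nu> UNIV"
  have \<mu>_eq: "\<mu> = scale_measure r ?\<nu>"
    unfolding r_def
  proof (rule uniform_balls_proportional[where S="?S" and h=h and k=k])
    show "emeasure \<mu> (ball x r) = h r" if "x \<in> ?S" "0 < r" for x r by (rule h[OF that(1)])
    show "emeasure ?\<nu> (ball x r) = k r" if "x \<in> ?S" "0 < r" for x r by (rule k[OF that(1)])
    show "0 < h r \<and> h r < \<infinity>" if "0 < r" for r by (rule h0[OF that])
    show "0 < k r \<and> k r < \<infinity>" if "0 < r" for r by (rule k0[OF that])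
  qed (fact fin\<mu> N.finite_measure_axioms sets_\<mu> sets_cone_measure AE\<mu> AE_cone_measure_sphere \<mu>pos)+
  define w :: "(real^'n) \<times> real \<Rightarrow> real" where
    "w z = indicator {z. 0 < snd z} z * snd z powr (\<alpha> + 1 - 1) * exp (- (norm z)\<^sup>2 / 2)" for z
  have [measurable]: "w \<in> borel_measurable borel" unfolding w_def[abs_def] by measurable
  define I where "I A = (\<integral>\<^sup>+z. ennreal (w z) * indicator A (to_half_sphere z) \<partial>lborel)" for A
  have PA: "emeasure (distr M ?SL X) A = r * ennreal (1 / C) * I A" if "A \<in> sets ?SL" for A
  proof -
    have A: "A \<in> sets borel" "A \<subseteq> half_sphere" using that sets_spherical_lebesgue by auto
    note [measurable] = A(1)
    have "emeasure (distr M ?SL X) A = (\<integral>\<^sup>+z. ennreal ((1 / C) * snd z powr \<alpha>) * indicator A z \<partial>?SL)"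
      unfolding law dens using snd_m that by (intro emeasure_density) simp_all
    also have "\<dots> = (\<integral>\<^sup>+z. ennreal ((1 / C) * snd z powr \<alpha>) * indicator A z * indicator half_sphere z \<partial>?H)"
      by (rule nn_integral_spherical_lebesgue)
    also have "\<dots> = (\<integral>\<^sup>+z. indicator ?S z * (ennreal (1 / C) * (?s z * indicator A z)) \<partial>?H)"
      using A(2) C by (intro nn_integral_cong) (auto simp: indicator_def half_sphere_def ennreal_mult[symmetric])
    also have "\<dots> = (\<integral>\<^sup>+z. ennreal (1 / C) * (?s z * indicator A z) \<partial>\<mu>)"
      unfolding \<mu>_def by (rule nn_integral_density[symmetric]) (use iS in auto)
    also have "\<dots> = r * (\<integral>\<^sup>+z. ennreal (1 / C) * (?s z * indicator A z) \<partial>?\<nu>)"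
      unfolding \<mu>_eq by (rule nn_integral_scale_measure) measurable
    also have "\<dots> = r * (ennreal (1 / C) * (\<integral>\<^sup>+z. ?s z * indicator A z \<partial>?\<nu>))"
      by (subst nn_integral_cmult) auto
    also have "(\<integral>\<^sup>+z. ?s z * indicator A z \<partial>?\<nu>) =
       (\<integral>\<^sup>+z. ennreal (norm z powr \<alpha> * exp (- (norm z)\<^sup>2 / 2)) * (ennreal (snd (sgn z) powr \<alpha>) * indicator A (sgn z)) \<partial>lborel)"
      by (rule nn_integral_cone_measure) measurable
    also have "\<dots> = I A"
      unfolding I_def
    proof (rule nn_integral_cong)
      fix z :: "(real^'n) \<times> real"
      show "ennreal (norm z powr \<alpha> * exp (- (norm z)\<^sup>2 / 2)) * (ennreal (snd (sgn z) powr \<alpha>) * indicator A (sgn z))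
          = ennreal (w z) * indicator A (to_half_sphere z)"
      proof (cases "0 < snd z")
        case True
        then have "z \<noteq> 0" by auto
        have "norm z powr \<alpha> * snd (sgn z) powr \<alpha> = (norm z * (snd z / norm z)) powr \<alpha>"
          unfolding snd_sgn by (rule powr_mult[symmetric])
        also have "\<dots> = snd z powr \<alpha>" using \<open>z \<noteq> 0\<close> by simp
        finally have "norm z powr \<alpha> * exp (- (norm z)\<^sup>2 / 2) * snd (sgn z) powr \<alpha> = w z"
          using True by (simp add: w_def)
        then have "ennreal (norm z powr \<alpha> * exp (- (norm z)\<^sup>2 / 2)) * ennreal (snd (sgn z) powr \<alpha>) = ennreal (w z)"
          by (simp add: ennreal_mult[symmetric])
        then show ?thesis using True by (simp add: to_half_sphere_def mult.assoc[symmetric])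
      next
        case False
        then have "sgn z \<notin> A" using A(2) sgn_in_half_sphere by blast
        then show ?thesis using False by (simp add: w_def)
      qed
    qed
    finally show ?thesis by (simp add: mult.assoc)
  qed
  obtain c where c: "c > 0" and Q: "(height_law (\<alpha> + 1) :: ((real^'n) \<times> real) measure) =
      density lborel (\<lambda>z. ennreal c * ennreal (w z))"
    using height_law_eq_density[of "\<alpha> + 1"] \<alpha> unfolding w_def by auto
  have th: "to_half_sphere \<in> height_law (\<alpha> + 1) \<rightarrow>\<^sub>M ?SL"
    unfolding measurable_cong_sets[OF sets_height_law refl] by (rule to_half_sphere_measurable)
  have QA: "emeasure (distr (height_law (\<alpha> + 1)) ?SL to_half_sphere) A = ennreal c * I A" if "A \<in> sets ?SL" for A
  proof -
    have A: "A \<in> sets borel" using that sets_spherical_lebesgue by auto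
    have A'[measurable]: "to_half_sphere -` A \<in> sets borel"
      using measurable_sets[OF to_half_sphere_borel_measurable A] by simp
    have "emeasure (distr (height_law (\<alpha> + 1)) ?SL to_half_sphere) A = emeasure (height_law (\<alpha> + 1)) (to_half_sphere -` A)"
      using emeasure_distr[OF th that] by simp
    also have "\<dots> = (\<integral>\<^sup>+z. ennreal c * ennreal (w z) * indicator (to_half_sphere -` A) z \<partial>lborel)"
      unfolding Q by (rule emeasure_density) auto
    also have "\<dots> = (\<integral>\<^sup>+z. ennreal c * (ennreal (w z) * indicator A (to_half_sphere z)) \<partial>lborel)"
      by (intro nn_integral_cong) (simp add: indicator_def mult.assoc)
    also have "\<dots> = ennreal c * I A"
      unfolding I_def
    proof (rule nn_integral_cmult)
      have "(\<lambda>z. indicator (to_half_sphere -` A) z :: ennreal) \<in> borel_measurable borel" by measurable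
      moreover have "(\<lambda>z. indicator (to_half_sphere -` A) z) = (\<lambda>z. indicator A (to_half_sphere z) :: ennreal)"
        by (simp add: fun_eq_iff indicator_def)
      ultimately show "(\<lambda>z. ennreal (w z) * indicator A (to_half_sphere z)) \<in> borel_measurable lborel" by simp
    qed
    finally show ?thesis .
  qed
  interpret Q: prob_space "height_law (\<alpha> + 1) :: ((real^'n) \<times> real) measure"
    by (rule prob_space_height_law) (use \<alpha> in simp)
  interpret Q': prob_space "distr (height_law (\<alpha> + 1)) ?SL to_half_sphere"
    by (rule Q.prob_space_distr[OF th])
  define J where "J = I half_sphere"
  \<comment> \<open>The unknown constants are compared through the total mass: each of them is
    inverse to J.\<close>
  have 1: "r * ennreal (1 / C) * J = 1" "ennreal c * J = 1"
    using P.emeasure_space_1 Q'.emeasure_space_1 PA[OF hs] QA[OF hs] by (simp_all add: J_def)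
  have "r * ennreal (1 / C) = r * ennreal (1 / C) * (ennreal c * J)" using 1(2) by simp
  also have "\<dots> = ennreal c * (r * ennreal (1 / C) * J)" by (simp only: ac_simps)
  also have "\<dots> = ennreal c" using 1(1) by simp
  finally have "r * ennreal (1 / C) = ennreal c" .
  then show ?thesis by (intro measure_eqI) (auto simp: PA QA)
qed

section \<open>The distribution function of Student's law and the sides of a hyperplane\<close>

lemma emeasure_chi_singleton [simp]: "emeasure (chi p) {s} = 0"
proof -
  have "emeasure (chi p) {s} = (\<integral>\<^sup>+t. ennreal (chi_weight p t / chi_const p) * indicator {s} t \<partial>lborel)"
    unfolding chi_def by (rule emeasure_density) auto
  also have "\<dots> = (\<integral>\<^sup>+t. 0 \<partial>(lborel :: real measure))"
    by (rule nn_integral_cong_AE, use AE_lborel_singleton[of s] in eventually_elim) (simp add: indicator_def)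
  finally show ?thesis by simp
qed

definition student_cdf :: "real \<Rightarrow> real \<Rightarrow> real" where
  "student_cdf p x = measure (student p) {..x}"

lemma sets_student [measurable_cong, simp]: "sets (student p) = sets borel"
  by (simp add: student_def)

lemma space_student [simp]: "space (student p) = UNIV"
  by (simp add: student_def)

lemma AE_student_neq: "AE x in student p. x \<noteq> a"
  unfolding student_def by (subst AE_density) (use AE_lborel_singleton[of a] in \<open>auto elim: eventually_mono\<close>)

lemma distr_student_uminus: "distr (student p) borel uminus = student p"
proof -
  have "distr (student p) lborel uminus = student p"
    unfolding student_def
    by (rule density_distr_invariant) (use lborel_distr_uminus in \<open>auto cong: distr_cong\<close>)
  moreover have "distr (student p) lborel uminus = distr (student p) borel uminus"
    by (rule distr_cong) auto
  ultimately show ?thesis by simp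
qed

locale student_space =
  fixes p :: real
  assumes p: "p > 0"
begin

sublocale prob_space "student p" by (rule prob_space_student[OF p])

lemma emeasure_Iic: "emeasure (student p) {..x} = ennreal (student_cdf p x)"
  by (simp add: student_cdf_def emeasure_eq_measure)

lemma emeasure_Iio: "emeasure (student p) {..<x} = ennreal (student_cdf p x)"
proof -
  have "emeasure (student p) {..<x} = emeasure (student p) {..x}"
    by (rule emeasure_eq_AE) (use AE_student_neq[of x p] in \<open>auto elim: eventually_mono\<close>)
  then show ?thesis by (simp add: emeasure_Iic)
qed

lemma student_cdf_nonneg: "0 \<le> student_cdf p x" and student_cdf_le_1: "student_cdf p x \<le> 1"
  by (simp_all add: student_cdf_def)

lemma emeasure_Ioi: "emeasure (student p) {x<..} = ennreal (1 - student_cdf p x)"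
proof -
  have "measure (student p) {x<..} = 1 - student_cdf p x"
    unfolding student_cdf_def using prob_compl[of "{..x}"] by (simp add: Compl_eq_Diff_UNIV[symmetric])
  then show ?thesis by (simp add: emeasure_eq_measure)
qed

lemma student_cdf_minus: "student_cdf p (- x) = 1 - student_cdf p x"
proof -
  have "emeasure (student p) {..- x} = emeasure (distr (student p) borel uminus) {..- x}"
    by (simp only: distr_student_uminus)
  also have "\<dots> = emeasure (student p) (uminus -` {..- x} \<inter> space (student p))"
    by (rule emeasure_distr) auto
  also have "uminus -` {..- x} \<inter> space (student p) = {x..}" by auto
  also have "emeasure (student p) {x..} = emeasure (student p) {x<..}"
    by (rule emeasure_eq_AE) (use AE_student_neq[of x p] in \<open>auto elim: eventually_mono\<close>)
  finally have "ennreal (student_cdf p (- x)) = ennreal (1 - student_cdf p x)"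
    by (simp add: emeasure_Iic emeasure_Ioi)
  then show ?thesis using student_cdf_nonneg student_cdf_le_1 by (subst (asm) ennreal_inj) auto
qed

definition density_fun :: "real \<Rightarrow> real" where
  "density_fun x = student_const p * (1 + x\<^sup>2) powr (- (p + 1) / 2)"

lemma density_fun_nonneg: "0 \<le> density_fun x"
  using student_const_pos[OF p] by (simp add: density_fun_def)

lemma density_fun_continuous: "continuous_on A density_fun"
proof -
  have "1 + x\<^sup>2 \<noteq> 0" for x :: real by (metis add_pos_nonneg less_irrefl zero_le_power2 zero_less_one)
  then show ?thesis unfolding density_fun_def[abs_def] by (intro continuous_intros) auto
qed

lemma density_fun_measurable [measurable]: "density_fun \<in> borel_measurable borel"
  by (rule borel_measurable_continuous_onI[OF density_fun_continuous])

lemma student_eq: "student p = density lborel (\<lambda>x. ennreal (density_fun x))"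
  by (simp add: student_def density_fun_def[abs_def])

lemma integrable_density_fun: "integrable lborel density_fun"
proof (rule integrableI_nonneg)
  have "(\<integral>\<^sup>+x. ennreal (density_fun x) \<partial>lborel) = emeasure (student p) (space (student p))"
    unfolding student_eq by (simp add: emeasure_density)
  then show "(\<integral>\<^sup>+x. ennreal (density_fun x) \<partial>lborel) < \<infinity>" using emeasure_space_1 by simp
qed (auto simp: density_fun_nonneg)

lemma DERIV_student_cdf: "(student_cdf p has_real_derivative density_fun x) (at x)"
proof -
  \<comment> \<open>A finite base point to the left of x, so that the fundamental theorem is applied
    on a compact interval.\<close>
  define a where "a = x - 1"
  have eq: "student_cdf p y = student_cdf p a + (LBINT t=a..y. density_fun t)" if "a \<le> y" for y
  proof -
    have "student_cdf p y = measure (student p) ({..a} \<union> {a<..y})"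
      using that by (simp add: student_cdf_def ivl_disj_un)
    also have "\<dots> = student_cdf p a + measure (student p) {a<..y}"
      unfolding student_cdf_def by (rule finite_measure_Union) auto
    also have "measure (student p) {a<..y} = (\<integral>t. density_fun t * indicator {a<..y} t \<partial>lborel)"
    proof -
      have "integrable lborel (\<lambda>t. density_fun t * indicator {a<..y} t)"
        by (rule integrable_real_mult_indicator[OF _ integrable_density_fun]) simp
      then have "(\<integral>\<^sup>+t. ennreal (density_fun t * indicator {a<..y} t) \<partial>lborel) =
          ennreal (\<integral>t. density_fun t * indicator {a<..y} t \<partial>lborel)"
        by (rule nn_integral_eq_integral) (simp add: density_fun_nonneg)
      moreover have "emeasure (student p) {a<..y} = (\<integral>\<^sup>+t. ennreal (density_fun t * indicator {a<..y} t) \<partial>lborel)"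
        unfolding student_eq
        by (subst emeasure_density) (auto intro!: nn_integral_cong simp: indicator_def)
      moreover have "0 \<le> (\<integral>t. density_fun t * indicator {a<..y} t \<partial>lborel)"
        by (rule Bochner_Integration.integral_nonneg) (simp add: density_fun_nonneg)
      ultimately show ?thesis by (simp add: measure_def)
    qed
    also have "\<dots> = (LBINT t=a..y. density_fun t)"
      using that by (simp add: interval_integral_Ioc set_lebesgue_integral_def mult.commute)
    finally show ?thesis .
  qed
  have "((\<lambda>u. LBINT t=a..u. density_fun t) has_vector_derivative density_fun x) (at x within {x - 1..x + 1})"
    by (rule interval_integral_FTC2) (auto simp: a_def density_fun_continuous)
  then have "((\<lambda>u. LBINT t=a..u. density_fun t) has_real_derivative density_fun x) (at x)"
    by (subst (asm) at_within_Icc_at) (auto simp: has_real_derivative_iff_has_vector_derivative)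
  then have "((\<lambda>u. student_cdf p a + (LBINT t=a..u. density_fun t)) has_real_derivative density_fun x) (at x)"
    by (auto intro!: derivative_eq_intros)
  then show ?thesis
  proof (rule has_field_derivative_transform_within[where d=1])
    fix u assume "dist u x < 1"
    then have "a \<le> u" by (simp add: a_def dist_real_def)
    then show "student_cdf p a + (LBINT t=a..u. density_fun t) = student_cdf p u" by (rule eq[symmetric])
  qed simp_all
qed

lemma student_cdf_limits: "(student_cdf p \<longlongrightarrow> 0) at_bot" "(student_cdf p \<longlongrightarrow> 1) at_top"
proof -
  interpret D: real_distribution "student p" by standard auto
  have "student_cdf p = cdf (student p)" by (simp add: student_cdf_def[abs_def] cdf_def[abs_def])
  then show "(student_cdf p \<longlongrightarrow> 0) at_bot" "(student_cdf p \<longlongrightarrow> 1) at_top"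
    using D.cdf_lim_at_bot D.cdf_lim_at_top_prob by simp_all
qed

lemma student_cdf_measurable [measurable]: "student_cdf p \<in> borel_measurable borel"
  by (rule borel_measurable_continuous_onI)
    (meson DERIV_isCont DERIV_student_cdf continuous_at_imp_continuous_on)

end

lemma (in student_space) beta_prime_cdf_student: "beta_prime_cdf (p - 1) (student_const p) (student_cdf p)"
proof (rule beta_prime_cdf.intro)
  show "(student_cdf p has_real_derivative student_const p * (1 + x\<^sup>2) powr (- (p - 1 + 2) / 2)) (at x)" for x
  proof -
    have "- (p - 1 + 2) / 2 = - (p + 1) / 2" by simp
    then show ?thesis using DERIV_student_cdf[of x] by (simp only: density_fun_def)
  qed
qed (use p student_const_pos[OF p] student_cdf_limits in simp_all)

text \<open>Projection to the direction of a leaves one standard normal variable N in place of the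
  horizontal part, and \<open>norm a * N < T\<close> means \<open>N / T < 1 / norm a\<close> because
  T is positive.\<close>

lemma (in student_space) emeasure_height_law_sides:
  fixes a :: "real^'n"
  assumes a: "a \<noteq> 0"
  shows "emeasure (height_law p) {z. fst z \<bullet> a < snd z} = ennreal (student_cdf p (1 / norm a))" (is ?A)
    and "emeasure (height_law p) {z. snd z < fst z \<bullet> a} = ennreal (1 - student_cdf p (1 / norm a))" (is ?B)
proof -
  define \<nu> where "\<nu> = sgn a"
  have \<nu>: "norm \<nu> = 1" using a by (simp add: \<nu>_def norm_sgn)
  have inner: "g \<bullet> a = norm a * (g \<bullet> \<nu>)" for g using a by (simp add: \<nu>_def sgn_div_norm)
  interpret G: prob_space "gauss :: (real^'n) measure" by (rule prob_space_gauss)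
  interpret C: prob_space "chi p" by (rule prob_space_chi[OF p])
  interpret G1: prob_space "gauss :: real measure" by (rule prob_space_gauss)
  interpret P: pair_sigma_finite "gauss :: (real^'n) measure" "chi p" ..
  interpret P1: pair_sigma_finite "gauss :: real measure" "chi p" ..
  \<comment> \<open>An arbitrary relation \<open>R\<close> treats both sides of the hyperplane at
    once.\<close>
  have key: "emeasure (height_law p) {z. R (fst z \<bullet> a) (snd z)} = emeasure (student p) {x. R' x}"
    if R: "{q. R (fst q) (snd q)} \<in> sets (borel :: (real \<times> real) measure)" and R': "{x. R' x} \<in> sets borel"
      and RR: "\<And>n t. 0 < t \<Longrightarrow> R (norm a * n) t \<longleftrightarrow> R' (n / t)" for R R'
  proof -
    have m: "(\<lambda>z :: (real^'n) \<times> real. (fst z \<bullet> a, snd z)) \<in> borel \<rightarrow>\<^sub>M borel"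
      by (intro borel_measurable_continuous_onI continuous_intros)
    have s: "{z :: (real^'n) \<times> real. R (fst z \<bullet> a) (snd z)} \<in> sets borel"
      using measurable_sets[OF m R] by (simp add: vimage_def)
    have m1: "(\<lambda>q :: real \<times> real. (norm a * fst q, snd q)) \<in> borel \<rightarrow>\<^sub>M borel"
      by (intro borel_measurable_continuous_onI continuous_intros)
    have s1: "{q. R (norm a * fst q) (snd q)} \<in> sets borel"
      using measurable_sets[OF m1 R] by (simp add: vimage_def)
    have s2: "{n. R (norm a * n) t} \<in> sets borel" for t
    proof -
      have "(\<lambda>n::real. (n, t)) \<in> borel \<rightarrow>\<^sub>M borel"
        by (intro borel_measurable_continuous_onI continuous_intros)
      from measurable_sets[OF this s1] show ?thesis by (simp add: vimage_def)
    qed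
    have "emeasure (height_law p) {z. R (fst z \<bullet> a) (snd z)} =
        (\<integral>\<^sup>+t. emeasure gauss {g. R (g \<bullet> a) t} \<partial>chi p)"
    proof -
      have "{z. R (fst z \<bullet> a) (snd z)} \<in> sets (gauss \<Otimes>\<^sub>M chi p)"
        using s unfolding sets_height_law[unfolded height_law_def, of p] .
      from P.emeasure_pair_measure_alt2[OF this] show ?thesis
        unfolding height_law_def by (simp add: vimage_def)
    qed
    also have "\<dots> = (\<integral>\<^sup>+t. emeasure (gauss :: real measure) {n. R (norm a * n) t} \<partial>chi p)"
    proof (rule nn_integral_cong)
      fix t
      have "emeasure (gauss :: real measure) {n. R (norm a * n) t} = emeasure (distr gauss borel (\<lambda>g. g \<bullet> \<nu>)) {n. R (norm a * n) t}"
        unfolding gauss_inner_law[OF \<nu>] ..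
      also have "\<dots> = emeasure gauss ((\<lambda>g. g \<bullet> \<nu>) -` {n. R (norm a * n) t} \<inter> space gauss)"
        by (rule emeasure_distr) (use s2 in auto)
      also have "(\<lambda>g. g \<bullet> \<nu>) -` {n. R (norm a * n) t} \<inter> space gauss = {g. R (g \<bullet> a) t}"
        by (auto simp: inner)
      finally show "emeasure gauss {g. R (g \<bullet> a) t} = emeasure (gauss :: real measure) {n. R (norm a * n) t}" ..
    qed
    also have "\<dots> = (\<integral>\<^sup>+t. emeasure (gauss :: real measure) {n. R' (n / t)} \<partial>chi p)"
      by (rule nn_integral_cong_AE, use AE_chi_pos in eventually_elim) (simp add: RR)
    also have "\<dots> = emeasure (gauss \<Otimes>\<^sub>M chi p) ((\<lambda>(n, r). n / r) -` {x. R' x} \<inter> space (gauss \<Otimes>\<^sub>M chi p))"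
    proof (subst P1.emeasure_pair_measure_alt2)
      show "(\<lambda>(n, r). n / r) -` {x. R' x} \<inter> space (gauss \<Otimes>\<^sub>M chi p) \<in> sets (gauss \<Otimes>\<^sub>M chi p)"
        by (rule measurable_sets[OF _ R']) measurable
    qed (simp add: space_pair_measure vimage_def)
    also have "\<dots> = emeasure (distr (gauss \<Otimes>\<^sub>M chi p) borel (\<lambda>(n, r). n / r)) {x. R' x}"
      by (rule emeasure_distr[symmetric, OF _ R']) measurable
    finally show ?thesis unfolding distr_gauss_chi_ratio[OF p] .
  qed
  have na: "norm a > 0" using a by simp
  have "emeasure (height_law p) {z. fst z \<bullet> a < snd z} = emeasure (student p) {x. x < 1 / norm a}"
  proof (rule key)
    show "norm a * n < t \<longleftrightarrow> n / t < 1 / norm a" if "0 < t" for n t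
      using na that by (simp add: field_simps)
  qed (intro borel_open open_Collect_less continuous_intros)+
  then show ?A using emeasure_Iio[of "1 / norm a"] by (simp add: lessThan_def)
  have "emeasure (height_law p) {z. snd z < fst z \<bullet> a} = emeasure (student p) {x. 1 / norm a < x}"
  proof (rule key)
    show "t < norm a * n \<longleftrightarrow> 1 / norm a < n / t" if "0 < t" for n t
      using na that by (simp add: field_simps)
  qed (intro borel_open open_Collect_less continuous_intros)+
  then show ?B using emeasure_Ioi[of "1 / norm a"] by (simp add: greaterThan_def)
qed

text \<open>For a fixed horizontal part only one height lies on the hyperplane, and
  \<open>chi p\<close> has no atoms.\<close>

lemma emeasure_height_law_hyperplane:
  fixes a :: "real^'n"
  assumes p: "p > 0"
  shows "emeasure (height_law p) {z. fst z \<bullet> a = snd z} = 0"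
proof -
  interpret G: prob_space "gauss :: (real^'n) measure" by (rule prob_space_gauss)
  interpret C: prob_space "chi p" by (rule prob_space_chi[OF p])
  interpret P: pair_sigma_finite "gauss :: (real^'n) measure" "chi p" ..
  have "closed {z :: (real^'n) \<times> real. fst z \<bullet> a = snd z}"
    by (intro closed_Collect_eq continuous_intros)
  then have "{z :: (real^'n) \<times> real. fst z \<bullet> a = snd z} \<in> sets (gauss \<Otimes>\<^sub>M chi p)"
    using sets_height_law[unfolded height_law_def] borel_closed by blast
  then have "emeasure (height_law p) {z. fst z \<bullet> a = snd z} = (\<integral>\<^sup>+g. emeasure (chi p) {g \<bullet> a} \<partial>gauss)"
    unfolding height_law_def by (subst C.emeasure_pair_measure_alt) (simp_all add: vimage_def)
  then show ?thesis by simp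
qed

section \<open>Integrals over the points that span a hyperplane\<close>

lemma borel_measurable_of_bool:
  assumes "{x \<in> space M. P x} \<in> sets M"
  shows "(\<lambda>x. of_bool (P x) :: ennreal) \<in> borel_measurable M"
proof -
  have "(\<lambda>x. of_bool (P x) :: ennreal) \<in> borel_measurable M \<longleftrightarrow>
      (indicator {x \<in> space M. P x} :: _ \<Rightarrow> ennreal) \<in> borel_measurable M"
    by (rule measurable_cong) (simp add: indicator_def)
  then show ?thesis using borel_measurable_indicator[OF assms] by blast
qed

lemma measurable_family [measurable]:
  fixes e :: "'n::finite \<Rightarrow> 'i"
  assumes e: "range e \<subseteq> N"
  shows "(\<lambda>x. family_matrix x e) \<in> borel_measurable (PiM N (\<lambda>_. height_law p))"
    and "(\<lambda>x. family_heights x e) \<in> borel_measurable (PiM N (\<lambda>_. height_law p))"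
    and "(\<lambda>x. family_normal x e) \<in> borel_measurable (PiM N (\<lambda>_. height_law p))"
proof -
  have c: "(\<lambda>x. x (e i)) \<in> borel_measurable (PiM N (\<lambda>_. height_law p :: ((real^'n) \<times> real) measure))" for i
    using measurable_component_singleton[of "e i" N "\<lambda>_. height_law p :: ((real^'n) \<times> real) measure"] e
    unfolding measurable_cong_sets[OF refl sets_height_law] by blast
  show 1: "(\<lambda>x. family_matrix x e) \<in> borel_measurable (PiM N (\<lambda>_. height_law p))"
    unfolding family_matrix_def by (intro borel_measurable_vec_lambda borel_measurable_fst_comp c)
  show 2: "(\<lambda>x. family_heights x e) \<in> borel_measurable (PiM N (\<lambda>_. height_law p))"
    unfolding family_heights_def by (intro borel_measurable_vec_lambda borel_measurable_snd_comp c)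
  show "(\<lambda>x. family_normal x e) \<in> borel_measurable (PiM N (\<lambda>_. height_law p))"
    unfolding family_normal_def by (rule borel_measurable_solve[OF 1 2])
qed

text \<open>The chosen points are independent copies, and for each of them the horizontal part is
  independent of the height. The heights form the outer integral, so that the Gaussian one can be
  evaluated for a fixed right-hand side of the linear system.\<close>

lemma nn_integral_family:
  fixes h :: "(real^'n^'n) \<times> (real^'n) \<Rightarrow> ennreal" and e :: "'n::finite \<Rightarrow> 'i"
  assumes p: "p > 0" and e: "inj e" "range e \<subseteq> N" and h[measurable]: "h \<in> borel_measurable borel"
  shows "(\<integral>\<^sup>+x. h (family_matrix x e, family_heights x e) \<partial>PiM N (\<lambda>_. height_law p)) =
    (\<integral>\<^sup>+T. (\<integral>\<^sup>+G. h (G, \<chi> i. T i) \<partial>gauss) \<partial>PiM UNIV (\<lambda>_. chi p))"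
proof -
  let ?Q = "height_law p :: ((real^'n) \<times> real) measure"
  let ?GC = "(gauss :: (real^'n) measure) \<Otimes>\<^sub>M chi p"
  interpret G: prob_space "gauss :: (real^'n) measure" by (rule prob_space_gauss)
  interpret C: prob_space "chi p" by (rule prob_space_chi[OF p])
  interpret PG: prob_space "PiM UNIV (\<lambda>_::'n. gauss :: (real^'n) measure)" by (intro prob_space_PiM prob_space_gauss)
  interpret PC: prob_space "PiM UNIV (\<lambda>_::'n. chi p)" by (intro prob_space_PiM prob_space_chi p)
  interpret PP: pair_sigma_finite "PiM UNIV (\<lambda>_::'n. gauss :: (real^'n) measure)" "PiM UNIV (\<lambda>_::'n. chi p)" ..
  define H where "H y = h (\<chi> i. fst (y i), \<chi> i. snd (y i))" for y :: "'n \<Rightarrow> (real^'n) \<times> real"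
  have comp: "(\<lambda>y. y i) \<in> borel_measurable (PiM UNIV (\<lambda>_::'n. ?Q))" for i
    using measurable_component_singleton[of i UNIV "\<lambda>_. ?Q"]
    unfolding measurable_cong_sets[OF refl sets_height_law] by blast
  have Hm: "H \<in> borel_measurable (PiM UNIV (\<lambda>_::'n. ?Q))"
    unfolding H_def
    by (intro measurable_compose[OF _ h] borel_measurable_Pair borel_measurable_vec_lambda
        borel_measurable_fst_comp borel_measurable_snd_comp comp)
  have Hm': "H \<in> borel_measurable (PiM UNIV (\<lambda>_::'n. ?GC))"
    using Hm unfolding height_law_def .
  have "(\<integral>\<^sup>+x. h (family_matrix x e, family_heights x e) \<partial>PiM N (\<lambda>_. ?Q)) =
      (\<integral>\<^sup>+x. H (\<lambda>i\<in>UNIV. x (e i)) \<partial>PiM N (\<lambda>_. ?Q))"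
    by (simp add: H_def family_matrix_def family_heights_def)
  also have "\<dots> = (\<integral>\<^sup>+y. H y \<partial>distr (PiM N (\<lambda>_. ?Q)) (PiM UNIV (\<lambda>_::'n. ?Q)) (\<lambda>x. \<lambda>i\<in>UNIV. x (e i)))"
  proof (rule nn_integral_distr[symmetric])
    show "(\<lambda>x. \<lambda>i\<in>UNIV. x (e i)) \<in> PiM N (\<lambda>_. ?Q) \<rightarrow>\<^sub>M PiM UNIV (\<lambda>_::'n. ?Q)"
      by (rule measurable_restrict, rule measurable_component_singleton) (use e in auto)
  qed (simp add: Hm)
  also have "distr (PiM N (\<lambda>_. ?Q)) (PiM UNIV (\<lambda>_::'n. ?Q)) (\<lambda>x. \<lambda>i\<in>UNIV. x (e i)) = PiM UNIV (\<lambda>_::'n. ?Q)"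
    by (rule distr_PiM_reindex[where M="\<lambda>_. ?Q"]) (use e prob_space_height_law[OF p] in auto)
  also have "(\<integral>\<^sup>+y. H y \<partial>PiM UNIV (\<lambda>_::'n. ?Q)) = (\<integral>\<^sup>+z. H (case z of (x, y) \<Rightarrow> \<lambda>i\<in>UNIV. (x i, y i))
      \<partial>(PiM UNIV (\<lambda>_::'n. gauss :: (real^'n) measure) \<Otimes>\<^sub>M PiM UNIV (\<lambda>_::'n. chi p)))"
  proof -
    have fm: "(\<lambda>(x, y). \<lambda>i\<in>UNIV. (x i, y i)) \<in> PiM UNIV (\<lambda>_::'n. gauss :: (real^'n) measure) \<Otimes>\<^sub>M PiM UNIV (\<lambda>_::'n. chi p)
        \<rightarrow>\<^sub>M PiM UNIV (\<lambda>_. ?GC)"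
      by measurable
    show ?thesis
      unfolding height_law_def
      by (subst PiM_pair_eq_distr[OF prob_space_gauss prob_space_chi[OF p] finite], rule nn_integral_distr[OF fm]) (simp add: Hm')
  qed
  also have "\<dots> = (\<integral>\<^sup>+T. (\<integral>\<^sup>+g. H (case (g, T) of (x, y) \<Rightarrow> \<lambda>i\<in>UNIV. (x i, y i)) \<partial>PiM UNIV (\<lambda>_::'n. gauss)) \<partial>PiM UNIV (\<lambda>_::'n. chi p))"
    by (rule PP.nn_integral_snd[symmetric], rule measurable_compose[OF _ Hm']) measurable
  also have "\<dots> = (\<integral>\<^sup>+T. (\<integral>\<^sup>+G. h (G, \<chi> i. T i) \<partial>gauss) \<partial>PiM UNIV (\<lambda>_. chi p))"
  proof (rule nn_integral_cong)
    fix T :: "'n \<Rightarrow> real"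
    have hm: "(\<lambda>G :: real^'n^'n. h (G, \<chi> i. T i)) \<in> borel_measurable borel"
      by (intro measurable_compose[OF _ h] borel_measurable_Pair) auto
    have vm: "(\<lambda>f. \<chi> i. f i) \<in> PiM UNIV (\<lambda>_::'n. gauss :: (real^'n) measure) \<rightarrow>\<^sub>M borel"
      by measurable
    have "(\<integral>\<^sup>+G. h (G, \<chi> i. T i) \<partial>gauss) = (\<integral>\<^sup>+g. h (\<chi> i. g i, \<chi> i. T i) \<partial>PiM UNIV (\<lambda>_::'n. gauss))"
      by (subst gauss_vec_eq_distr_PiM) (rule nn_integral_distr[OF vm], use hm in simp)
    then show "(\<integral>\<^sup>+g. H (case (g, T) of (x, y) \<Rightarrow> \<lambda>i\<in>UNIV. (x i, y i)) \<partial>PiM UNIV (\<lambda>_::'n. gauss)) = (\<integral>\<^sup>+G. h (G, \<chi> i. T i) \<partial>gauss)"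
      by (simp add: H_def)
  qed
  finally show ?thesis .
qed

lemma AE_family_det_nonzero:
  fixes e :: "'n::finite \<Rightarrow> 'i"
  assumes p: "p > 0" and e: "inj e" "range e \<subseteq> N"
  shows "AE x in PiM N (\<lambda>_. height_law p). det (family_matrix x e) \<noteq> 0"
proof -
  let ?h = "\<lambda>z :: (real^'n^'n) \<times> (real^'n). indicator {0} (det (fst z)) :: ennreal"
  have hm: "?h \<in> borel_measurable borel"
    by (intro measurable_compose[OF borel_measurable_det[OF borel_measurable_fst_comp]]) auto
  have "(\<integral>\<^sup>+x. ?h (family_matrix x e, family_heights x e) \<partial>PiM N (\<lambda>_. height_law p)) =
    (\<integral>\<^sup>+T. (\<integral>\<^sup>+G. ?h (G, \<chi> i. T i) \<partial>gauss) \<partial>PiM UNIV (\<lambda>_. chi p))"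
    by (rule nn_integral_family[OF p e hm])
  also have "\<dots> = (\<integral>\<^sup>+T. 0 \<partial>PiM UNIV (\<lambda>_::'n. chi p))"
  proof (rule nn_integral_cong)
    fix T :: "'n \<Rightarrow> real"
    have "(\<integral>\<^sup>+G. ?h (G, \<chi> i. T i) \<partial>gauss) = (\<integral>\<^sup>+G. 0 \<partial>(gauss :: (real^'n^'n) measure))"
      by (rule nn_integral_cong_AE, use AE_gauss_det_nonzero in eventually_elim) simp
    then show "(\<integral>\<^sup>+G. ?h (G, \<chi> i. T i) \<partial>gauss) = 0" by simp
  qed
  finally have "(\<integral>\<^sup>+x. indicator {0} (det (family_matrix x e)) \<partial>PiM N (\<lambda>_. height_law p)) = 0" by simp
  moreover have "(\<lambda>x. indicator {0} (det (family_matrix x e)) :: ennreal) \<in> borel_measurable (PiM N (\<lambda>_. height_law p))"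
    by (rule measurable_compose[OF borel_measurable_det[OF measurable_family(1)[OF e(2)]]]) simp
  ultimately have "AE x in PiM N (\<lambda>_. height_law p). indicator {0} (det (family_matrix x e)) = (0 :: ennreal)"
    by (simp add: nn_integral_0_iff_AE)
  then show ?thesis by eventually_elim (auto simp: indicator_def split: if_splits)
qed

text \<open>For fixed heights T the norm of the normal is distributed like
  \<open>norm T / \<bar>n\<bar>\<close> by \<open>nn_integral_solve\<close>, and
  \<open>norm T\<close> is chi distributed with \<open>CARD('n) * p\<close> degrees of freedom. So
  the inverse of the norm is the absolute value of a Student variable.\<close>

lemma nn_integral_family_normal:
  fixes \<phi> :: "real \<Rightarrow> ennreal" and e :: "'n::finite \<Rightarrow> 'i"
  assumes p: "p > 0" and e: "inj e" "range e \<subseteq> N" and \<phi>[measurable]: "\<phi> \<in> borel_measurable borel"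
  shows "(\<integral>\<^sup>+x. \<phi> (norm (family_normal x e)) \<partial>PiM N (\<lambda>_. height_law p)) =
    (\<integral>\<^sup>+x. \<phi> (1 / \<bar>x\<bar>) \<partial>student (real CARD('n) * p))"
proof -
  let ?D = "real CARD('n) * p"
  have D: "?D > 0" using p by simp
  interpret G: prob_space "gauss :: real measure" by (rule prob_space_gauss)
  interpret C: prob_space "chi ?D" by (rule prob_space_chi[OF D])
  interpret P: pair_sigma_finite "gauss :: real measure" "chi ?D" ..
  have nm: "(\<lambda>T. norm (\<chi> i. (T i :: real))) \<in> PiM UNIV (\<lambda>_::'n. chi p) \<rightarrow>\<^sub>M borel"
    by measurable
  have "(\<integral>\<^sup>+x. \<phi> (norm (family_normal x e)) \<partial>PiM N (\<lambda>_. height_law p)) =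
      (\<integral>\<^sup>+T. (\<integral>\<^sup>+G. \<phi> (norm (solve G (\<chi> i. T i))) \<partial>gauss) \<partial>PiM UNIV (\<lambda>_::'n. chi p))"
    using nn_integral_family[OF p e, of "\<lambda>z. \<phi> (norm (solve (fst z) (snd z)))"]
    unfolding family_normal_def
    by (simp add: measurable_compose[OF _ \<phi>] measurable_compose[OF _ borel_measurable_norm]
        borel_measurable_solve borel_measurable_fst_comp borel_measurable_snd_comp)
  also have "\<dots> = (\<integral>\<^sup>+T. (\<integral>\<^sup>+n. \<phi> (norm (\<chi> i. T i) / \<bar>n\<bar>) \<partial>gauss) \<partial>PiM UNIV (\<lambda>_::'n. chi p))"
  proof (rule nn_integral_cong_AE)
    have "AE r in distr (PiM UNIV (\<lambda>_::'n. chi p)) borel (\<lambda>T. norm (\<chi> i. T i)). 0 < r"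
      unfolding distr_norm_PiM_chi[OF p] by (rule AE_chi_pos)
    then have "AE T in PiM UNIV (\<lambda>_::'n. chi p). 0 < norm (\<chi> i. T i)"
      by (rule AE_distrD[OF nm])
    then show "AE T in PiM UNIV (\<lambda>_::'n. chi p). (\<integral>\<^sup>+G. \<phi> (norm (solve G (\<chi> i. T i))) \<partial>gauss) = (\<integral>\<^sup>+n. \<phi> (norm (\<chi> i. T i) / \<bar>n\<bar>) \<partial>gauss)"
      by eventually_elim (rule nn_integral_solve[OF \<phi>], simp)
  qed
  also have "\<dots> = (\<integral>\<^sup>+r. (\<integral>\<^sup>+n. \<phi> (r / \<bar>n\<bar>) \<partial>gauss) \<partial>chi ?D)"
  proof -
    have "(\<lambda>r. \<integral>\<^sup>+n. \<phi> (r / \<bar>n\<bar>) \<partial>gauss) \<in> borel_measurable borel"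
      by (rule G.borel_measurable_nn_integral) measurable
    then show ?thesis
      unfolding distr_norm_PiM_chi[OF p, symmetric] by (subst nn_integral_distr[OF nm]) simp_all
  qed
  also have "\<dots> = (\<integral>\<^sup>+z. \<phi> (case z of (n, r) \<Rightarrow> r / \<bar>n\<bar>) \<partial>(gauss \<Otimes>\<^sub>M chi ?D))"
    by (subst P.nn_integral_snd[symmetric]) auto
  also have "\<dots> = (\<integral>\<^sup>+z. \<phi> (1 / \<bar>case z of (n, r) \<Rightarrow> n / r\<bar>) \<partial>(gauss \<Otimes>\<^sub>M chi ?D))"
  proof (rule nn_integral_cong_AE)
    have "AE z in (gauss :: real measure) \<Otimes>\<^sub>M chi ?D. 0 < snd z"
    proof (rule P.AE_pair_measure)
      show "{z \<in> space (gauss \<Otimes>\<^sub>M chi ?D). 0 < snd z} \<in> sets ((gauss :: real measure) \<Otimes>\<^sub>M chi ?D)"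
        by measurable
      show "AE x in (gauss :: real measure). AE r in chi ?D. 0 < snd (x, r)"
        by (simp add: AE_chi_pos)
    qed
    then show "AE z in gauss \<Otimes>\<^sub>M chi ?D. \<phi> (case z of (n, r) \<Rightarrow> r / \<bar>n\<bar>) = \<phi> (1 / \<bar>case z of (n, r) \<Rightarrow> n / r\<bar>)"
      by eventually_elim (auto simp: split_beta)
  qed
  also have "\<dots> = (\<integral>\<^sup>+x. \<phi> (1 / \<bar>x\<bar>) \<partial>student ?D)"
    unfolding distr_gauss_chi_ratio[OF D, symmetric] by (rule nn_integral_distr[symmetric]) measurable
  finally show ?thesis .
qed

lemma AE_family_normal_nonzero:
  fixes e :: "'n::finite \<Rightarrow> 'i"
  assumes p: "p > 0" and e: "inj e" "range e \<subseteq> N"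
  shows "AE x in PiM N (\<lambda>_. height_law p). family_normal x e \<noteq> 0"
proof -
  have "(\<integral>\<^sup>+x. indicator {0} (norm (family_normal x e)) \<partial>PiM N (\<lambda>_. height_law p)) =
      (\<integral>\<^sup>+x. indicator {0} (1 / \<bar>x\<bar>) \<partial>student (real CARD('n) * p))"
    by (rule nn_integral_family_normal[OF p e]) simp
  \<comment> \<open>By the convention for division by 0, \<open>1 / \<bar>x\<bar>\<close> vanishes
    only at \<open>x = 0\<close>, and a single point has no mass.\<close>
  also have "\<dots> = (\<integral>\<^sup>+x. 0 \<partial>student (real CARD('n) * p))"
    by (rule nn_integral_cong_AE, use AE_student_neq[of 0] in eventually_elim) simp
  finally have "(\<integral>\<^sup>+x. indicator {0} (norm (family_normal x e)) \<partial>PiM N (\<lambda>_. height_law p)) = 0" by simp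
  moreover have "(\<lambda>x. indicator {0} (norm (family_normal x e)) :: ennreal) \<in> borel_measurable (PiM N (\<lambda>_. height_law p))"
    by (rule measurable_compose[OF measurable_compose[OF measurable_family(3)[OF e(2)] borel_measurable_norm]]) simp
  ultimately have "AE x in PiM N (\<lambda>_. height_law p). indicator {0} (norm (family_normal x e)) = (0 :: ennreal)"
    by (simp add: nn_integral_0_iff_AE)
  then show ?thesis by eventually_elim (auto simp: indicator_def split: if_splits)
qed

lemma family_normal_cong:
  "(\<And>i. x (e i) = y (e i)) \<Longrightarrow> family_normal x e = family_normal y e"
  by (simp add: family_normal_def family_matrix_def family_heights_def)

section \<open>Conditioning on the points that span the hyperplane\<close>

context
  fixes p :: real and N I :: "'i set" and e :: "'n::finite \<Rightarrow> 'i" and Q :: "((real^'n) \<times> real) measure"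
  assumes p: "p > 0" and N: "finite N" and I: "I \<subseteq> N" and e: "bij_betw e UNIV I"
  defines "Q \<equiv> height_law p"
begin

lemma enumeration_props: "inj e" "range e = I" "range e \<subseteq> N"
  using e I by (auto simp: bij_betw_def)

lemma nn_integral_PiM_split:
  assumes "f \<in> borel_measurable (PiM N (\<lambda>_. Q))"
  shows "(\<integral>\<^sup>+x. f x \<partial>PiM N (\<lambda>_. Q)) =
    (\<integral>\<^sup>+x. (\<integral>\<^sup>+y. f (merge I (N - I) (x, y)) \<partial>PiM (N - I) (\<lambda>_. Q)) \<partial>PiM I (\<lambda>_. Q))"
proof -
  interpret Q: prob_space Q unfolding Q_def by (rule prob_space_height_law[OF p])
  interpret P: product_sigma_finite "\<lambda>_::'i. Q" ..
  have U: "I \<union> (N - I) = N" using I by blast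
  have "I \<inter> (N - I) = {}" "finite I" "finite (N - I)" using N I finite_subset by auto
  from P.product_nn_integral_fold[OF this, of f, unfolded U, OF assms] show ?thesis .
qed

lemma family_normal_measurable: "(\<lambda>x. family_normal x e) \<in> borel_measurable (PiM N (\<lambda>_. Q))"
  unfolding Q_def by (rule measurable_family(3)[OF enumeration_props(3)])

text \<open>Once the points in \<open>I\<close> are fixed, the hyperplane is fixed and the point
  \<open>j\<close> is independent of it, so that \<open>emeasure_height_law_hyperplane\<close>
  applies.\<close>

lemma AE_not_on_hyperplane:
  assumes j: "j \<in> N - I"
  shows "AE x in PiM N (\<lambda>_. Q). fst (x j) \<bullet> family_normal x e \<noteq> snd (x j)"
proof -
  interpret Q: prob_space Q unfolding Q_def by (rule prob_space_height_law[OF p])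
  let ?f = "\<lambda>x. indicator {0} (fst (x j) \<bullet> family_normal x e - snd (x j)) :: ennreal"
  have xj: "(\<lambda>x. x j) \<in> borel_measurable (PiM N (\<lambda>_. Q))"
    using measurable_component_singleton[of j N "\<lambda>_. Q"] j
    unfolding Q_def measurable_cong_sets[OF refl sets_height_law] by blast
  have fm: "?f \<in> borel_measurable (PiM N (\<lambda>_. Q))"
    by (intro measurable_compose[OF borel_measurable_diff[OF borel_measurable_inner[OF borel_measurable_fst_comp[OF xj]
        family_normal_measurable] borel_measurable_snd_comp[OF xj]]]) simp
  have "(\<integral>\<^sup>+x. ?f x \<partial>PiM N (\<lambda>_. Q)) =
    (\<integral>\<^sup>+x. (\<integral>\<^sup>+y. ?f (merge I (N - I) (x, y)) \<partial>PiM (N - I) (\<lambda>_. Q)) \<partial>PiM I (\<lambda>_. Q))"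
    by (rule nn_integral_PiM_split[OF fm])
  also have "\<dots> = (\<integral>\<^sup>+x. 0 \<partial>PiM I (\<lambda>_. Q))"
  proof (rule nn_integral_cong)
    fix x
    define a where "a = family_normal x e"
    have a: "family_normal (merge I (N - I) (x, y)) e = a" for y
      unfolding a_def by (rule family_normal_cong) (use enumeration_props(2) in \<open>auto simp: merge_def\<close>)
    have H: "{z. fst z \<bullet> a = snd z} \<in> sets Q"
      unfolding Q_def sets_height_law by (intro borel_closed closed_Collect_eq continuous_intros)
    have "(\<integral>\<^sup>+y. ?f (merge I (N - I) (x, y)) \<partial>PiM (N - I) (\<lambda>_. Q)) =
        (\<integral>\<^sup>+y. indicator {z. fst z \<bullet> a = snd z} (y j) \<partial>PiM (N - I) (\<lambda>_. Q))"
      unfolding a using j by (intro nn_integral_cong) (auto simp: merge_def indicator_def)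
    also have "\<dots> = (\<integral>\<^sup>+z. indicator {z. fst z \<bullet> a = snd z} z \<partial>distr (PiM (N - I) (\<lambda>_. Q)) Q (\<lambda>y. y j))"
      using j H by (intro nn_integral_distr[symmetric]) (auto intro!: measurable_component_singleton)
    also have "distr (PiM (N - I) (\<lambda>_. Q)) Q (\<lambda>y. y j) = Q"
      using j by (intro distr_PiM_component Q.prob_space_axioms) auto
    also have "(\<integral>\<^sup>+z. indicator {z. fst z \<bullet> a = snd z} z \<partial>Q) = 0"
      using H emeasure_height_law_hyperplane[OF p, of a] by (simp add: Q_def)
    finally show "(\<integral>\<^sup>+y. ?f (merge I (N - I) (x, y)) \<partial>PiM (N - I) (\<lambda>_. Q)) = 0" .
  qed
  finally have "AE x in PiM N (\<lambda>_. Q). ?f x = 0"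
    using fm by (simp add: nn_integral_0_iff_AE)
  then show ?thesis by eventually_elim (auto simp: indicator_def split: if_splits)
qed

text \<open>Given the points in \<open>I\<close>, the others are independent and each lies on the
  chosen side with the same probability, which accounts for the power. The two possible
  \<open>S\<close> share the argument; the mass is written through \<open>1 / norm a\<close> because
  that quantity has the law of \<open>\<bar>x\<bar>\<close> for a Student variable x.\<close>

lemma nn_integral_side:
  fixes S :: "real^'n \<Rightarrow> ((real^'n) \<times> real) set" and w :: "real \<Rightarrow> real"
  assumes S: "S = (\<lambda>a. {z. fst z \<bullet> a < snd z}) \<or> S = (\<lambda>a. {z. snd z < fst z \<bullet> a})"
    and w: "\<And>a. a \<noteq> 0 \<Longrightarrow> emeasure Q (S a) = ennreal (w (1 / norm a))" "\<And>y. 0 \<le> w y"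
    and w_m[measurable]: "w \<in> borel_measurable borel"
  shows "{x \<in> space (PiM N (\<lambda>_. Q)). \<forall>j\<in>N - I. x j \<in> S (family_normal x e)} \<in> sets (PiM N (\<lambda>_. Q))"
    and "(\<integral>\<^sup>+x. of_bool (\<forall>j\<in>N - I. x j \<in> S (family_normal x e)) \<partial>PiM N (\<lambda>_. Q)) =
      (\<integral>\<^sup>+x. ennreal (w \<bar>x\<bar> ^ card (N - I)) \<partial>student (real CARD('n) * p))"
proof -
  interpret Q: prob_space Q unfolding Q_def by (rule prob_space_height_law[OF p])
  interpret P: product_sigma_finite "\<lambda>_::'i. Q" ..
  have xj: "(\<lambda>x. x j) \<in> borel_measurable (PiM N (\<lambda>_. Q))" if "j \<in> N" for j
    using measurable_component_singleton[of j N "\<lambda>_. Q"] that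
    unfolding Q_def measurable_cong_sets[OF refl sets_height_law] by blast
  note nm = family_normal_measurable
  have in_m: "{x \<in> space (PiM N (\<lambda>_. Q)). x j \<in> S (family_normal x e)} \<in> sets (PiM N (\<lambda>_. Q))" if "j \<in> N" for j
  proof -
    note [measurable] = borel_measurable_inner[OF borel_measurable_fst_comp[OF xj[OF that]] nm]
      borel_measurable_snd_comp[OF xj[OF that]]
    from S show ?thesis
    proof
      assume "S = (\<lambda>a. {z. fst z \<bullet> a < snd z})"
      then show ?thesis by simp
    next
      assume "S = (\<lambda>a. {z. snd z < fst z \<bullet> a})"
      then show ?thesis by simp
    qed
  qed
  show sets: "{x \<in> space (PiM N (\<lambda>_. Q)). \<forall>j\<in>N - I. x j \<in> S (family_normal x e)} \<in> sets (PiM N (\<lambda>_. Q))"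
    by (rule sets.sets_Collect_finite_All) (use N in_m in auto)
  let ?f = "\<lambda>x. of_bool (\<forall>j\<in>N - I. x j \<in> S (family_normal x e)) :: ennreal"
  have fm: "?f \<in> borel_measurable (PiM N (\<lambda>_. Q))"
    by (rule borel_measurable_of_bool[OF sets])
  have Sm: "S a \<in> sets Q" for a
    unfolding Q_def sets_height_law
    using S by (auto intro!: borel_open open_Collect_less continuous_intros)
  have "(\<integral>\<^sup>+x. ?f x \<partial>PiM N (\<lambda>_. Q)) =
    (\<integral>\<^sup>+x. (\<integral>\<^sup>+y. ?f (merge I (N - I) (x, y)) \<partial>PiM (N - I) (\<lambda>_. Q)) \<partial>PiM I (\<lambda>_. Q))"
    by (rule nn_integral_PiM_split[OF fm])
  also have "\<dots> = (\<integral>\<^sup>+x. emeasure Q (S (family_normal x e)) ^ card (N - I) \<partial>PiM I (\<lambda>_. Q))"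
  proof (rule nn_integral_cong)
    fix x
    define a where "a = family_normal x e"
    have a: "family_normal (merge I (N - I) (x, y)) e = a" for y
      unfolding a_def by (rule family_normal_cong) (use enumeration_props(2) in \<open>auto simp: merge_def\<close>)
    have "(\<integral>\<^sup>+y. ?f (merge I (N - I) (x, y)) \<partial>PiM (N - I) (\<lambda>_. Q)) =
        (\<integral>\<^sup>+y. indicator (\<Pi>\<^sub>E j\<in>N - I. S a) y \<partial>PiM (N - I) (\<lambda>_. Q))"
      unfolding a by (intro nn_integral_cong) (auto simp: merge_def indicator_def PiE_iff space_PiM)
    also have "\<dots> = emeasure (PiM (N - I) (\<lambda>_. Q)) (\<Pi>\<^sub>E j\<in>N - I. S a)"
      using N Sm by (intro nn_integral_indicator sets_PiM_I_finite) auto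
    also have "\<dots> = (\<Prod>j\<in>N - I. emeasure Q (S a))"
      using N Sm by (intro P.emeasure_PiM) auto
    finally show "(\<integral>\<^sup>+y. ?f (merge I (N - I) (x, y)) \<partial>PiM (N - I) (\<lambda>_. Q)) = emeasure Q (S (family_normal x e)) ^ card (N - I)"
      by (simp add: a_def)
  qed
  also have "\<dots> = (\<integral>\<^sup>+x. ennreal (w (1 / norm (family_normal x e)) ^ card (N - I)) \<partial>PiM I (\<lambda>_. Q))"
  proof (rule nn_integral_cong_AE)
    have "AE x in PiM I (\<lambda>_. Q). family_normal x e \<noteq> 0"
      unfolding Q_def by (rule AE_family_normal_nonzero[OF p]) (use enumeration_props in auto)
    then show "AE x in PiM I (\<lambda>_. Q). emeasure Q (S (family_normal x e)) ^ card (N - I) =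
        ennreal (w (1 / norm (family_normal x e)) ^ card (N - I))"
      by eventually_elim (simp add: w ennreal_power)
  qed
  also have "\<dots> = (\<integral>\<^sup>+x. ennreal (w (1 / (1 / \<bar>x\<bar>)) ^ card (N - I)) \<partial>student (real CARD('n) * p))"
    unfolding Q_def by (rule nn_integral_family_normal[OF p, of e I "\<lambda>\<rho>. ennreal (w (1 / \<rho>) ^ card (N - I))"])
      (use enumeration_props in auto)
  finally show "(\<integral>\<^sup>+x. ?f x \<partial>PiM N (\<lambda>_. Q)) = (\<integral>\<^sup>+x. ennreal (w \<bar>x\<bar> ^ card (N - I)) \<partial>student (real CARD('n) * p))"
    by simp
qed

text \<open>The sides have masses \<open>V \<bar>x\<bar>\<close> and
  \<open>1 - V \<bar>x\<bar> = V (- \<bar>x\<bar>)\<close>. The sum of their powers is that of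
  \<open>V x\<close> and \<open>V (- x)\<close> whatever the sign of x, and the symmetry of
  Student's law makes the two integrals equal.\<close>

lemma nn_integral_both_sides:
  shows "(\<lambda>x. of_bool (\<forall>j\<in>N - I. fst (x j) \<bullet> family_normal x e < snd (x j)) +
      of_bool (\<forall>j\<in>N - I. snd (x j) < fst (x j) \<bullet> family_normal x e) :: ennreal)
      \<in> borel_measurable (PiM N (\<lambda>_. Q))"
    and "(\<integral>\<^sup>+x. of_bool (\<forall>j\<in>N - I. fst (x j) \<bullet> family_normal x e < snd (x j)) +
      of_bool (\<forall>j\<in>N - I. snd (x j) < fst (x j) \<bullet> family_normal x e) \<partial>PiM N (\<lambda>_. Q)) =
    2 * (\<integral>\<^sup>+x. ennreal (student_cdf p x ^ card (N - I)) \<partial>student (real CARD('n) * p))"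
proof -
  interpret S: student_space p by standard (rule p)
  let ?k = "card (N - I)" and ?D = "real CARD('n) * p"
  let ?S1 = "\<lambda>a::real^'n. {z. fst z \<bullet> a < snd z}" and ?S2 = "\<lambda>a::real^'n. {z. snd z < fst z \<bullet> a}"
  have v1: "emeasure Q (?S1 a) = ennreal (student_cdf p (1 / norm a))" if "a \<noteq> 0" for a
    unfolding Q_def by (rule S.emeasure_height_law_sides(1)[OF that])
  have v2: "emeasure Q (?S2 a) = ennreal (1 - student_cdf p (1 / norm a))" if "a \<noteq> 0" for a
    unfolding Q_def by (rule S.emeasure_height_law_sides(2)[OF that])
  note s1 = nn_integral_side[OF disjI1[OF refl] v1 S.student_cdf_nonneg S.student_cdf_measurable]
  have w2: "0 \<le> 1 - student_cdf p y" for y using S.student_cdf_le_1[of y] by simp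
  have w2m: "(\<lambda>y. 1 - student_cdf p y) \<in> borel_measurable borel" using S.student_cdf_measurable by measurable
  note s2 = nn_integral_side[of ?S2 "\<lambda>y. 1 - student_cdf p y", OF disjI2[OF refl] v2 w2 w2m]
  show "(\<lambda>x. of_bool (\<forall>j\<in>N - I. fst (x j) \<bullet> family_normal x e < snd (x j)) +
      of_bool (\<forall>j\<in>N - I. snd (x j) < fst (x j) \<bullet> family_normal x e) :: ennreal)
      \<in> borel_measurable (PiM N (\<lambda>_. Q))"
    using borel_measurable_add[OF borel_measurable_of_bool[OF s1(1)] borel_measurable_of_bool[OF s2(1)]] by simp
  have cm: "(\<lambda>x. ennreal (student_cdf p x ^ ?k)) \<in> borel_measurable borel"
    using S.student_cdf_measurable by measurable
  have "(\<integral>\<^sup>+x. of_bool (\<forall>j\<in>N - I. fst (x j) \<bullet> family_normal x e < snd (x j)) +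
      of_bool (\<forall>j\<in>N - I. snd (x j) < fst (x j) \<bullet> family_normal x e) \<partial>PiM N (\<lambda>_. Q)) =
    (\<integral>\<^sup>+x. of_bool (\<forall>j\<in>N - I. x j \<in> ?S1 (family_normal x e)) \<partial>PiM N (\<lambda>_. Q)) +
    (\<integral>\<^sup>+x. of_bool (\<forall>j\<in>N - I. x j \<in> ?S2 (family_normal x e)) \<partial>PiM N (\<lambda>_. Q))"
    using nn_integral_add[OF borel_measurable_of_bool[OF s1(1)] borel_measurable_of_bool[OF s2(1)]] by simp
  also have "\<dots> = (\<integral>\<^sup>+x. ennreal (student_cdf p \<bar>x\<bar> ^ ?k) \<partial>student ?D) + (\<integral>\<^sup>+x. ennreal ((1 - student_cdf p \<bar>x\<bar>) ^ ?k) \<partial>student ?D)"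
    by (subst s1(2), simp, subst s2(2)) simp_all
  also have "\<dots> = (\<integral>\<^sup>+x. ennreal (student_cdf p \<bar>x\<bar> ^ ?k) + ennreal ((1 - student_cdf p \<bar>x\<bar>) ^ ?k) \<partial>student ?D)"
    using S.student_cdf_measurable by (intro nn_integral_add[symmetric]) measurable
  also have "\<dots> = (\<integral>\<^sup>+x. ennreal (student_cdf p x ^ ?k) + ennreal (student_cdf p (- x) ^ ?k) \<partial>student ?D)"
    by (intro nn_integral_cong) (auto simp: abs_if S.student_cdf_minus add.commute)
  also have "\<dots> = (\<integral>\<^sup>+x. ennreal (student_cdf p x ^ ?k) \<partial>student ?D) + (\<integral>\<^sup>+x. ennreal (student_cdf p (- x) ^ ?k) \<partial>student ?D)"
    using S.student_cdf_measurable by (intro nn_integral_add) measurable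
  also have "(\<integral>\<^sup>+x. ennreal (student_cdf p (- x) ^ ?k) \<partial>student ?D) = (\<integral>\<^sup>+x. ennreal (student_cdf p x ^ ?k) \<partial>distr (student ?D) borel uminus)"
    by (rule nn_integral_distr[symmetric]) (use cm in auto)
  also have "\<dots> = (\<integral>\<^sup>+x. ennreal (student_cdf p x ^ ?k) \<partial>student ?D)" unfolding distr_student_uminus ..
  finally show "(\<integral>\<^sup>+x. of_bool (\<forall>j\<in>N - I. fst (x j) \<bullet> family_normal x e < snd (x j)) +
      of_bool (\<forall>j\<in>N - I. snd (x j) < fst (x j) \<bullet> family_normal x e) \<partial>PiM N (\<lambda>_. Q)) =
    2 * (\<integral>\<^sup>+x. ennreal (student_cdf p x ^ card (N - I)) \<partial>student (real CARD('n) * p))"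
    by (simp add: mult_2)
qed

end

section \<open>Expected facet numbers\<close>

lemma borel_measurable_card_facet_pattern:
  fixes X :: "'i \<Rightarrow> 'w \<Rightarrow> 'a::euclidean_space"
  assumes N: "finite N" and X: "\<And>i. i \<in> N \<Longrightarrow> X i \<in> borel_measurable M"
  shows "(\<lambda>\<omega>. real (card {B. facet_pattern (\<lambda>i. X i \<omega>) N B})) \<in> borel_measurable M"
proof -
  have "real (card {B. facet_pattern (\<lambda>i. X i \<omega>) N B}) =
      (\<Sum>B\<in>Pow N. indicator {\<omega> \<in> space M. facet_pattern (\<lambda>i. X i \<omega>) N B} \<omega>)" if "\<omega> \<in> space M" for \<omega>
  proof -
    have "{B. facet_pattern (\<lambda>i. X i \<omega>) N B} = Pow N \<inter> {B. facet_pattern (\<lambda>i. X i \<omega>) N B}"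
      by (auto simp: facet_pattern_def)
    then have "real (card {B. facet_pattern (\<lambda>i. X i \<omega>) N B}) = (\<Sum>B\<in>Pow N. of_bool (facet_pattern (\<lambda>i. X i \<omega>) N B))"
      using N by simp
    then show ?thesis using that by (simp add: indicator_def)
  qed
  moreover have "(\<lambda>\<omega>. \<Sum>B\<in>Pow N. indicator {\<omega> \<in> space M. facet_pattern (\<lambda>i. X i \<omega>) N B} \<omega> :: real) \<in> borel_measurable M"
    by (intro borel_measurable_sum borel_measurable_indicator sets_facet_pattern N X)
  ultimately show ?thesis
    by (simp cong: measurable_cong)
qed

lemma AE_height_law_pos:
  assumes "p > 0"
  shows "AE z in (height_law p :: ((real^'n) \<times> real) measure). 0 < snd z"
proof -
  obtain c where "c > 0" and Q: "(height_law p :: ((real^'n) \<times> real) measure) =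
    density lborel (\<lambda>z. ennreal c * ennreal (indicator {z. 0 < snd z} z * snd z powr (p - 1) * exp (- (norm z)\<^sup>2 / 2)))"
    using height_law_eq_density[OF assms] by blast
  show ?thesis unfolding Q by (subst AE_density) (auto simp: indicator_def intro!: AE_I2)
qed

text \<open>Finitely many almost sure conditions put the points in general position for all
  \<open>I\<close> at once.\<close>

lemma AE_card_facet_pattern:
  fixes N :: "'i set"
  assumes p: "p > 0" and N: "finite N" "CARD('n) < card N"
    and e: "\<And>I. I \<subseteq> N \<Longrightarrow> card I = CARD('n) \<Longrightarrow> bij_betw (e I) (UNIV :: 'n::finite set) I"
  shows "AE x in PiM N (\<lambda>_. height_law p :: ((real^'n) \<times> real) measure).
    card {B. facet_pattern x N B} = (\<Sum>I | I \<subseteq> N \<and> card I = CARD('n).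
      of_bool (\<forall>j\<in>N - I. fst (x j) \<bullet> family_normal x (e I) < snd (x j)) +
      of_bool (\<forall>j\<in>N - I. snd (x j) < fst (x j) \<bullet> family_normal x (e I)))"
proof -
  let ?\<S> = "{I. I \<subseteq> N \<and> card I = CARD('n)}"
  let ?P = "PiM N (\<lambda>_. height_law p :: ((real^'n) \<times> real) measure)"
  have fin: "finite ?\<S>" using N by simp
  have "AE x in ?P. \<forall>I\<in>?\<S>. det (family_matrix x (e I)) \<noteq> 0"
  proof (rule AE_finite_allI[OF fin])
    fix I assume "I \<in> ?\<S>"
    then have "bij_betw (e I) UNIV I" "I \<subseteq> N" using e by auto
    then show "AE x in ?P. det (family_matrix x (e I)) \<noteq> 0"
      by (intro AE_family_det_nonzero[OF p]) (auto simp: bij_betw_def)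
  qed
  moreover have "AE x in ?P. \<forall>I\<in>?\<S>. \<forall>j\<in>N - I. fst (x j) \<bullet> family_normal x (e I) \<noteq> snd (x j)"
  proof (rule AE_finite_allI[OF fin])
    fix I assume I: "I \<in> ?\<S>"
    have "finite (N - I)" using N by simp
    then show "AE x in ?P. \<forall>j\<in>N - I. fst (x j) \<bullet> family_normal x (e I) \<noteq> snd (x j)"
    proof (rule AE_finite_allI)
      fix j assume j: "j \<in> N - I"
      show "AE x in ?P. fst (x j) \<bullet> family_normal x (e I) \<noteq> snd (x j)"
        by (rule AE_not_on_hyperplane[OF p N(1) _ _ j]) (use I e in auto)
    qed
  qed
  ultimately show ?thesis
  proof eventually_elim
    case (elim x)
    show ?case
    proof (rule card_facet_pattern_generic[OF N])
      show "range (e I) = I" if "I \<subseteq> N" "card I = CARD('n)" for I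
        using e[OF that] by (simp add: bij_betw_def)
    qed (use elim in blast)+
  qed
qed

text \<open>All subsets of size \<open>CARD('n)\<close> contribute the same expectation, so
  linearity yields the binomial coefficient.\<close>

lemma nn_integral_card_facet_pattern:
  fixes N :: "'i set"
  assumes p: "p > 0" and N: "finite N" "CARD('n::finite) < card N"
  shows "(\<integral>\<^sup>+x. ennreal (real (card {B. facet_pattern x N B})) \<partial>PiM N (\<lambda>_. height_law p :: ((real^'n) \<times> real) measure)) =
    of_nat (card N choose CARD('n)) * (2 * (\<integral>\<^sup>+x. ennreal (student_cdf p x ^ (card N - CARD('n))) \<partial>student (real CARD('n) * p)))"
proof -
  let ?\<S> = "{I. I \<subseteq> N \<and> card I = CARD('n)}"
  let ?P = "PiM N (\<lambda>_. height_law p :: ((real^'n) \<times> real) measure)"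
  have "\<exists>e. bij_betw e (UNIV :: 'n set) I" if "I \<subseteq> N" "card I = CARD('n)" for I
    using that N(1) finite_subset by (intro finite_same_card_bij) auto
  then obtain e where e: "\<And>I. I \<subseteq> N \<Longrightarrow> card I = CARD('n) \<Longrightarrow> bij_betw (e I) (UNIV :: 'n set) I"
    by metis
  define s :: "'i set \<Rightarrow> ('i \<Rightarrow> (real^'n) \<times> real) \<Rightarrow> ennreal" where
    "s I x = of_bool (\<forall>j\<in>N - I. fst (x j) \<bullet> family_normal x (e I) < snd (x j)) +
      of_bool (\<forall>j\<in>N - I. snd (x j) < fst (x j) \<bullet> family_normal x (e I))" for I x
  have AE: "AE x in ?P. card {B. facet_pattern x N B} = (\<Sum>I\<in>?\<S>.
      of_bool (\<forall>j\<in>N - I. fst (x j) \<bullet> family_normal x (e I) < snd (x j)) +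
      of_bool (\<forall>j\<in>N - I. snd (x j) < fst (x j) \<bullet> family_normal x (e I)))"
    by (rule AE_card_facet_pattern[OF p N]) (rule e)
  have "(\<integral>\<^sup>+x. ennreal (real (card {B. facet_pattern x N B})) \<partial>?P) = (\<integral>\<^sup>+x. (\<Sum>I\<in>?\<S>. s I x) \<partial>?P)"
  proof (rule nn_integral_cong_AE, use AE in eventually_elim)
    case (elim x)
    have "ennreal (real (card {B. facet_pattern x N B})) = of_nat (card {B. facet_pattern x N B})"
      by (rule ennreal_of_nat_eq_real_of_nat[symmetric])
    then show ?case unfolding elim s_def by simp
  qed
  also have "\<dots> = (\<Sum>I\<in>?\<S>. \<integral>\<^sup>+x. s I x \<partial>?P)"
  proof (rule nn_integral_sum)
    fix I assume "I \<in> ?\<S>"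
    then show "s I \<in> borel_measurable ?P"
      unfolding s_def by (intro nn_integral_both_sides(1)[OF p N(1)] e) auto
  qed
  also have "\<dots> = (\<Sum>I\<in>?\<S>. 2 * (\<integral>\<^sup>+x. ennreal (student_cdf p x ^ (card N - CARD('n))) \<partial>student (real CARD('n) * p)))"
  proof (rule sum.cong[OF refl])
    fix I assume I: "I \<in> ?\<S>"
    then have "card (N - I) = card N - CARD('n)"
      using N(1) by (auto simp: card_Diff_subset finite_subset)
    then show "(\<integral>\<^sup>+x. s I x \<partial>?P) = 2 * (\<integral>\<^sup>+x. ennreal (student_cdf p x ^ (card N - CARD('n))) \<partial>student (real CARD('n) * p))"
      unfolding s_def using I nn_integral_both_sides(2)[OF p N(1) _ e[of I]] by simp
  qed
  also have "\<dots> = of_nat (card N choose CARD('n)) * (2 * (\<integral>\<^sup>+x. ennreal (student_cdf p x ^ (card N - CARD('n))) \<partial>student (real CARD('n) * p)))"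
    using N(1) by (simp add: n_subsets)
  finally show ?thesis .
qed

lemma facet_pattern_to_half_sphere:
  assumes "\<And>i. i \<in> N \<Longrightarrow> 0 < snd (x i)"
  shows "facet_pattern (compose N to_half_sphere x) N B \<longleftrightarrow> facet_pattern x N B"
proof -
  have "facet_pattern (compose N to_half_sphere x) N B \<longleftrightarrow> facet_pattern (\<lambda>i. (1 / norm (x i)) *\<^sub>R x i) N B"
    by (rule facet_pattern_cong) (simp add: compose_def to_half_sphere_scale(1)[OF assms])
  also have "\<dots> \<longleftrightarrow> facet_pattern x N B"
    by (rule facet_pattern_scale) (rule to_half_sphere_scale(2)[OF assms])
  finally show ?thesis .
qed

text \<open>The expectation is transported twice: from \<open>M\<close> to the product law on the
  half-sphere, and from there to the product of height laws, where the facet count is unchanged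
  because patterns ignore positive factors.\<close>

lemma expectation_f_number:
  fixes M :: "'w measure" and X :: "nat \<Rightarrow> 'w \<Rightarrow> (real^'d) \<times> real"
  assumes n: "CARD('d) < n" and \<alpha>: "\<alpha> > -1" and M: "prob_space M"
    and indep: "prob_space.indep_vars M (\<lambda>_. spherical_lebesgue) X {1..n}"
    and X: "\<And>i. i \<in> {1..n} \<Longrightarrow>
           distributed M spherical_lebesgue (X i) (\<lambda>y. ennreal (spherical_density \<alpha> y))"
  shows "prob_space.expectation M (\<lambda>\<omega>. real (f_number (CARD('d) - 1) (spherical_hull ((\<lambda>i. X i \<omega>) ` {1..n})))) =
    real (n choose CARD('d)) * (2 * (\<integral>x. student_cdf (\<alpha> + 1) x ^ (n - CARD('d)) \<partial>student (real CARD('d) * (\<alpha> + 1))))"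
proof -
  interpret M: prob_space M by fact
  define N where "N = {1..n}"
  have N: "finite N" "card N = n" "N \<noteq> {}" using n by (auto simp: N_def)
  define p where "p = \<alpha> + 1"
  have p: "p > 0" using \<alpha> by (simp add: p_def)
  let ?SL = "spherical_lebesgue :: ((real^'d) \<times> real) measure"
  let ?Q = "height_law p :: ((real^'d) \<times> real) measure"
  define P where "P = distr ?Q ?SL to_half_sphere"
  interpret Q: prob_space ?Q by (rule prob_space_height_law[OF p])
  have th: "to_half_sphere \<in> ?Q \<rightarrow>\<^sub>M ?SL"
    unfolding measurable_cong_sets[OF sets_height_law refl] by (rule to_half_sphere_measurable)
  interpret P: prob_space P unfolding P_def by (rule Q.prob_space_distr[OF th])
  have sP: "sets P = sets ?SL" by (simp add: P_def)
  have th': "to_half_sphere \<in> ?Q \<rightarrow>\<^sub>M P"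
    using th unfolding measurable_cong_sets[OF refl sP] .
  have Xm: "X i \<in> M \<rightarrow>\<^sub>M ?SL" if "i \<in> N" for i
    using X[of i] that by (intro distributed_measurable) (simp add: N_def)
  \<comment> \<open>Cut off outside \<open>N\<close>, since the elements of a product space over
    \<open>N\<close> take a fixed value there.\<close>
  define Y where "Y \<omega> = (\<lambda>i\<in>N. X i \<omega>)" for \<omega>
  have Ym: "Y \<in> M \<rightarrow>\<^sub>M PiM N (\<lambda>_. P)"
    unfolding Y_def by (rule measurable_restrict) (use Xm measurable_cong_sets[OF refl sP] in blast)
  have "distr M (PiM N (\<lambda>_. ?SL)) Y = PiM N (\<lambda>i. distr M ?SL (X i))"
    using indep unfolding Y_def N_def
    by (subst (asm) M.indep_vars_iff_distr_eq_PiM') (use N Xm in \<open>auto simp: N_def\<close>)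
  also have "\<dots> = PiM N (\<lambda>_. P)"
    unfolding P_def p_def by (intro PiM_cong refl spherical_law[OF \<alpha> M X]) (simp add: N_def)
  finally have "distr M (PiM N (\<lambda>_. ?SL)) Y = PiM N (\<lambda>_. P)" .
  moreover have "distr M (PiM N (\<lambda>_. ?SL)) Y = distr M (PiM N (\<lambda>_. P)) Y"
    by (rule distr_cong) (auto intro!: sets_PiM_cong simp: sP)
  ultimately have lawY: "distr M (PiM N (\<lambda>_. P)) Y = PiM N (\<lambda>_. P)" by simp
  have "distr ?Q P to_half_sphere = P"
    unfolding P_def by (rule distr_cong) auto
  then have lawQ: "distr (PiM N (\<lambda>_. ?Q)) (PiM N (\<lambda>_. P)) (compose N to_half_sphere) = PiM N (\<lambda>_. P)"
    using distr_PiM_finite_prob_space'[of N "\<lambda>_. ?Q" "\<lambda>_. P" to_half_sphere] N(1) th'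
      Q.prob_space_axioms P.prob_space_axioms by simp
  have cm: "compose N to_half_sphere \<in> PiM N (\<lambda>_. ?Q) \<rightarrow>\<^sub>M PiM N (\<lambda>_. P)"
    unfolding compose_def
  proof (rule measurable_restrict)
    fix i assume "i \<in> N"
    then have "(\<lambda>x. x i) \<in> PiM N (\<lambda>_. ?Q) \<rightarrow>\<^sub>M ?Q" by (rule measurable_component_singleton)
    then show "(\<lambda>x. to_half_sphere (x i)) \<in> PiM N (\<lambda>_. ?Q) \<rightarrow>\<^sub>M P"
      by (rule measurable_compose[OF _ th'])
  qed
  define F where "F y = real (card {B. facet_pattern y N B})" for y :: "nat \<Rightarrow> (real^'d) \<times> real"
  have FmP: "F \<in> borel_measurable (PiM N (\<lambda>_. P))"
    unfolding F_def
  proof (rule borel_measurable_card_facet_pattern[OF N(1)])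
    fix i assume "i \<in> N"
    then have "(\<lambda>y. y i) \<in> PiM N (\<lambda>_. P) \<rightarrow>\<^sub>M ?SL"
      using measurable_component_singleton[of i N "\<lambda>_. P"] unfolding measurable_cong_sets[OF refl sP] by blast
    then show "(\<lambda>y. y i) \<in> borel_measurable (PiM N (\<lambda>_. P))"
      by (rule measurable_compose[OF _ measurable_spherical_lebesgue_borel])
  qed
  have FmQ: "F \<in> borel_measurable (PiM N (\<lambda>_. ?Q))"
    unfolding F_def
  proof (rule borel_measurable_card_facet_pattern[OF N(1)])
    fix i assume "i \<in> N"
    then show "(\<lambda>y. y i) \<in> borel_measurable (PiM N (\<lambda>_. ?Q))"
      using measurable_component_singleton[of i N "\<lambda>_. ?Q"]
      unfolding measurable_cong_sets[OF refl sets_height_law] by blast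
  qed
  have "prob_space.expectation M (\<lambda>\<omega>. real (f_number (CARD('d) - 1) (spherical_hull ((\<lambda>i. X i \<omega>) ` {1..n})))) =
     (\<integral>\<omega>. F (Y \<omega>) \<partial>M)"
  proof (rule Bochner_Integration.integral_cong[OF refl])
    fix \<omega> assume \<omega>: "\<omega> \<in> space M"
    have "norm (X i \<omega>) = 1" if "i \<in> N" for i
      using measurable_space[OF Xm[OF that] \<omega>] by (simp add: half_sphere_def)
    then have "f_number (CARD('d) - 1) (spherical_hull ((\<lambda>i. X i \<omega>) ` N)) = card {B. facet_pattern (\<lambda>i. X i \<omega>) N B}"
      by (intro f_number_spherical_hull N) (simp_all add: Suc_le_eq)
    also have "\<dots> = card {B. facet_pattern (Y \<omega>) N B}"
      by (intro arg_cong[where f=card] Collect_cong facet_pattern_cong) (simp add: Y_def)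
    finally show "real (f_number (CARD('d) - 1) (spherical_hull ((\<lambda>i. X i \<omega>) ` {1..n}))) = F (Y \<omega>)"
      by (simp add: F_def N_def)
  qed
  also have "\<dots> = (\<integral>y. F y \<partial>PiM N (\<lambda>_. P))"
    using integral_distr[OF Ym FmP] unfolding lawY by (rule sym)
  also have "\<dots> = (\<integral>x. F (compose N to_half_sphere x) \<partial>PiM N (\<lambda>_. ?Q))"
    using integral_distr[OF cm FmP] unfolding lawQ .
  also have "\<dots> = (\<integral>x. F x \<partial>PiM N (\<lambda>_. ?Q))"
  proof (rule integral_cong_AE)
    show "(\<lambda>x. F (compose N to_half_sphere x)) \<in> borel_measurable (PiM N (\<lambda>_. ?Q))"
      by (rule measurable_compose[OF cm FmP])
    have "AE x in PiM N (\<lambda>_. ?Q). \<forall>i\<in>N. 0 < snd (x i)"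
    proof (rule AE_finite_allI[OF N(1)])
      fix i assume "i \<in> N"
      then show "AE x in PiM N (\<lambda>_. ?Q). 0 < snd (x i)"
        by (rule AE_PiM_component[OF Q.prob_space_axioms _ AE_height_law_pos[OF p]])
    qed
    then show "AE x in PiM N (\<lambda>_. ?Q). F (compose N to_half_sphere x) = F x"
      by eventually_elim (simp add: F_def facet_pattern_to_half_sphere)
  qed (rule FmQ)
  also have "\<dots> = enn2real (\<integral>\<^sup>+x. ennreal (F x) \<partial>PiM N (\<lambda>_. ?Q))"
    by (rule integral_eq_nn_integral[OF FmQ]) (simp add: F_def)
  also have "(\<integral>\<^sup>+x. ennreal (F x) \<partial>PiM N (\<lambda>_. ?Q)) =
      of_nat (n choose CARD('d)) * (2 * (\<integral>\<^sup>+x. ennreal (student_cdf p x ^ (n - CARD('d))) \<partial>student (real CARD('d) * p)))"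
    using nn_integral_card_facet_pattern[OF p N(1), where 'n='d] n N(2) by (simp add: F_def)
  also have "(\<integral>\<^sup>+x. ennreal (student_cdf p x ^ (n - CARD('d))) \<partial>student (real CARD('d) * p)) =
      ennreal (\<integral>x. student_cdf p x ^ (n - CARD('d)) \<partial>student (real CARD('d) * p))"
  proof (rule nn_integral_eq_integral)
    interpret S: student_space p by standard (rule p)
    interpret D: student_space "real CARD('d) * p" by standard (use p in simp)
    have "student_cdf p \<in> borel_measurable (student (real CARD('d) * p))"
      using S.student_cdf_measurable by simp
    then show "integrable (student (real CARD('d) * p)) (\<lambda>x. student_cdf p x ^ (n - CARD('d)))"
      by (intro D.integrable_const_bound[where B=1])
        (auto simp: power_le_one S.student_cdf_nonneg S.student_cdf_le_1)
    show "AE x in student (real CARD('d) * p). 0 \<le> student_cdf p x ^ (n - CARD('d))"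
      by (simp add: S.student_cdf_nonneg)
  qed
  also have "enn2real (of_nat (n choose CARD('d)) * (2 * ennreal (\<integral>x. student_cdf p x ^ (n - CARD('d)) \<partial>student (real CARD('d) * p))))
    = real (n choose CARD('d)) * (2 * (\<integral>x. student_cdf p x ^ (n - CARD('d)) \<partial>student (real CARD('d) * p)))"
  proof -
    interpret S: student_space p by standard (rule p)
    have "0 \<le> (\<integral>x. student_cdf p x ^ (n - CARD('d)) \<partial>student (real CARD('d) * p))"
      by (rule Bochner_Integration.integral_nonneg) (simp add: S.student_cdf_nonneg)
    then show ?thesis by (simp add: enn2real_mult)
  qed
  finally show ?thesis by (simp add: p_def)
qed

text \<open>With \<open>\<alpha> = p - 1\<close> the weight of \<open>moment_inequality\<close> is
  the unnormalised Student density with \<open>d * p\<close> degrees of freedom; its constant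
  cancels.\<close>

lemma student_moment_inequality:
  assumes p: "p > 0" and k: "k \<ge> 1" and d: "d \<ge> 2"
  shows "real k * (\<integral>x. student_cdf p x ^ (k - 1) \<partial>student (real d * p)) <
    real (k + d) * (\<integral>x. student_cdf p x ^ k \<partial>student (real d * p))"
proof -
  interpret S: student_space p by standard (rule p)
  have D: "real d * p > 0" using p d by simp
  interpret D: student_space "real d * p" by standard (rule D)
  interpret B: beta_prime_cdf "p - 1" "student_const p" "student_cdf p" by (rule S.beta_prime_cdf_student)
  let ?c = "student_const (real d * p)"
  let ?g = "\<lambda>x::real. (1 + x\<^sup>2) powr (-(real d * (p - 1 + 1) + 1) / 2)"
  have c: "?c > 0" by (rule student_const_pos[OF D])
  have dens: "D.density_fun x = ?c * ?g x" for x by (simp add: D.density_fun_def)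
  have "B.v = S.density_fun"
  proof
    fix x
    have "- (p - 1 + 2) / 2 = - (p + 1) / 2" by simp
    then show "B.v x = S.density_fun x" by (simp only: B.v_def S.density_fun_def)
  qed
  then have iv: "integrable lborel B.v" using S.integrable_density_fun by simp
  have ig: "integrable lborel ?g"
    using integrable_mult_right[OF D.integrable_density_fun, of "1 / ?c"] c unfolding dens by simp
  have int: "(\<integral>x. student_cdf p x ^ j \<partial>student (real d * p)) = ?c * (\<integral>x. student_cdf p x ^ j * ?g x \<partial>lborel)" for j
  proof -
    have "(\<integral>x. student_cdf p x ^ j \<partial>student (real d * p)) = (\<integral>x. D.density_fun x *\<^sub>R student_cdf p x ^ j \<partial>lborel)"
      unfolding D.student_eq
      by (rule integral_density) (use S.student_cdf_measurable D.density_fun_nonneg in auto)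
    also have "\<dots> = (\<integral>x. ?c * (student_cdf p x ^ j * ?g x) \<partial>lborel)"
      unfolding dens by (simp add: ac_simps)
    finally show ?thesis by simp
  qed
  have "real k * (\<integral>x. student_cdf p x ^ (k - 1) * ?g x \<partial>lborel) < real (k + d) * (\<integral>x. student_cdf p x ^ k * ?g x \<partial>lborel)"
    by (rule B.moment_inequality[OF iv ig k d])
  then have "?c * (real k * (\<integral>x. student_cdf p x ^ (k - 1) * ?g x \<partial>lborel)) < ?c * (real (k + d) * (\<integral>x. student_cdf p x ^ k * ?g x \<partial>lborel))"
    using c by simp
  then show ?thesis unfolding int by (simp only: ac_simps)
qed

theorem theorem8:
  fixes M :: "'w measure"
    and X :: "nat \<Rightarrow> 'w \<Rightarrow> (real^'d) \<times> real"
    and n :: nat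
    and \<alpha> :: real
  assumes "CARD('d) \<ge> 2"
    and "n \<ge> CARD('d) + 1"
    and "\<alpha> > -1"
    and "prob_space M"
    and "prob_space.indep_vars M (\<lambda>_. spherical_lebesgue) X {1..n}"
    and "\<And>i. i \<in> {1..n} \<Longrightarrow>
           distributed M spherical_lebesgue (X i) (\<lambda>y. ennreal (spherical_density \<alpha> y))"
  shows "prob_space.expectation M
             (\<lambda>\<omega>. real (f_number (CARD('d) - 1) (spherical_hull ((\<lambda>i. X i \<omega>) ` {1..n}))))
         > prob_space.expectation M
             (\<lambda>\<omega>. real (f_number (CARD('d) - 1) (spherical_hull ((\<lambda>i. X i \<omega>) ` {1..n-1}))))"
proof -
  interpret M: prob_space M by fact
  define d where "d = CARD('d)"
  have d: "d \<ge> 2" "d < n" using assms(1,2) by (simp_all add: d_def)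
  define p where "p = \<alpha> + 1"
  have p: "p > 0" using assms(3) by (simp add: p_def)
  define E where "E m = M.expectation (\<lambda>\<omega>. real (f_number (CARD('d) - 1) (spherical_hull ((\<lambda>i. X i \<omega>) ` {1..m}))))" for m
  define I where "I k = (\<integral>x. student_cdf p x ^ k \<partial>student (real d * p))" for k
  have E: "E m = real (m choose d) * (2 * I (m - d))" if "d < m" "m \<le> n" for m
    unfolding E_def I_def d_def p_def
  proof (rule expectation_f_number[OF _ assms(3,4)])
    show "M.indep_vars (\<lambda>_. spherical_lebesgue) X {1..m}"
      using assms(5) by (rule M.indep_vars_subset) (use that in auto)
  qed (use that assms(6) in \<open>auto simp: d_def\<close>)
  define k where "k = n - d"
  have k: "k \<ge> 1" "n = k + d" using d by (auto simp: k_def)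
  have ineq: "real k * I (k - 1) < real n * I k"
    unfolding I_def using student_moment_inequality[OF p k(1) d(1)] k(2) by simp
  have "E (n - 1) < E n"
  \<comment> \<open>For \<open>n - 1 = d\<close> points no point is left outside the hyperplane and
    the formula for \<open>E\<close> does not apply. Instead \<open>I 0 = 1\<close> and the moment
    inequality give \<open>E n > 2\<close>, against at most one facet.\<close>
  proof (cases "k = 1")
    case True
    interpret D: student_space "real d * p" by standard (use p d in simp)
    have "I 0 = 1" using D.prob_space by (simp add: I_def)
    then have "1 < real n * I 1" using ineq True by simp
    moreover have "n choose d = n" using True k(2) by simp
    ultimately have "2 < E n" using E[of n] d True by (simp add: k_def)
    moreover have "E (n - 1) \<le> (\<integral>\<omega>. 1 \<partial>M)"
      unfolding E_def
    \<comment> \<open>Only the constant bound has to be integrable: a nonintegrable function has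
      integral 0, which is below 1 as well.\<close>
    proof (rule integral_mono')
      fix \<omega> assume \<omega>: "\<omega> \<in> space M"
      have "norm (X i \<omega>) = 1" if "i \<in> {1..n - 1}" for i
      proof -
        have "X i \<in> M \<rightarrow>\<^sub>M spherical_lebesgue"
          by (rule distributed_measurable[OF assms(6)]) (use that in auto)
        from measurable_space[OF this \<omega>] show ?thesis by (simp add: half_sphere_def)
      qed
      then have "f_number (CARD('d) - 1) (spherical_hull ((\<lambda>i. X i \<omega>) ` {1..n - 1})) =
          card {B. facet_pattern (\<lambda>i. X i \<omega>) {1..n - 1} B}"
        using d by (intro f_number_spherical_hull) (auto simp: d_def)
      also have "\<dots> \<le> 1"
        by (rule card_facet_pattern_le_1) (use True k(2) in \<open>auto simp: d_def\<close>)
      finally show "real (f_number (CARD('d) - 1) (spherical_hull ((\<lambda>i. X i \<omega>) ` {1..n - 1}))) \<le> 1"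
        by simp
    qed simp_all
    ultimately show ?thesis by (simp add: M.prob_space)
  next
    case False
    then have "d < n - 1" using k by simp
    \<comment> \<open>Links the binomial coefficients of n and \<open>n - 1\<close>: after
      multiplication by n the comparison becomes the moment inequality.\<close>
    have absorb: "real k * real (n choose d) = real n * real ((n - 1) choose d)"
      using binomial_absorb_comp[of n d] k(2) by (metis add_diff_cancel_right' of_nat_mult)
    have "E (n - 1) = real ((n - 1) choose d) * (2 * I (k - 1))"
      using E[of "n - 1"] \<open>d < n - 1\<close> by (simp add: k_def)
    then have "real n * E (n - 1) = (real n * real ((n - 1) choose d)) * (2 * I (k - 1))" by simp
    also have "\<dots> = real (n choose d) * 2 * (real k * I (k - 1))"
      unfolding absorb[symmetric] by simp
    also have "\<dots> < real (n choose d) * 2 * (real n * I k)"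
      using ineq d by (intro mult_strict_left_mono) auto
    also have "\<dots> = real n * E n"
      using E[of n] d by (simp add: k_def)
    finally show ?thesis using d by simp
  qed
  then show ?thesis unfolding E_def .
qed

end
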